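(* Let $H=H(Q^1,Q^2,Q^3,Q^4)$ be the cubic graph constructed (as in the context) from cyclically $5$-edge connected permutation snarks $Q^1,\dots,Q^4$ with permutation $2$-factors $F^i$ not contained in any CDC of $Q^i$. Then $H$ is a cyclically $5$-edge connected permutation snark.
   Context: Basic notions. A circuit is a $2$-regular $2$-connected graph. A CDC of a graph $G$ is a set $S$ of subgraphs of $G$, every component of each of which is a circuit, such that every edge of $G$ lies in exactly two elements of $S$; a $2$-factor is contained in a CDC consisting of circuits if each of its circuits is an element of it (equivalently, there is a CDC in the general sense having the $2$-factor as an element). A cycle permutation graph is a cubic graph with a $2$-factor consisting of two chordless circuits (a permutation $2$-factor). A snark is a cyclically $4$-edge connected cubic graph of girth at least $5$ that is not $3$-edge colorable; a permutation snark is a cycle permutation graph that is a snark. $\lambda_c(G)$ is the minimum number of edges whose deletion yields two components each containing a circuit; cyclically $k$-edge connected means $\lambda_c\ge k$. The graphs $Q^i$ and $\widetilde Q^i$. For $i\in\{1,2,3,4\}$ let $Q^i$ be a cyclically $5$-edge connected permutation snark with a permutation $2$-factor $F^i$, with circuits $C^i_1,C^i_2$, such that $F^i$ is not contained in any CDC of $Q^i$. Label vertices so that $C^i_1$ contains a subpath with consecutive vertices $x^i_1,x^i_2,z^i_2,x^i_6$, and $C^i_2$ contains a subpath with consecutive vertices $x^i_4,z^i_1,x^i_5$, where $z^i_1z^i_2\in E(Q^i)$. Let $\widetilde Q^i$ be obtained from $Q^i$ by removing the edge $x^i_1x^i_2$ and the vertices $z^i_1,z^i_2$, and adding new vertices $y^i_1,\dots,y^i_6$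 and edges $e^i_3:=x^i_2y^i_3$ and $e^i_s:=x^i_sy^i_s$ for $s=1,2,4,5,6$. The graph $H$. In $\widetilde Q^1,\dots,\widetilde Q^4$ regard each $e^i_j$ as a half-edge (delete $y^i_j$), except $e^1_2,e^2_3,e^3_2,e^4_3$, which keep their degree-$1$ endvertices. $H$ is obtained from the disjoint union by gluing half-edges pairwise into single edges (gluing half-edges at $u$ and $v$ gives the edge $uv$): $e^1_1$ with $e^4_4$, $e^1_3$ with $e^4_5$; $e^4_1$ with $e^3_4$, $e^4_2$ with $e^3_5$; $e^3_1$ with $e^2_4$, $e^3_3$ with $e^2_5$; $e^2_1$ with $e^1_4$, $e^2_2$ with $e^1_5$; $e^1_6$ with $e^3_6$; $e^2_6$ with $e^4_6$; by identifying the degree-$1$ endvertices of $e^1_2$ and $e^3_2$ to one vertex $p$ and those of $e^2_3$ and $e^4_3$ to one vertex $q$; and by adding the edge $\alpha=pq$. *)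

theory Defs
  imports Main "HOL-Library.Extended_Nat"
begin

record 'a graph =
  verts :: "'a set"
  edges :: "'a set set"

definition simple_graph :: "'a graph \<Rightarrow> bool" where
  "simple_graph G \<longleftrightarrow> finite (verts G) \<and>
     (\<forall>e \<in> edges G. \<exists>u v. u \<in> verts G \<and> v \<in> verts G \<and> u \<noteq> v \<and> e = {u, v})"

definition subgraph :: "'a graph \<Rightarrow> 'a graph \<Rightarrow> bool" where
  "subgraph K G \<longleftrightarrow> simple_graph K \<and> verts K \<subseteq> verts G \<and> edges K \<subseteq> edges G"

definition induced_subgraph :: "'a graph \<Rightarrow> 'a set \<Rightarrow> 'a graph" where
  "induced_subgraph G U = \<lparr>verts = U, edges = {e \<in> edges G. e \<subseteq> U}\<rparr>"

definition delete_vertices :: "'a graph \<Rightarrow> 'a set \<Rightarrow> 'a graph" where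
  "delete_vertices G U = induced_subgraph G (verts G - U)"

definition delete_edges :: "'a graph \<Rightarrow> 'a set set \<Rightarrow> 'a graph" where
  "delete_edges G X = \<lparr>verts = verts G, edges = edges G - X\<rparr>"

definition degree :: "'a graph \<Rightarrow> 'a \<Rightarrow> nat" where
  "degree G v = card {e \<in> edges G. v \<in> e}"

definition regular :: "nat \<Rightarrow> 'a graph \<Rightarrow> bool" where
  "regular k G \<longleftrightarrow> (\<forall>v \<in> verts G. degree G v = k)"

definition cubic :: "'a graph \<Rightarrow> bool" where
  "cubic G \<longleftrightarrow> simple_graph G \<and> regular 3 G"

definition reachable :: "'a graph \<Rightarrow> 'a \<Rightarrow> 'a \<Rightarrow> bool" where
  "reachable G u v \<longleftrightarrow> (u, v) \<in> {(a, b). {a, b} \<in> edges G}\<^sup>*"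

definition connected :: "'a graph \<Rightarrow> bool" where
  "connected G \<longleftrightarrow> verts G \<noteq> {} \<and> (\<forall>u \<in> verts G. \<forall>v \<in> verts G. reachable G u v)"

definition components :: "'a graph \<Rightarrow> 'a graph set" where
  "components G = {induced_subgraph G {v \<in> verts G. reachable G u v} | u. u \<in> verts G}"

definition two_connected :: "'a graph \<Rightarrow> bool" where
  "two_connected G \<longleftrightarrow> 3 \<le> card (verts G) \<and> connected G \<and>
     (\<forall>v \<in> verts G. connected (delete_vertices G {v}))"

definition circuit :: "'a graph \<Rightarrow> bool" where
  "circuit C \<longleftrightarrow> simple_graph C \<and> regular 2 C \<and> two_connected C"

definition is_path :: "'a graph \<Rightarrow> 'a list \<Rightarrow> bool" where
  "is_path G vs \<longleftrightarrow> distinct vs \<and> set vs \<subseteq> verts G \<and> successively (\<lambda>u v. {u, v} \<in> edges G) vs"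

text \<open>The infimum is taken in the extended naturals, so a graph without circuits has
  infinite girth and a graph without a cycle-separating edge cut has infinite cyclic
  edge connectivity.\<close>

definition girth :: "'a graph \<Rightarrow> enat" where
  "girth G = (INF C \<in> {C. subgraph C G \<and> circuit C}. enat (card (edges C)))"

definition cyclic_edge_cut :: "'a graph \<Rightarrow> 'a set set \<Rightarrow> bool" where
  "cyclic_edge_cut G X \<longleftrightarrow> X \<subseteq> edges G \<and>
     (\<exists>A \<in> components (delete_edges G X). \<exists>B \<in> components (delete_edges G X). A \<noteq> B \<and>
        (\<exists>C. subgraph C A \<and> circuit C) \<and> (\<exists>C. subgraph C B \<and> circuit C))"

definition cyclic_edge_connectivity :: "'a graph \<Rightarrow> enat" where
  "cyclic_edge_connectivity G = (INF X \<in> {X. cyclic_edge_cut G X}. enat (card X))"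

definition cyclically_edge_connected :: "nat \<Rightarrow> 'a graph \<Rightarrow> bool" where
  "cyclically_edge_connected k G \<longleftrightarrow> enat k \<le> cyclic_edge_connectivity G"

definition three_edge_colorable :: "'a graph \<Rightarrow> bool" where
  "three_edge_colorable G \<longleftrightarrow> (\<exists>c :: 'a set \<Rightarrow> nat. (\<forall>e \<in> edges G. c e < 3) \<and>
     (\<forall>e \<in> edges G. \<forall>f \<in> edges G. e \<noteq> f \<and> e \<inter> f \<noteq> {} \<longrightarrow> c e \<noteq> c f))"

definition snark :: "'a graph \<Rightarrow> bool" where
  "snark G \<longleftrightarrow> cubic G \<and> cyclically_edge_connected 4 G \<and> 5 \<le> girth G \<and>
     \<not> three_edge_colorable G"

definition two_factor :: "'a graph \<Rightarrow> 'a graph \<Rightarrow> bool" where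
  "two_factor G F \<longleftrightarrow> subgraph F G \<and> verts F = verts G \<and> regular 2 F"

definition chordless :: "'a graph \<Rightarrow> 'a graph \<Rightarrow> bool" where
  "chordless G C \<longleftrightarrow> (\<forall>e \<in> edges G. e \<subseteq> verts C \<longrightarrow> e \<in> edges C)"

definition permutation_two_factor :: "'a graph \<Rightarrow> 'a graph \<Rightarrow> bool" where
  "permutation_two_factor G F \<longleftrightarrow> two_factor G F \<and> card (components F) = 2 \<and>
     (\<forall>C \<in> components F. circuit C \<and> chordless G C)"

definition cycle_permutation_graph :: "'a graph \<Rightarrow> bool" where
  "cycle_permutation_graph G \<longleftrightarrow> cubic G \<and> (\<exists>F. permutation_two_factor G F)"

definition permutation_snark :: "'a graph \<Rightarrow> bool" where
  "permutation_snark G \<longleftrightarrow> cycle_permutation_graph G \<and> snark G"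

definition is_CDC :: "'a graph \<Rightarrow> 'a graph set \<Rightarrow> bool" where
  "is_CDC G S \<longleftrightarrow>
     (\<forall>K \<in> S. subgraph K G \<and> (\<forall>C \<in> components K. circuit C)) \<and>
     (\<forall>e \<in> edges G. card {K \<in> S. e \<in> edges K} = 2)"

definition contained_in_CDC :: "'a graph \<Rightarrow> 'a graph \<Rightarrow> bool" where
  "contained_in_CDC G F \<longleftrightarrow>
     (\<exists>S. is_CDC G S \<and> (\<forall>K \<in> S. circuit K) \<and> components F \<subseteq> S)"


text \<open>The graph \<open>Q_tilde Q x z\<close> has the remaining vertices \<open>Old v\<close> of \<open>Q\<close> and the new
  vertices \<open>Y 1, \<dots>, Y 6\<close>. There is no label \<open>x 3\<close>: both \<open>Y 2\<close> and \<open>Y 3\<close> are attached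
  to \<open>x 2\<close>.\<close>

datatype 'a tvert = Old 'a | Y nat

definition Q_tilde :: "'a graph \<Rightarrow> (nat \<Rightarrow> 'a) \<Rightarrow> (nat \<Rightarrow> 'a) \<Rightarrow> 'a tvert graph" where
  "Q_tilde Q x z =
     (let R = delete_vertices (delete_edges Q {{x 1, x 2}}) {z 1, z 2} in
      \<lparr>verts = Old ` verts R \<union> Y ` {1..6},
       edges = (\<lambda>e. Old ` e) ` edges R \<union> {{Old (x 2), Y 3}} \<union>
               {{Old (x s), Y s} | s. s \<in> {1, 2, 4, 5, 6}}\<rparr>)"

text \<open>The pair \<open>(i, s)\<close> stands for the half-edge \<open>e\<^sup>i\<^sub>s\<close>.\<close>

definition glued_half_edges :: "((nat \<times> nat) \<times> (nat \<times> nat)) set" where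
  "glued_half_edges =
     {((1, 1), (4, 4)), ((1, 3), (4, 5)),
      ((4, 1), (3, 4)), ((4, 2), (3, 5)),
      ((3, 1), (2, 4)), ((3, 3), (2, 5)),
      ((2, 1), (1, 4)), ((2, 2), (1, 5)),
      ((1, 6), (3, 6)), ((2, 6), (4, 6))}"

text \<open>\<open>Copy i v\<close> is the vertex \<open>v\<close> of the \<open>i\<close>-th summand of the disjoint union.\<close>

datatype 'a hvert = Copy nat 'a | Vertex_p | Vertex_q

definition H_graph ::
    "(nat \<Rightarrow> 'a graph) \<Rightarrow> (nat \<Rightarrow> nat \<Rightarrow> 'a) \<Rightarrow> (nat \<Rightarrow> nat \<Rightarrow> 'a) \<Rightarrow> 'a hvert graph" where
  "H_graph Q x z =
     (let T = (\<lambda>i. Q_tilde (Q i) (x i) (z i)) in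
      \<lparr>verts = {Copy i v | i v. i \<in> {1..4} \<and> Old v \<in> verts (T i)} \<union> {Vertex_p, Vertex_q},
       edges =
         {{Copy i u, Copy i v} | i u v. i \<in> {1..4} \<and> {Old u, Old v} \<in> edges (T i)} \<union>
         {{Copy i u, Copy j v} | i s j t u v. ((i, s), (j, t)) \<in> glued_half_edges \<and>
            {Old u, Y s} \<in> edges (T i) \<and> {Old v, Y t} \<in> edges (T j)} \<union>
         {{Copy i u, Vertex_p} | i s u. (i, s) \<in> {(1, 2), (3, 2)} \<and>
            {Old u, Y s} \<in> edges (T i)} \<union>
         {{Copy i u, Vertex_q} | i s u. (i, s) \<in> {(2, 3), (4, 3)} \<and>
            {Old u, Y s} \<in> edges (T i)} \<union>
         {{Vertex_p, Vertex_q}}\<rparr>)"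

end

(* For cubic graphs with at least 7 vertices, cyclic 5-edge connectivity is equivalent to the
   statement that a vertex set with at least three vertices inside and outside has an edge cut
   of size at least 5; circuits of length at most 4 are then impossible as well.

   Connectivity: take a violating set U of H with smallest cut. In the i-th summand without the
   path x2, z2, z1, a cut with at least two vertices on each side has size at least 2, with
   equality only if U separates x4 from x5 and x1 from the third neighbour w of x2. Hence at most one summand is cut, and
   counting the remaining edges shows that U or its complement lies inside that summand, where
   the connectivity of Q i applies.

   Colouring: let s_i be the sum, in the Klein four-group, of the colours at x4 and x5 of the
   i-th summand. Since Q i is not colourable, s_{i+1} = 0 implies s_i = 0 along the ring of
   summands, so either all s_i vanish or none does. In both cases the values of the colours on
   the remaining half-edges propagate around the ring to two edges at p of the same colour.

   2-factor: the two paths left of C1 and C2 in each summand, and the path through x2, close up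
   to two induced circuits of H. *)

theory Submission
  imports Defs
begin

section \<open>Cuts and circuits in simple graphs\<close>

text \<open>For connectivity, circuits and components occur only where cyclic connectivity and girth
  are translated; in between only vertex sets and cuts are counted, because these restrict to a
  summand and add up over the ring. One map, \<open>port\<close>, gives at every surviving vertex a
  bijection between the neighbours in \<open>Q i\<close> and those in \<open>H\<close>. Degrees,
  colourings, 2-regularity and cuts are therefore compared one vertex at a time. A smallest
  violating cut is taken because no vertex then lies opposite to two of its neighbours: no core
  loses a single vertex, where the summand bound would not apply, and p, q and the vertices
  \<open>x2\<close> agree with a majority of their neighbours. The bound 2 alone is too weak, since
  two cut summands fit into four edges; its equality case excludes this. The chords at
  \<open>x6\<close> join opposite summands. They equate the colours that collide at p, and they
  supply the fifth cut edge when the side changes around the ring.\<close>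

definition nbrs :: "'a graph \<Rightarrow> 'a \<Rightarrow> 'a set" where
  "nbrs G v = {u. {v, u} \<in> edges G}"

text \<open>Each cut edge is recorded once, directed away from its end in \<open>U\<close>. The cut
  is then a disjoint sum over the vertices of \<open>U\<close>, so its size can be read off
  neighbourhoods.\<close>

definition cut :: "'a graph \<Rightarrow> 'a set \<Rightarrow> ('a \<times> 'a) set" where
  "cut G U = {(u, v). u \<in> U \<and> v \<notin> U \<and> {u, v} \<in> edges G}"

lemma even_if_add_double: "a + 2 * b = 2 * c \<Longrightarrow> even a" for a b c :: nat
  by presburger

lemma card_darts:
  assumes "finite E" "\<And>e. e \<in> E \<Longrightarrow> \<exists>u v. u \<noteq> v \<and> e = {u, v}"
  shows "card {(u, v). {u, v} \<in> E} = 2 * card E"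
proof -
  have eq: "{(u, v). {u, v} \<in> E} = (\<Union>e\<in>E. {(u, v). {u, v} = e})" by auto
  have two: "finite {(u, v). {u, v} = e} \<and> card {(u, v). {u, v} = e} = 2" if e: "e \<in> E" for e
  proof -
    obtain a b where ab: "a \<noteq> b" "e = {a, b}" using assms(2)[OF e] by blast
    then have "{(u, v). {u, v} = e} = {(a, b), (b, a)}" by (auto simp: doubleton_eq_iff)
    then show ?thesis using ab(1) by simp
  qed
  show ?thesis unfolding eq
    by (subst card_UN_disjoint) (use assms(1) two in auto)
qed

lemma simple_edgeD:
  assumes "simple_graph G" "{u, v} \<in> edges G"
  shows "u \<noteq> v" "u \<in> verts G" "v \<in> verts G"
proof -
  obtain a b where "a \<in> verts G" "b \<in> verts G" "a \<noteq> b" "{u, v} = {a, b}"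
    using assms unfolding simple_graph_def by metis
  then show "u \<noteq> v" "u \<in> verts G" "v \<in> verts G" by (auto simp: doubleton_eq_iff)
qed

lemma simple_edgeE:
  assumes "simple_graph G" "e \<in> edges G"
  obtains u v where "e = {u, v}" "u \<noteq> v" "u \<in> verts G" "v \<in> verts G"
  using assms unfolding simple_graph_def by metis

lemma finite_edges: "simple_graph G \<Longrightarrow> finite (edges G)"
  by (rule finite_subset[of _ "Pow (verts G)"]) (auto simp: simple_graph_def)

lemma finite_verts_subset: "simple_graph G \<Longrightarrow> U \<subseteq> verts G \<Longrightarrow> finite U"
  unfolding simple_graph_def using finite_subset by blast

lemma nbrs_sym: "u \<in> nbrs G v \<longleftrightarrow> v \<in> nbrs G u"
  by (simp add: nbrs_def insert_commute)

lemma nbrs_subset: "simple_graph G \<Longrightarrow> nbrs G v \<subseteq> verts G"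
  by (auto simp: nbrs_def dest: simple_edgeD)

lemma finite_nbrs: "simple_graph G \<Longrightarrow> finite (nbrs G v)"
  using nbrs_subset[of G v] finite_subset simple_graph_def by metis

lemma not_in_nbrs: "simple_graph G \<Longrightarrow> v \<notin> nbrs G v"
  using simple_edgeD(1)[of G v v] by (auto simp: nbrs_def)

lemma degree_eq_card_nbrs:
  assumes "simple_graph G"
  shows "degree G v = card (nbrs G v)"
proof -
  have "{e \<in> edges G. v \<in> e} = (\<lambda>u. {v, u}) ` nbrs G v"
  proof (intro equalityI subsetI)
    fix e assume "e \<in> {e \<in> edges G. v \<in> e}"
    then have e: "e \<in> edges G" "v \<in> e" by auto
    then obtain a b where "e = {a, b}" using assms simple_edgeE by metis
    then show "e \<in> (\<lambda>u. {v, u}) ` nbrs G v"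
      using e by (auto simp: nbrs_def insert_commute)
  qed (auto simp: nbrs_def)
  moreover have "inj_on (\<lambda>u. {v, u}) (nbrs G v)"
    by (auto simp: inj_on_def doubleton_eq_iff)
  ultimately show ?thesis by (simp add: degree_def card_image)
qed

lemma cubic_nbrs: "cubic G \<Longrightarrow> v \<in> verts G \<Longrightarrow> card (nbrs G v) = 3"
  by (simp add: cubic_def regular_def degree_eq_card_nbrs[symmetric])

lemma cut_eq_Sigma: "cut G U = Sigma U (\<lambda>v. nbrs G v - U)"
  by (auto simp: cut_def nbrs_def)

lemma finite_cut: "simple_graph G \<Longrightarrow> U \<subseteq> verts G \<Longrightarrow> finite (cut G U)"
  unfolding cut_eq_Sigma
  by (intro finite_SigmaI finite_Diff finite_nbrs finite_verts_subset)

lemma card_cut: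
  assumes "simple_graph G" "U \<subseteq> verts G"
  shows "card (cut G U) = (\<Sum>v\<in>U. card (nbrs G v - U))"
  unfolding cut_eq_Sigma
  using assms by (intro card_SigmaI) (auto intro: finite_nbrs finite_verts_subset)

lemma cut_complement:
  assumes "simple_graph G" "U \<subseteq> verts G"
  shows "card (cut G (verts G - U)) = card (cut G U)"
proof -
  have "cut G (verts G - U) = prod.swap ` cut G U"
  proof (intro equalityI subsetI)
    fix d assume "d \<in> cut G (verts G - U)"
    then have "prod.swap d \<in> cut G U"
      using simple_edgeD[OF assms(1)] by (auto simp: cut_def insert_commute)
    then show "d \<in> prod.swap ` cut G U" by (metis image_eqI swap_swap)
  next
    fix d assume "d \<in> prod.swap ` cut G U"
    then show "d \<in> cut G (verts G - U)"
      using simple_edgeD[OF assms(1)] assms(2) by (auto simp: cut_def insert_commute)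
  qed
  then show ?thesis by (simp add: card_image)
qed

lemma card_induced_darts:
  assumes "simple_graph G" "U \<subseteq> verts G"
  shows "(\<Sum>v\<in>U. card (nbrs G v \<inter> U)) = 2 * card {e \<in> edges G. e \<subseteq> U}"
proof -
  have "(\<Sum>v\<in>U. card (nbrs G v \<inter> U)) = card (Sigma U (\<lambda>v. nbrs G v \<inter> U))"
    using assms by (intro card_SigmaI[symmetric]) (auto intro: finite_nbrs finite_verts_subset)
  also have "Sigma U (\<lambda>v. nbrs G v \<inter> U) = {(u, v). {u, v} \<in> {e \<in> edges G. e \<subseteq> U}}"
    by (auto simp: nbrs_def)
  also have "card \<dots> = 2 * card {e \<in> edges G. e \<subseteq> U}"
  proof (rule card_darts)
    show "finite {e \<in> edges G. e \<subseteq> U}" using finite_edges[OF assms(1)] by simp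
    fix e assume "e \<in> {e \<in> edges G. e \<subseteq> U}"
    then show "\<exists>u v. u \<noteq> v \<and> e = {u, v}" using simple_edgeE[OF assms(1)] by (metis mem_Collect_eq)
  qed
  finally show ?thesis .
qed

text \<open>Degree sum over \<open>U\<close>: of the \<open>3 * card U\<close> darts starting in
  \<open>U\<close>, those that leave form the cut and the others pair up into edges inside. Besides
  the count this fixes the parity of the cut.\<close>

lemma card_cut_cubic:
  assumes "cubic G" "U \<subseteq> verts G"
  shows "card (cut G U) + 2 * card {e \<in> edges G. e \<subseteq> U} = 3 * card U"
proof -
  have s: "simple_graph G" using assms(1) by (simp add: cubic_def)
  have "card (nbrs G v - U) + card (nbrs G v \<inter> U) = 3" if "v \<in> U" for v
    using cubic_nbrs[OF assms(1), of v] that assms(2) finite_nbrs[OF s, of v]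
    by (metis (no_types, lifting) card_Int_Diff add.commute subsetD)
  then have "(\<Sum>v\<in>U. card (nbrs G v - U) + card (nbrs G v \<inter> U)) = (\<Sum>v\<in>U. 3)"
    by (intro sum.cong) auto
  then show ?thesis
    unfolding card_cut[OF s assms(2)] card_induced_darts[OF s assms(2), symmetric]
    by (simp add: sum.distrib)
qed

lemma reachable_refl: "reachable G u u"
  by (simp add: reachable_def)

lemma reachable_trans: "reachable G u v \<Longrightarrow> reachable G v w \<Longrightarrow> reachable G u w"
  by (simp add: reachable_def)

lemma reachable_edge: "{u, v} \<in> edges G \<Longrightarrow> reachable G u v"
  by (auto simp: reachable_def)

lemma reachable_sym: "reachable G u v \<Longrightarrow> reachable G v u"
  using sym_rtrancl[of "{(a, b). {a, b} \<in> edges G}"]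
  by (auto simp: reachable_def sym_def insert_commute)

lemma reachable_closed:
  assumes "reachable G u v" "u \<in> R" "\<And>a b. a \<in> R \<Longrightarrow> {a, b} \<in> edges G \<Longrightarrow> b \<in> R"
  shows "v \<in> R"
  using assms(1,2) unfolding reachable_def
  by (induction rule: rtrancl_induct) (auto intro: assms(3))

text \<open>An edge may be sent to a whole walk. This matters where the missing edge
  \<open>x1 x2\<close> of a summand is replaced by a detour through the next summand.\<close>

lemma reachable_map:
  assumes "reachable G u v" "\<And>a b. {a, b} \<in> edges G \<Longrightarrow> reachable K (f a) (f b)"
  shows "reachable K (f u) (f v)"
  using assms(1) unfolding reachable_def[of G]
  by (induction rule: rtrancl_induct) (auto intro: assms(2) reachable_trans reachable_refl)

lemma simple_induced: "simple_graph G \<Longrightarrow> U \<subseteq> verts G \<Longrightarrow> simple_graph (induced_subgraph G U)"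
  using finite_verts_subset[of G U]
  by (fastforce simp: simple_graph_def induced_subgraph_def)

lemma nbrs_induced: "v \<in> U \<Longrightarrow> nbrs (induced_subgraph G U) v = nbrs G v \<inter> U"
  by (auto simp: nbrs_def induced_subgraph_def)

text \<open>A component of the graph without \<open>v\<close> sends, by parity, either no or two edges to \<open>v\<close>, so every
  component contains both neighbours of \<open>v\<close>.\<close>

lemma circuit_if_connected_two_regular:
  assumes s: "simple_graph G" and r: "regular 2 G" and c: "connected G"
  shows "circuit G"
proof -
  have fin: "finite (verts G)" using s by (simp add: simple_graph_def)
  have deg: "card (nbrs G v) = 2" if "v \<in> verts G" for v
    using r that by (simp add: regular_def degree_eq_card_nbrs[OF s])
  have three: "3 \<le> card (verts G)"
  proof -
    obtain v where v: "v \<in> verts G" using c by (auto simp: connected_def)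
    have "card (insert v (nbrs G v)) = 3"
      using deg[OF v] not_in_nbrs[OF s] finite_nbrs[OF s] by simp
    moreover have "card (insert v (nbrs G v)) \<le> card (verts G)"
      by (rule card_mono[OF fin]) (use v nbrs_subset[OF s] in auto)
    ultimately show ?thesis by simp
  qed
  have "connected (delete_vertices G {v})" if v: "v \<in> verts G" for v
  proof -
    let ?D = "delete_vertices G {v}"
    have vD: "verts ?D = verts G - {v}" by (simp add: delete_vertices_def induced_subgraph_def)
    have eD: "{a, b} \<in> edges ?D \<longleftrightarrow> {a, b} \<in> edges G \<and> a \<noteq> v \<and> b \<noteq> v" for a b
      using simple_edgeD[OF s] by (auto simp: delete_vertices_def induced_subgraph_def)
    have key: "nbrs G v \<subseteq> {y. reachable ?D x y}" if x: "x \<in> verts G" "x \<noteq> v" for x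
    proof -
      let ?R = "{y. reachable ?D x y}"
      have xR: "x \<in> ?R" by (simp add: reachable_refl)
      have RV: "?R \<subseteq> verts G - {v}"
      proof
        fix y assume "y \<in> ?R"
        then have "reachable ?D x y" by simp
        then show "y \<in> verts G - {v}"
          by (rule reachable_closed) (use x eD simple_edgeD[OF s] in auto)
      qed
      have RG: "?R \<subseteq> verts G" using RV by auto
      have finR: "finite ?R" using RG fin by (rule finite_subset)
      have out: "nbrs G y - ?R \<subseteq> {v}" if "y \<in> ?R" for y
      proof
        fix b assume b: "b \<in> nbrs G y - ?R"
        show "b \<in> {v}"
        proof (rule ccontr)
          assume "b \<notin> {v}"
          then have "{y, b} \<in> edges ?D" using b that RV by (auto simp: eD nbrs_def)
          then have "reachable ?D x b" using that by (auto intro: reachable_trans reachable_edge)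
          then show False using b by simp
        qed
      qed
      have vR: "v \<notin> ?R" using RV by auto
      have outc: "card (nbrs G y - ?R) = of_bool (y \<in> nbrs G v)" if "y \<in> ?R" for y
      proof (cases "y \<in> nbrs G v")
        case True
        then have "nbrs G y - ?R = {v}" using out[OF that] vR by (auto simp: nbrs_sym[of v])
        then show ?thesis using True by simp
      next
        case False
        then have "nbrs G y - ?R = {}" using out[OF that] by (auto simp: nbrs_sym[of v])
        then show ?thesis using False by (metis card.empty of_bool_eq(1))
      qed
      have "(\<Sum>y\<in>?R. card (nbrs G y - ?R)) = card (?R \<inter> nbrs G v)"
        using finR by (subst sum.cong[OF refl outc]) (auto simp: sum_of_bool_eq)
      moreover have "(\<Sum>y\<in>?R. card (nbrs G y - ?R) + card (nbrs G y \<inter> ?R)) = (\<Sum>y\<in>?R. 2)"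
      proof (rule sum.cong)
        fix y assume "y \<in> ?R"
        then have "card (nbrs G y) = 2" using deg RG by blast
        then show "card (nbrs G y - ?R) + card (nbrs G y \<inter> ?R) = 2"
          using card_Int_Diff[OF finite_nbrs[OF s, of y], of ?R] by simp
      qed simp
      ultimately have "card (?R \<inter> nbrs G v) + 2 * card {e \<in> edges G. e \<subseteq> ?R} = 2 * card ?R"
        using card_induced_darts[OF s RG] by (simp add: sum.distrib)
      then have ev: "even (card (?R \<inter> nbrs G v))"
        by (rule even_if_add_double)
      \<comment> \<open>Without a neighbour of \<open>v\<close>, the set \<open>?R\<close> would be
        closed under all edges of \<open>G\<close>, against connectedness.\<close>
      have ne: "?R \<inter> nbrs G v \<noteq> {}"
      proof
        assume emp: "?R \<inter> nbrs G v = {}"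
        have "reachable G x v" using c x v by (auto simp: connected_def)
        then have "v \<in> ?R"
        proof (rule reachable_closed[OF _ xR])
          fix a b assume a: "a \<in> ?R" and "{a, b} \<in> edges G"
          then show "b \<in> ?R"
            using out[OF a] emp nbrs_sym[of v G a] by (auto simp: nbrs_def)
        qed
        then show False using vR by simp
      qed
      have "card (?R \<inter> nbrs G v) \<noteq> 0" using ne finR by auto
      then have "card (?R \<inter> nbrs G v) \<ge> 2" using ev
        by (cases "card (?R \<inter> nbrs G v) = 1") simp_all
      then have "?R \<inter> nbrs G v = nbrs G v"
        using deg[OF v] by (intro card_seteq) (auto simp: finite_nbrs[OF s])
      then show ?thesis by blast
    qed
    obtain a where a: "a \<in> nbrs G v" using deg[OF v] by fastforce
    then have "a \<in> verts ?D" using nbrs_subset[OF s] not_in_nbrs[OF s] vD by auto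
    moreover have "reachable ?D x y" if "x \<in> verts ?D" "y \<in> verts ?D" for x y
    proof -
      have "reachable ?D x a" "reachable ?D y a" using key a that vD by auto
      then show ?thesis by (blast intro: reachable_trans reachable_sym)
    qed
    ultimately show ?thesis unfolding connected_def by blast
  qed
  then show ?thesis using assms three by (simp add: circuit_def two_connected_def)
qed

section \<open>Edge cuts of cubic graphs\<close>

lemma even_card_sym_diff:
  assumes "finite A" "finite B" "even (card A) = even (card B)"
  shows "even (card ((A - B) \<union> (B - A)))"
proof -
  have "card ((A - B) \<union> (B - A)) = card (A - B) + card (B - A)"
    using assms by (intro card_Un_disjoint) auto
  moreover have "card A = card (A \<inter> B) + card (A - B)" "card B = card (A \<inter> B) + card (B - A)"
    using assms card_Int_Diff[of A B] card_Int_Diff[of B A] by (auto simp: Int_commute)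
  ultimately show ?thesis using assms(3) by auto
qed

text \<open>By pigeonhole two edge subsets have the same set of odd vertices, since a single vertex is
  never the set of odd vertices. A minimal nonempty edge set all of whose degrees are even,
  contained in their symmetric difference, is a circuit, because in a cubic graph an even
  positive degree is 2.\<close>

lemma ex_circuit_in_dense_set:
  assumes cub: "cubic G" and U: "U \<subseteq> verts G" "U \<noteq> {}"
    and dense: "card U \<le> card {e \<in> edges G. e \<subseteq> U}"
  shows "\<exists>C. subgraph C (induced_subgraph G U) \<and> circuit C"
proof -
  have s: "simple_graph G" using cub by (simp add: cubic_def)
  define E where "E = {e \<in> edges G. e \<subseteq> U}"
  have finE: "finite E" using finite_edges[OF s] by (simp add: E_def)
  have finU: "finite U" using finite_verts_subset[OF s U(1)] .
  have card2: "card e = 2" if "e \<in> E" for e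
    using that simple_edgeE[OF s, of e] by (force simp: E_def)
  define oddv where "oddv T = {v \<in> U. odd (card {e \<in> T. v \<in> e})}" for T :: "'a set set"
  obtain a where a: "a \<in> U" using U by auto
  \<comment> \<open>Counting incidences in two ways shows that the number of odd vertices is even,
    so it is never 1.\<close>
  have miss: "oddv T \<noteq> {a}" if T: "T \<subseteq> E" for T
  proof
    assume "oddv T = {a}"
    have fT: "finite T" using T finE finite_subset by blast
    have "(\<Sum>v\<in>U. card {e \<in> T. v \<in> e}) = (\<Sum>v\<in>U. \<Sum>e\<in>T. of_bool (v \<in> e))"
      using fT by (simp add: sum_of_bool_eq Int_def)
    also have "\<dots> = (\<Sum>e\<in>T. \<Sum>v\<in>U. of_bool (v \<in> e))" by (rule sum.swap)
    also have "\<dots> = (\<Sum>e\<in>T. 2)"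
    proof (rule sum.cong)
      fix e assume e: "e \<in> T"
      then have "U \<inter> e = e" using T by (auto simp: E_def)
      then show "(\<Sum>v\<in>U. of_bool (v \<in> e)) = (2::nat)"
        using finU card2 e T by (auto simp: sum_of_bool_eq)
    qed simp
    finally have "even (\<Sum>v\<in>U. card {e \<in> T. v \<in> e})" by simp
    then have "even (card (oddv T))" using finU by (simp add: even_sum_iff oddv_def)
    then show False using \<open>oddv T = {a}\<close> by simp
  qed
  have "\<not> inj_on oddv (Pow E)"
  proof
    assume inj: "inj_on oddv (Pow E)"
    have "oddv ` Pow E \<subseteq> Pow U - {{a}}" using miss by (auto simp: oddv_def)
    then have "card (Pow E) \<le> card (Pow U - {{a}})"
      using inj finU by (intro card_inj_on_le) auto
    also have "\<dots> < card (Pow U)" using a finU by (intro psubset_card_mono) auto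
    also have "\<dots> \<le> card (Pow E)"
      using dense finU finE by (simp add: card_Pow E_def[symmetric])
    finally show False by simp
  qed
  then obtain T1 T2 where T: "T1 \<subseteq> E" "T2 \<subseteq> E" "T1 \<noteq> T2" "oddv T1 = oddv T2"
    by (auto simp: inj_on_def)
  define ev where "ev D \<longleftrightarrow> D \<subseteq> E \<and> D \<noteq> {} \<and> (\<forall>v. even (card {e \<in> D. v \<in> e}))" for D
  have "ev ((T1 - T2) \<union> (T2 - T1))"
  proof -
    have "even (card {e \<in> (T1 - T2) \<union> (T2 - T1). v \<in> e})" for v
    proof (cases "v \<in> U")
      case True
      have "finite T1" "finite T2" using T finE finite_subset by blast+
      moreover have "even (card {e \<in> T1. v \<in> e}) = even (card {e \<in> T2. v \<in> e})"
        using T(4) True by (auto simp: oddv_def)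
      ultimately have "even (card (({e \<in> T1. v \<in> e} - {e \<in> T2. v \<in> e}) \<union> ({e \<in> T2. v \<in> e} - {e \<in> T1. v \<in> e})))"
        by (intro even_card_sym_diff) auto
      also have "({e \<in> T1. v \<in> e} - {e \<in> T2. v \<in> e}) \<union> ({e \<in> T2. v \<in> e} - {e \<in> T1. v \<in> e}) =
         {e \<in> (T1 - T2) \<union> (T2 - T1). v \<in> e}" by blast
      finally show ?thesis .
    next
      case False
      then have "{e \<in> (T1 - T2) \<union> (T2 - T1). v \<in> e} = {}" using T by (auto simp: E_def)
      then show ?thesis by (metis card.empty even_zero)
    qed
    moreover have "(T1 - T2) \<union> (T2 - T1) \<noteq> {}" using T(3) by blast
    moreover have "(T1 - T2) \<union> (T2 - T1) \<subseteq> E" using T by blast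
    ultimately show ?thesis unfolding ev_def by blast
  qed
  then obtain D where D: "ev D" and D_min: "\<And>D'. ev D' \<Longrightarrow> card D \<le> card D'"
    using ex_has_least_nat[of ev _ card] by blast
  have DE: "D \<subseteq> E" and Dne: "D \<noteq> {}" and Deven: "\<And>v. even (card {e \<in> D. v \<in> e})"
    using D by (auto simp: ev_def)
  have finD: "finite D" using DE finE finite_subset by blast
  define C where "C = \<lparr>verts = \<Union> D, edges = D\<rparr>"
  have DU: "\<Union> D \<subseteq> U" using DE by (auto simp: E_def)
  have sC: "simple_graph C"
    unfolding simple_graph_def
  proof (intro conjI ballI)
    show "finite (verts C)" using DU finU finite_subset by (auto simp: C_def)
    fix e assume e: "e \<in> edges C"
    then have "e \<in> edges G" using DE by (auto simp: C_def E_def)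
    then obtain u v where "e = {u, v}" "u \<noteq> v" using simple_edgeE[OF s] by metis
    moreover from this have "u \<in> verts C" "v \<in> verts C" using e by (auto simp: C_def)
    ultimately show "\<exists>u v. u \<in> verts C \<and> v \<in> verts C \<and> u \<noteq> v \<and> e = {u, v}" by blast
  qed
  have "regular 2 C"
    unfolding regular_def
  proof
    fix v assume v: "v \<in> verts C"
    then have "card {e \<in> D. v \<in> e} \<noteq> 0" using finD by (auto simp: C_def)
    moreover have "card {e \<in> D. v \<in> e} \<le> card {e \<in> edges G. v \<in> e}"
      using DE finite_edges[OF s] by (intro card_mono) (auto simp: E_def)
    moreover have "card {e \<in> edges G. v \<in> e} = 3"
    proof -
      have "v \<in> verts G" using v DU U(1) by (auto simp: C_def)
      then show ?thesis using cub by (simp add: cubic_def regular_def degree_def)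
    qed
    ultimately have "card {e \<in> D. v \<in> e} \<in> {1, 2, 3}" by auto
    then show "degree C v = 2" using Deven[of v] by (auto simp: degree_def C_def)
  qed
  moreover have "connected C"
    unfolding connected_def
  proof (intro conjI ballI)
    show "verts C \<noteq> {}"
    proof -
      obtain e where e: "e \<in> D" using Dne by auto
      then have "e \<noteq> {}" using card2 DE by fastforce
      then show ?thesis using e by (auto simp: C_def)
    qed
    fix u v assume u: "u \<in> verts C" and v: "v \<in> verts C"
    let ?R = "{y. reachable C u y}"
    let ?D = "{e \<in> D. e \<subseteq> ?R}"
    have full: "e \<subseteq> ?R" if e: "e \<in> D" "x \<in> e" "x \<in> ?R" for e x
    proof -
      have "e \<in> edges G" using e DE by (auto simp: E_def)
      then obtain y where y: "e = {x, y}" using simple_edgeE[OF s, of e] e(2) by auto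
      then have "reachable C x y" using e by (intro reachable_edge) (simp add: C_def)
      then show ?thesis using e(3) y by (auto intro: reachable_trans)
    qed
    \<comment> \<open>Restricting \<open>D\<close> to the component of \<open>u\<close> changes no
      degree there and makes all others 0; minimality then leaves only one component.\<close>
    have "ev ?D"
      unfolding ev_def
    proof (intro conjI allI)
      show "?D \<subseteq> E" using DE by auto
      obtain e where "e \<in> D" "u \<in> e" using u by (auto simp: C_def)
      then show "?D \<noteq> {}" using full[of e u] by (auto simp: reachable_refl)
      fix x
      show "even (card {e \<in> ?D. x \<in> e})"
      proof (cases "x \<in> ?R")
        case True
        then have "{e \<in> ?D. x \<in> e} = {e \<in> D. x \<in> e}" using full by blast
        then show ?thesis using Deven by simp
      next
        case False
        then have "{e \<in> ?D. x \<in> e} = {}" by auto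
        then show ?thesis by (metis card.empty even_zero)
      qed
    qed
    then have "?D = D" using D_min finD by (intro card_seteq) auto
    moreover obtain e where "e \<in> D" "v \<in> e" using v by (auto simp: C_def)
    ultimately show "reachable C u v" by blast
  qed
  ultimately have "circuit C" using sC circuit_if_connected_two_regular by blast
  moreover have "subgraph C (induced_subgraph G U)"
    using sC DU DE by (auto simp: subgraph_def induced_subgraph_def C_def E_def)
  ultimately show ?thesis by blast
qed

section \<open>Cyclic 5-edge connectivity in terms of vertex sets\<close>

definition well_separated :: "'a graph \<Rightarrow> bool" where
  "well_separated G \<longleftrightarrow> (\<forall>U \<subseteq> verts G. 3 \<le> card U \<longrightarrow> 3 \<le> card (verts G - U) \<longrightarrow> 5 \<le> card (cut G U))"

text \<open>By \<open>card_cut_cubic\<close>, \<open>U\<close> spans at least \<open>card U\<close>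
  edges as soon as its cut has at most \<open>card U\<close> elements. For four or more vertices
  this is clear; for three the cut has odd size, hence at most 3. The threshold three is sharp: two
  adjacent vertices span one edge and have a cut of size 4.\<close>

lemma ex_circuit_if_small_cut:
  assumes "cubic G" "U \<subseteq> verts G" "3 \<le> card U" "card (cut G U) \<le> 4"
  shows "\<exists>C. subgraph C (induced_subgraph G U) \<and> circuit C"
  using card_cut_cubic[OF assms(1,2)] assms by (intro ex_circuit_in_dense_set) auto

lemma circuit_card_verts: "circuit C \<Longrightarrow> 3 \<le> card (verts C)"
  by (simp add: circuit_def two_connected_def)

lemma in_components: "u \<in> verts G \<Longrightarrow> induced_subgraph G {v \<in> verts G. reachable G u v} \<in> components G"
  by (auto simp: components_def)


lemma card_cut_edges:
  assumes "simple_graph G"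
  shows "card {e \<in> edges G. \<exists>a b. e = {a, b} \<and> a \<in> U \<and> b \<notin> U} = card (cut G U)"
proof -
  have "{e \<in> edges G. \<exists>a b. e = {a, b} \<and> a \<in> U \<and> b \<notin> U} = (\<lambda>(a, b). {a, b}) ` cut G U"
    by (auto simp: cut_def image_iff)
  moreover have "inj_on (\<lambda>(a, b). {a, b}) (cut G U)"
    by (auto simp: inj_on_def cut_def doubleton_eq_iff)
  ultimately show ?thesis by (simp add: card_image)
qed

text \<open>With the cut edges deleted no walk leaves \<open>U\<close>, so the component around the
  connected graph \<open>C\<close> stays inside \<open>U\<close>. Nonemptiness is recorded in order
  to tell apart the components found on the two sides.\<close>

lemma circuit_in_component:
  assumes s: "simple_graph G" and C: "subgraph C (induced_subgraph G U)" "circuit C" and U: "U \<subseteq> verts G"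
    and X: "X = {e \<in> edges G. \<exists>a b. e = {a, b} \<and> a \<in> U \<and> b \<notin> U}"
  shows "\<exists>A\<in>components (delete_edges G X). verts A \<subseteq> U \<and> verts A \<noteq> {} \<and> (\<exists>C. subgraph C A \<and> circuit C)"
proof -
  let ?D = "delete_edges G X"
  have CU: "verts C \<subseteq> U" and CE: "edges C \<subseteq> {e \<in> edges G. e \<subseteq> U}" and sC: "simple_graph C"
    using C(1) by (auto simp: subgraph_def induced_subgraph_def)
  have cC: "connected C" using C(2) by (simp add: circuit_def two_connected_def)
  obtain u where u: "u \<in> verts C" using cC by (auto simp: connected_def)
  let ?R = "{v \<in> verts ?D. reachable ?D u v}"
  let ?A = "induced_subgraph ?D ?R"
  have ED: "edges C \<subseteq> edges ?D" using CE X by (auto simp: delete_edges_def doubleton_eq_iff)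
  have VD: "verts ?D = verts G" by (simp add: delete_edges_def)
  have RU: "?R \<subseteq> U"
  proof
    fix v assume "v \<in> ?R"
    then have "reachable ?D u v" by simp
    then show "v \<in> U"
      by (rule reachable_closed) (use u CU X in \<open>auto simp: delete_edges_def\<close>)
  qed
  have VR: "verts C \<subseteq> ?R"
  proof
    fix v assume v: "v \<in> verts C"
    then have "reachable C u v" using cC u by (auto simp: connected_def)
    then have "reachable ?D u v"
      by (rule reachable_map[where f = "\<lambda>x. x"]) (use ED in \<open>auto intro: reachable_edge\<close>)
    then show "v \<in> ?R" using v CU U VD by auto
  qed
  have "e \<subseteq> verts C" if "e \<in> edges C" for e using simple_edgeE[OF sC that] by auto
  then have "subgraph C ?A" using sC VR ED by (fastforce simp: subgraph_def induced_subgraph_def)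
  moreover have "?A \<in> components ?D" using u CU U VD by (intro in_components) auto
  moreover have "verts ?A \<subseteq> U" "verts ?A \<noteq> {}"
    using RU u VR by (auto simp: induced_subgraph_def)
  ultimately show ?thesis using C(2) by blast
qed

lemma well_separated_if_cyclically_5_connected:
  assumes cub: "cubic G" and c5: "cyclically_edge_connected 5 G"
  shows "well_separated G"
  unfolding well_separated_def
proof (intro allI impI)
  fix U assume U: "U \<subseteq> verts G" "3 \<le> card U" "3 \<le> card (verts G - U)"
  have s: "simple_graph G" using cub by (simp add: cubic_def)
  show "5 \<le> card (cut G U)"
  proof (rule ccontr)
    assume "\<not> 5 \<le> card (cut G U)"
    then have small: "card (cut G U) \<le> 4" by simp
    let ?W = "verts G - U"
    let ?X = "{e \<in> edges G. \<exists>a b. e = {a, b} \<and> a \<in> U \<and> b \<notin> U}"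
    obtain C where "subgraph C (induced_subgraph G U)" "circuit C"
      using ex_circuit_if_small_cut[OF cub U(1,2) small] by blast
    from circuit_in_component[OF s this U(1) refl]
    obtain A where A: "A \<in> components (delete_edges G ?X)" "verts A \<subseteq> U" "verts A \<noteq> {}"
      "\<exists>C. subgraph C A \<and> circuit C" by blast
    \<comment> \<open>The same edge set is the cut seen from the complement, so a single deletion
      produces a component with a circuit on either side.\<close>
    have XW: "?X = {e \<in> edges G. \<exists>a b. e = {a, b} \<and> a \<in> ?W \<and> b \<notin> ?W}"
    proof -
      have "\<exists>a b. e = {a, b} \<and> a \<in> ?W \<and> b \<notin> ?W"
        if "e \<in> edges G" "e = {a, b}" "a \<in> U" "b \<notin> U" for e a b
        using that simple_edgeD[OF s, of a b] by (intro exI[of _ b] exI[of _ a]) auto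
      moreover have "\<exists>a b. e = {a, b} \<and> a \<in> U \<and> b \<notin> U"
        if "e \<in> edges G" "e = {a, b}" "a \<in> ?W" "b \<notin> ?W" for e a b
        using that simple_edgeD[OF s, of a b] by (intro exI[of _ b] exI[of _ a]) auto
      ultimately show ?thesis by blast
    qed
    have "card (cut G ?W) \<le> 4" using small cut_complement[OF s U(1)] by simp
    then obtain C where "subgraph C (induced_subgraph G ?W)" "circuit C"
      using ex_circuit_if_small_cut[OF cub _ U(3)] by blast
    from circuit_in_component[OF s this _ XW]
    obtain B where B: "B \<in> components (delete_edges G ?X)" "verts B \<subseteq> ?W"
      "\<exists>C. subgraph C B \<and> circuit C" by blast
    have "A \<noteq> B" using A(2,3) B(2) by auto
    then have "cyclic_edge_cut G ?X"
      unfolding cyclic_edge_cut_def using A B by blast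
    then have "cyclic_edge_connectivity G \<le> enat (card ?X)"
      unfolding cyclic_edge_connectivity_def by (intro INF_lower) simp
    also have "card ?X = card (cut G U)" by (rule card_cut_edges[OF s])
    finally have "enat 5 \<le> enat (card (cut G U))"
      using c5 order_trans unfolding cyclically_edge_connected_def by blast
    then show False using small by simp
  qed
qed

lemma component_closed:
  assumes "A \<in> components K" "a \<in> verts A" "{a, b} \<in> edges K" "b \<in> verts K"
  shows "b \<in> verts A"
  using assms(1,2,4) reachable_trans[OF _ reachable_edge[OF assms(3)]]
  by (auto simp: components_def induced_subgraph_def)

lemma components_eq_or_disjoint:
  assumes "A \<in> components K" "B \<in> components K" "v \<in> verts A" "v \<in> verts B"
  shows "A = B"
proof -
  obtain a b where A: "A = induced_subgraph K {w \<in> verts K. reachable K a w}"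
    and B: "B = induced_subgraph K {w \<in> verts K. reachable K b w}"
    using assms by (auto simp: components_def)
  have "reachable K a v" "reachable K b v" using assms(3,4) by (auto simp: A B induced_subgraph_def)
  then have "reachable K a w \<longleftrightarrow> reachable K b w" for w
    by (meson reachable_sym reachable_trans)
  then show ?thesis by (simp add: A B)
qed

text \<open>For a cyclic cut \<open>X\<close>, separation is applied to the vertex set of one of the
  two components: every edge leaving it lies in \<open>X\<close>, and on both sides a circuit
  provides three vertices.\<close>

lemma cyclically_5_connected_if_well_separated:
  assumes cub: "cubic G" and ws: "well_separated G"
  shows "cyclically_edge_connected 5 G"
  unfolding cyclically_edge_connected_def cyclic_edge_connectivity_def
proof (rule INF_greatest)
  fix X assume "X \<in> {X. cyclic_edge_cut G X}"
  then obtain A B CA CB where X: "X \<subseteq> edges G"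
    and A: "A \<in> components (delete_edges G X)" "subgraph CA A" "circuit CA"
    and B: "B \<in> components (delete_edges G X)" "subgraph CB B" "circuit CB" and "A \<noteq> B"
    unfolding cyclic_edge_cut_def by blast
  have s: "simple_graph G" using cub by (simp add: cubic_def)
  have sub: "verts A \<subseteq> verts G" "verts B \<subseteq> verts G"
    using A(1) B(1) by (auto simp: components_def induced_subgraph_def delete_edges_def)
  have fin: "finite (verts G)" using s by (simp add: simple_graph_def)
  have disj: "verts A \<inter> verts B = {}" using \<open>A \<noteq> B\<close> components_eq_or_disjoint[OF A(1) B(1)] by blast
  have "card (verts CA) \<le> card (verts A)" "card (verts CB) \<le> card (verts G - verts A)"
    using A(2) B(2) sub disj fin by (auto simp: subgraph_def intro!: card_mono intro: finite_subset)
  then have "5 \<le> card (cut G (verts A))"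
    using ws sub circuit_card_verts[OF A(3)] circuit_card_verts[OF B(3)]
    unfolding well_separated_def by auto
  also have "\<dots> = card {e \<in> edges G. \<exists>a b. e = {a, b} \<and> a \<in> verts A \<and> b \<notin> verts A}"
    by (rule card_cut_edges[OF s, symmetric])
  also have "\<dots> \<le> card X"
  proof (rule card_mono)
    show "finite X" using X finite_edges[OF s] finite_subset by blast
    show "{e \<in> edges G. \<exists>a b. e = {a, b} \<and> a \<in> verts A \<and> b \<notin> verts A} \<subseteq> X"
    proof (rule subsetI, rule ccontr)
      fix e assume e: "e \<in> {e \<in> edges G. \<exists>a b. e = {a, b} \<and> a \<in> verts A \<and> b \<notin> verts A}" "e \<notin> X"
      then obtain a b where ab: "e = {a, b}" "a \<in> verts A" "b \<notin> verts A" "{a, b} \<in> edges (delete_edges G X)"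
        by (auto simp: delete_edges_def)
      then have "b \<in> verts (delete_edges G X)"
        using simple_edgeD[OF s, of a b] by (auto simp: delete_edges_def)
      then show False using component_closed[OF A(1) ab(2,4)] ab(3) by blast
    qed
  qed
  finally show "enat 5 \<le> enat (card X)" by simp
qed

text \<open>A vertex of a circuit has at most one edge leaving the circuit, so a circuit of length
  at most 4 has a cut of size at most 4. The constant 7 guarantees three vertices outside
  it.\<close>

lemma girth_ge_5_if_well_separated:
  assumes cub: "cubic G" and ws: "well_separated G" and big: "7 \<le> card (verts G)"
  shows "5 \<le> girth G"
  unfolding girth_def
proof (rule INF_greatest)
  fix C assume "C \<in> {C. subgraph C G \<and> circuit C}"
  then have C: "subgraph C G" "circuit C" by auto
  have s: "simple_graph G" using cub by (simp add: cubic_def)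
  have sC: "simple_graph C" and VC: "verts C \<subseteq> verts G" and EC: "edges C \<subseteq> edges G"
    using C(1) by (auto simp: subgraph_def)
  have deg: "card (nbrs C v) = 2" if "v \<in> verts C" for v
    using C(2) that by (simp add: circuit_def regular_def degree_eq_card_nbrs[OF sC])
  have one: "card (nbrs G v - verts C) \<le> 1" if v: "v \<in> verts C" for v
  proof -
    have sub: "nbrs C v \<subseteq> nbrs G v" using EC by (auto simp: nbrs_def)
    have "card (nbrs G v - verts C) \<le> card (nbrs G v - nbrs C v)"
      using finite_nbrs[OF s] nbrs_subset[OF sC] by (intro card_mono) auto
    also have "\<dots> = card (nbrs G v) - card (nbrs C v)"
      using sub finite_nbrs[OF sC] by (intro card_Diff_subset) auto
    also have "\<dots> = 1" using cubic_nbrs[OF cub] VC v deg by auto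
    finally show ?thesis .
  qed
  have "card (cut G (verts C)) \<le> (\<Sum>v\<in>verts C. 1)"
    unfolding card_cut[OF s VC] using one by (intro sum_mono) auto
  then have cutle: "card (cut G (verts C)) \<le> card (verts C)" by simp
  have "(\<Sum>v\<in>verts C. card (nbrs C v \<inter> verts C)) = (\<Sum>v\<in>verts C. 2)"
    using nbrs_subset[OF sC] deg by (intro sum.cong) (auto simp: Int_absorb2)
  moreover have "{e \<in> edges C. e \<subseteq> verts C} = edges C"
    using simple_edgeE[OF sC] by blast
  ultimately have eq: "card (edges C) = card (verts C)"
    using card_induced_darts[OF sC, of "verts C"] by simp
  show "5 \<le> enat (card (edges C))"
  proof (rule ccontr)
    assume "\<not> 5 \<le> enat (card (edges C))"
    then have "\<not> enat 5 \<le> enat (card (edges C))" by (simp add: numeral_eq_enat)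
    then have small: "card (verts C) \<le> 4" using eq by simp
    have "card (verts G - verts C) = card (verts G) - card (verts C)"
      using VC s by (intro card_Diff_subset) (auto simp: simple_graph_def intro: finite_verts_subset[OF s])
    then have "5 \<le> card (cut G (verts C))"
      using ws VC circuit_card_verts[OF C(2)] big small unfolding well_separated_def by auto
    then show False using cutle small by simp
  qed
qed

lemma cut_pair_ge_4:
  assumes cub: "cubic G" and W: "W \<subseteq> verts G" "card W = 2"
  shows "4 \<le> card (cut G W)"
proof -
  have s: "simple_graph G" using cub by (simp add: cubic_def)
  have "{e \<in> edges G. e \<subseteq> W} \<subseteq> {W}"
  proof
    fix e assume e: "e \<in> {e \<in> edges G. e \<subseteq> W}"
    then have "card e = 2" using simple_edgeE[OF s, of e] by force
    then show "e \<in> {W}" using e W(2)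
      by (metis (no_types, lifting) card_subset_eq card.infinite mem_Collect_eq singletonI zero_neq_numeral)
  qed
  then have "card {e \<in> edges G. e \<subseteq> W} \<le> card {W}" by (intro card_mono) auto
  then show ?thesis using card_cut_cubic[OF cub W(1)] W(2) by simp
qed

text \<open>Covers sides with only two vertices, which arise when a subset of a summand is extended
  without splitting the removed path.\<close>

lemma cut_ge_4:
  assumes cub: "cubic G" and ws: "well_separated G" and U: "U \<subseteq> verts G"
    and "2 \<le> card U" "2 \<le> card (verts G - U)"
  shows "4 \<le> card (cut G U)"
proof -
  have s: "simple_graph G" using cub by (simp add: cubic_def)
  consider "card U = 2" | "card (verts G - U) = 2" | "3 \<le> card U" "3 \<le> card (verts G - U)"
    using assms by linarith
  then show ?thesis
  proof cases
    case 1
    then show ?thesis using cut_pair_ge_4[OF cub U] by simp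
  next
    case 2
    then show ?thesis using cut_pair_ge_4[OF cub, of "verts G - U"] cut_complement[OF s U] by auto
  next
    case 3
    then have "5 \<le> card (cut G U)" using ws U unfolding well_separated_def by blast
    then show ?thesis by simp
  qed
qed

lemma cut_remove_vertex:
  assumes "simple_graph G" "U \<subseteq> verts G" "v \<in> U"
  shows "card (cut G (U - {v})) + card (nbrs G v - U) = card (cut G U) + card (nbrs G v \<inter> U)"
proof -
  have fin: "finite (cut G U)" "finite (cut G (U - {v}))"
    using assms by (auto intro: finite_cut)
  let ?C = "{(a, b). a \<in> U - {v} \<and> b \<notin> U \<and> {a, b} \<in> edges G}"
  have fC: "finite ?C" by (rule finite_subset[OF _ fin(1)]) (auto simp: cut_def)
  have fn: "finite (nbrs G v)" by (rule finite_nbrs[OF assms(1)])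
  have "cut G U = ?C \<union> Pair v ` (nbrs G v - U)" using assms(3) by (auto simp: cut_def nbrs_def)
  moreover have "card (?C \<union> Pair v ` (nbrs G v - U)) = card ?C + card (Pair v ` (nbrs G v - U))"
    using fC fn by (intro card_Un_disjoint) auto
  moreover have "card (Pair v ` (nbrs G v - U)) = card (nbrs G v - U)"
    by (intro card_image) (simp add: inj_on_def)
  moreover have "cut G (U - {v}) = ?C \<union> (\<lambda>u. (u, v)) ` (nbrs G v \<inter> U)"
    using assms(3) not_in_nbrs[OF assms(1), of v] by (auto simp: cut_def nbrs_def insert_commute)
  moreover have "card (?C \<union> (\<lambda>u. (u, v)) ` (nbrs G v \<inter> U)) = card ?C + card ((\<lambda>u. (u, v)) ` (nbrs G v \<inter> U))"
    using fC fn assms(3) by (intro card_Un_disjoint) auto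
  moreover have "card ((\<lambda>u. (u, v)) ` (nbrs G v \<inter> U)) = card (nbrs G v \<inter> U)"
    by (intro card_image) (simp add: inj_on_def)
  ultimately show ?thesis by simp
qed

text \<open>A violating set with the smallest possible cut: moving a vertex with two neighbours on the
  other side would make the cut smaller.\<close>

lemma ex_stable_cut:
  assumes cub: "cubic G" and nws: "\<not> well_separated G"
  obtains U where "U \<subseteq> verts G" "3 \<le> card U" "3 \<le> card (verts G - U)" "card (cut G U) \<le> 4"
    "\<And>v. v \<in> U \<Longrightarrow> card (nbrs G v - U) \<le> 1"
    "\<And>v. v \<in> verts G - U \<Longrightarrow> card (nbrs G v - (verts G - U)) \<le> 1"
proof -
  have s: "simple_graph G" using cub by (simp add: cubic_def)
  have fin: "finite (verts G)" using s by (simp add: simple_graph_def)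
  define bad where "bad U \<longleftrightarrow> U \<subseteq> verts G \<and> 3 \<le> card U \<and> 3 \<le> card (verts G - U) \<and> card (cut G U) \<le> 4" for U
  have "\<exists>U. bad U" using nws unfolding well_separated_def bad_def by force
  then obtain U where U: "bad U" and least: "\<And>U'. bad U' \<Longrightarrow> card (cut G U) \<le> card (cut G U')"
    using ex_has_least_nat[of bad _ "\<lambda>U. card (cut G U)"] by blast
  have stable: "card (nbrs G v - W) \<le> 1"
    if W: "bad W" "\<And>U'. bad U' \<Longrightarrow> card (cut G W) \<le> card (cut G U')" and v: "v \<in> W" for v W
  proof (rule ccontr)
    assume "\<not> card (nbrs G v - W) \<le> 1"
    then have two: "2 \<le> card (nbrs G v - W)" by simp
    have WV: "W \<subseteq> verts G" and finW: "finite W" using W(1) fin finite_subset by (auto simp: bad_def)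
    have "card (nbrs G v - W) + card (nbrs G v \<inter> W) = 3"
      using cubic_nbrs[OF cub, of v] v WV card_Int_Diff[OF finite_nbrs[OF s], of v W] by auto
    then have less: "card (cut G (W - {v})) < card (cut G W)"
      using cut_remove_vertex[OF s WV v] two by linarith
    have W3: "card W \<ge> 3" using W(1) by (simp add: bad_def)
    have "verts G - (W - {v}) = insert v (verts G - W)" using v WV by auto
    then have co: "card (verts G - (W - {v})) \<ge> 4" using W(1) v fin by (simp add: bad_def)
    show False
    \<comment> \<open>A set of three vertices cannot shrink and stay a violating set. But the pair
      that remains has a cut of size at least 4, which is not smaller than a cut of size at most
      4.\<close>
    proof (cases "card W = 3")
      case True
      then have "card (W - {v}) = 2" using v finW by simp
      then have "4 \<le> card (cut G (W - {v}))"
        using cut_pair_ge_4[OF cub, of "W - {v}"] WV by auto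
      then show False using less W(1) by (simp add: bad_def)
    next
      case False
      then have "card (W - {v}) \<ge> 3" using W3 v finW by simp
      then have "bad (W - {v})" using co less W(1) WV unfolding bad_def by auto
      then show False using W(2) less by fastforce
    qed
  qed
  have UV: "U \<subseteq> verts G" using U by (simp add: bad_def)
  have dc: "verts G - (verts G - U) = U" using UV by auto
  have ccut: "card (cut G (verts G - U)) = card (cut G U)" by (rule cut_complement[OF s UV])
  then have "bad (verts G - U)" using U dc unfolding bad_def by auto
  then have "\<And>v. v \<in> verts G - U \<Longrightarrow> card (nbrs G v - (verts G - U)) \<le> 1"
    using stable[of "verts G - U"] least ccut by simp
  then show ?thesis using that[of U] stable[OF U least] U unfolding bad_def by blast
qed

text \<open>No edge of \<open>?F\<close> joins \<open>A\<close> to \<open>B\<close>, so its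
  components are exactly the two induced subgraphs; being induced, they have no chords.\<close>

lemma permutation_two_factor_if_circuits:
  assumes s: "simple_graph G" and AB: "verts G = A \<union> B" "A \<inter> B = {}"
    and cA: "circuit (induced_subgraph G A)" and cB: "circuit (induced_subgraph G B)"
  shows "permutation_two_factor G \<lparr>verts = verts G, edges = {e \<in> edges G. e \<subseteq> A \<or> e \<subseteq> B}\<rparr>"
    (is "permutation_two_factor G ?F")
proof -
  have conn: "connected (induced_subgraph G A)" "connected (induced_subgraph G B)"
    using cA cB by (auto simp: circuit_def two_connected_def)
  have ne: "A \<noteq> {}" "B \<noteq> {}" using conn by (auto simp: connected_def induced_subgraph_def)
  have sF: "simple_graph ?F" using s by (auto simp: simple_graph_def)
  have edge: "{a, b} \<in> edges ?F \<longleftrightarrow> {a, b} \<in> edges G \<and> (a \<in> A \<longleftrightarrow> b \<in> A)" for a b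
    using simple_edgeD[OF s, of a b] AB by auto
  have reach: "{v \<in> verts ?F. reachable ?F u v} = S"
    if S: "S = A \<or> S = B" and u: "u \<in> S" for u S
  proof (intro equalityI subsetI)
    fix v assume v: "v \<in> {v \<in> verts ?F. reachable ?F u v}"
    then have "reachable ?F u v" by simp
    then show "v \<in> S"
      by (rule reachable_closed[OF _ u]) (use S AB edge simple_edgeD[OF s] in blast)
  next
    fix v assume v: "v \<in> S"
    then have "reachable (induced_subgraph G S) u v"
      using conn S u by (auto simp: connected_def induced_subgraph_def)
    then have "reachable ?F u v"
      by (rule reachable_map[where f = "\<lambda>x. x"])
        (use S in \<open>auto intro!: reachable_edge simp: induced_subgraph_def\<close>)
    then show "v \<in> {v \<in> verts ?F. reachable ?F u v}" using v S AB by auto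
  qed
  have ind: "induced_subgraph ?F S = induced_subgraph G S" if "S = A \<or> S = B" for S
    using that by (auto simp: induced_subgraph_def)
  have comp: "components ?F = {induced_subgraph G A, induced_subgraph G B}"
  proof (intro equalityI subsetI)
    fix K assume "K \<in> components ?F"
    then obtain u where u: "u \<in> verts G" "K = induced_subgraph ?F {v \<in> verts ?F. reachable ?F u v}"
      by (auto simp: components_def)
    then consider "u \<in> A" | "u \<in> B" using AB by auto
    then show "K \<in> {induced_subgraph G A, induced_subgraph G B}"
      using u(2) reach[of A u] reach[of B u] ind by cases simp_all
  next
    fix K assume K: "K \<in> {induced_subgraph G A, induced_subgraph G B}"
    obtain a b where "a \<in> A" "b \<in> B" using ne by auto
    then have "induced_subgraph G A \<in> components ?F" "induced_subgraph G B \<in> components ?F"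
      using reach[of A a] reach[of B b] ind[of A] ind[of B] in_components[of a ?F] in_components[of b ?F] AB by auto
    then show "K \<in> components ?F" using K by auto
  qed
  have "induced_subgraph G A \<noteq> induced_subgraph G B"
    using AB ne by (auto simp: induced_subgraph_def)
  moreover have "regular 2 ?F"
    unfolding regular_def
  proof
    fix v assume v: "v \<in> verts ?F"
    have deg: "degree ?F v = 2" if S: "S = A \<or> S = B" and vS: "v \<in> S" for S
    proof -
      have "degree (induced_subgraph G S) v = 2"
        using cA cB S vS by (auto simp: circuit_def regular_def induced_subgraph_def)
      moreover have "{e \<in> edges ?F. v \<in> e} = {e \<in> edges (induced_subgraph G S). v \<in> e}"
        using S vS AB by (auto simp: induced_subgraph_def)
      ultimately show ?thesis by (simp add: degree_def)
    qed
    show "degree ?F v = 2" using v AB deg[of A] deg[of B] by auto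
  qed
  moreover have "chordless G (induced_subgraph G S)" for S
    by (auto simp: chordless_def induced_subgraph_def)
  ultimately show ?thesis
    using sF cA cB comp by (simp add: permutation_two_factor_def two_factor_def subgraph_def)
qed

text \<open>Properness is expressed at one vertex at a time, here and in the converse below, because
  a colouring of \<open>H\<close> is carried to a summand separately around each vertex.\<close>

lemma three_edge_colorable_if_proper_darts:
  assumes s: "simple_graph G" and lt: "\<And>e. e \<in> edges G \<Longrightarrow> c e < (3::nat)"
    and inj: "\<And>v. v \<in> verts G \<Longrightarrow> inj_on (\<lambda>u. c {v, u}) (nbrs G v)"
  shows "three_edge_colorable G"
  unfolding three_edge_colorable_def
proof (intro exI[of _ c] conjI ballI impI)
  fix e f assume e: "e \<in> edges G" and f: "f \<in> edges G" and ef: "e \<noteq> f \<and> e \<inter> f \<noteq> {}"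
  then obtain v where v: "v \<in> e" "v \<in> f" by auto
  obtain a where a: "e = {v, a}" using simple_edgeE[OF s e] v(1) by (metis insert_commute insert_iff singletonD)
  obtain b where b: "f = {v, b}" using simple_edgeE[OF s f] v(2) by (metis insert_commute insert_iff singletonD)
  have "v \<in> verts G" using simple_edgeD[OF s] e a by blast
  from inj[OF this] show "c e \<noteq> c f" using e f ef a b by (auto simp: inj_on_def nbrs_def)
qed (use lt in auto)

lemma proper_darts_if_three_edge_coloring:
  assumes c: "\<And>e f. e \<in> edges G \<Longrightarrow> f \<in> edges G \<Longrightarrow> e \<noteq> f \<Longrightarrow> e \<inter> f \<noteq> {} \<Longrightarrow> c e \<noteq> c f"
  shows "inj_on (\<lambda>u. c {v, u}) (nbrs G v)"
proof (rule inj_onI)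
  fix a b assume "a \<in> nbrs G v" "b \<in> nbrs G v" "c {v, a} = c {v, b}"
  then have "{v, a} = {v, b}" using c[of "{v, a}" "{v, b}"] by (auto simp: nbrs_def)
  then show "a = b" by (auto simp: doubleton_eq_iff)
qed

lemma even_card_verts_cubic:
  assumes "cubic G"
  shows "even (card (verts G))"
proof -
  have "simple_graph G" using assms by (simp add: cubic_def)
  then have "cut G (verts G) = {}" by (auto simp: cut_def dest: simple_edgeD)
  then have "2 * card {e \<in> edges G. e \<subseteq> verts G} = 3 * card (verts G)"
    using card_cut_cubic[OF assms, of "verts G"] by simp
  then show ?thesis by (metis dvd_triv_left even_mult_iff odd_numeral)
qed

section \<open>Boundary behaviour of one summand\<close>

text \<open>In a cubic graph with distinct neighbours \<open>a\<close> and \<open>b\<close> of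
  \<open>v\<close> exactly one candidate remains, so the choice is determined.\<close>

definition third_nbr :: "'a graph \<Rightarrow> 'a \<Rightarrow> 'a \<Rightarrow> 'a \<Rightarrow> 'a" where
  "third_nbr G v a b = (SOME u. u \<in> nbrs G v - {a, b})"

lemma nbrs_third:
  assumes "cubic G" "v \<in> verts G" "a \<in> nbrs G v" "b \<in> nbrs G v" "a \<noteq> b"
  shows "nbrs G v = {a, b, third_nbr G v a b}" "third_nbr G v a b \<notin> {a, b}"
proof -
  have fin: "finite (nbrs G v)" using assms(1) by (simp add: finite_nbrs cubic_def)
  have "card (nbrs G v - {a, b}) = 1"
    using cubic_nbrs[OF assms(1,2)] assms fin by (simp add: card_Diff_subset)
  then obtain u where u: "nbrs G v - {a, b} = {u}" by (auto simp: card_1_singleton_iff)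
  then have "third_nbr G v a b = u" by (simp add: third_nbr_def)
  then show "nbrs G v = {a, b, third_nbr G v a b}" "third_nbr G v a b \<notin> {a, b}"
    using u assms by auto
qed

lemma nbrs_eq_triple:
  assumes "cubic G" "v \<in> verts G" "a \<in> nbrs G v" "b \<in> nbrs G v" "c \<in> nbrs G v" "distinct [a, b, c]"
  shows "nbrs G v = {a, b, c}"
  using nbrs_third[OF assms(1-4)] assms by auto

lemma induced_edges_subset: "edges (induced_subgraph G U) \<subseteq> edges G"
  by (auto simp: induced_subgraph_def)

text \<open>The chordless circuits of the 2-factor enter as induced subgraphs, so that the
  neighbours of a vertex on its circuit are simply its neighbours in \<open>Q\<close> that lie on
  that circuit.\<close>

locale ingredient =
  fixes Q C1 C2 :: "'a graph" and x1 x2 x4 x5 x6 z1 z2 :: 'a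
  assumes cub: "cubic Q" and ws: "well_separated Q" and uncol: "\<not> three_edge_colorable Q"
    and circ1: "circuit C1" and circ2: "circuit C2"
    and ind1: "C1 = induced_subgraph Q (verts C1)" and ind2: "C2 = induced_subgraph Q (verts C2)"
    and cover: "verts Q = verts C1 \<union> verts C2" and disj: "verts C1 \<inter> verts C2 = {}"
    and path1: "is_path C1 [x1, x2, z2, x6]" and path2: "is_path C2 [x4, z1, x5]"
    and z_edge: "{z1, z2} \<in> edges Q"
begin

definition "w = third_nbr Q x2 x1 z2"

text \<open>Although \<open>x2\<close> survives in \<open>H\<close>, it is left out: of its three
  edges only the one to \<open>w\<close> stays inside the summand, so \<open>x2\<close> is better
  treated together with the ring.\<close>

definition "R = verts Q - {x2, z2, z1}"

definition "inner S = {(u, v). u \<in> S \<and> v \<in> R - S \<and> {u, v} \<in> edges Q}"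

lemma simple: "simple_graph Q" using cub by (simp add: cubic_def)

lemma fin: "finite (verts Q)" using simple by (simp add: simple_graph_def)

lemma in1: "x1 \<in> verts C1" "x2 \<in> verts C1" "z2 \<in> verts C1" "x6 \<in> verts C1"
  and in2: "x4 \<in> verts C2" "z1 \<in> verts C2" "x5 \<in> verts C2"
  using path1 path2 by (auto simp: is_path_def)

lemma distinct_vertices: "distinct [x1, x2, z2, x6, x4, z1, x5]"
  using path1 path2 in1 in2 disj unfolding is_path_def by auto

lemma in_Q [simp]: "x1 \<in> verts Q" "x2 \<in> verts Q" "z2 \<in> verts Q" "x6 \<in> verts Q"
  "x4 \<in> verts Q" "z1 \<in> verts Q" "x5 \<in> verts Q"
  using in1 in2 cover by auto

lemma edges_C_sub: "edges C1 \<subseteq> edges Q" "edges C2 \<subseteq> edges Q"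
  by (subst ind1, rule induced_edges_subset, subst ind2, rule induced_edges_subset)

lemma path_edges: "{x1, x2} \<in> edges Q" "{x2, z2} \<in> edges Q" "{z2, x6} \<in> edges Q"
  "{x4, z1} \<in> edges Q" "{z1, x5} \<in> edges Q"
  using path1 path2 edges_C_sub by (auto simp: is_path_def)

lemma nbrs_z1: "nbrs Q z1 = {x4, x5, z2}"
  by (rule nbrs_eq_triple[OF cub])
    (use path_edges z_edge distinct_vertices in \<open>auto simp: nbrs_def insert_commute\<close>)

lemma nbrs_z2: "nbrs Q z2 = {x2, x6, z1}"
  by (rule nbrs_eq_triple[OF cub])
    (use path_edges z_edge distinct_vertices in \<open>auto simp: nbrs_def insert_commute\<close>)

lemma nbrs_x2: "nbrs Q x2 = {x1, z2, w}" and w_new: "w \<noteq> x1" "w \<noteq> z2"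
  using nbrs_third[OF cub, of x2 x1 z2] path_edges distinct_vertices
  by (auto simp: w_def nbrs_def insert_commute)

lemma nbrs_C1: "v \<in> verts C1 \<Longrightarrow> nbrs C1 v = nbrs Q v \<inter> verts C1"
  by (subst ind1) (rule nbrs_induced)

lemma nbrs_C2: "v \<in> verts C2 \<Longrightarrow> nbrs C2 v = nbrs Q v \<inter> verts C2"
  by (subst ind2) (rule nbrs_induced)

lemma card_nbrs_C1: "v \<in> verts C1 \<Longrightarrow> card (nbrs Q v \<inter> verts C1) = 2"
  using circ1 by (simp add: nbrs_C1[symmetric] circuit_def regular_def degree_eq_card_nbrs[symmetric])

lemma card_nbrs_C2: "v \<in> verts C2 \<Longrightarrow> card (nbrs Q v \<inter> verts C2) = 2"
  using circ2 by (simp add: nbrs_C2[symmetric] circuit_def regular_def degree_eq_card_nbrs[symmetric])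

text \<open>The vertex \<open>x2\<close> already has its two circuit neighbours \<open>x1\<close>
  and \<open>z2\<close>, and \<open>C1\<close> is induced; the third edge must lead to the other
  circuit.\<close>

lemma w_in_C2: "w \<in> verts C2"
proof (rule ccontr)
  have wQ: "w \<in> verts Q" using nbrs_subset[OF simple, of x2] nbrs_x2 by auto
  assume "w \<notin> verts C2"
  then have "w \<in> verts C1" using wQ cover by auto
  then have "nbrs Q x2 \<inter> verts C1 = {x1, z2, w}" using nbrs_x2 in1 by auto
  then show False using card_nbrs_C1[OF in1(2)] distinct_vertices w_new by auto
qed

lemma card_Q_ge: "7 \<le> card (verts Q)"
proof -
  have "card (set [x1, x2, z2, x6, x4, z1, x5]) = 7"
    using distinct_card[OF distinct_vertices] by simp
  moreover have "card (set [x1, x2, z2, x6, x4, z1, x5]) \<le> card (verts Q)"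
    using fin by (intro card_mono) auto
  ultimately show ?thesis by simp
qed

text \<open>Four vertices spanning four edges have a cut of size at most 12 - 8 = 4, with three
  vertices left outside. Applied to \<open>x2, z2, z1\<close> and \<open>x4\<close> or
  \<open>x5\<close>, this keeps \<open>w\<close> away from \<open>x4\<close> and
  \<open>x5\<close>.\<close>

lemma no_quadrilateral:
  assumes d: "distinct [a, b, c, d]"
    and e: "{a, b} \<in> edges Q" "{b, c} \<in> edges Q" "{c, d} \<in> edges Q" "{d, a} \<in> edges Q"
  shows False
proof -
  let ?U = "{a, b, c, d}"
  have U: "?U \<subseteq> verts Q" using e simple_edgeD[OF simple] by auto
  have c4: "card ?U = 4" using d by simp
  have "card {{a, b}, {b, c}, {c, d}, {d, a}} \<le> card {e \<in> edges Q. e \<subseteq> ?U}"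
    using e finite_edges[OF simple] by (intro card_mono) auto
  moreover have "card {{a, b}, {b, c}, {c, d}, {d, a}} = 4"
    using d by (auto simp: doubleton_eq_iff card_insert_if)
  ultimately have "4 \<le> card {e \<in> edges Q. e \<subseteq> ?U}" by simp
  then have "card (cut Q ?U) \<le> 4" using card_cut_cubic[OF cub U] c4 by linarith
  moreover have "card (verts Q - ?U) = card (verts Q) - 4"
    using U c4 by (simp add: card_Diff_subset)
  then have "3 \<le> card (verts Q - ?U)" using card_Q_ge by linarith
  then have "5 \<le> card (cut Q ?U)" using ws U c4 unfolding well_separated_def by simp
  ultimately show False by simp
qed

lemma w_edge: "{x2, w} \<in> edges Q"
  using nbrs_x2 by (auto simp: nbrs_def)

lemma w_distinct: "w \<notin> {x1, x2, z2, x6, x4, z1, x5}"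
proof -
  have "w \<noteq> x4" "w \<noteq> x5"
    using no_quadrilateral[of x2 z2 z1 x4] no_quadrilateral[of x2 z2 z1 x5]
      distinct_vertices path_edges z_edge w_edge by (auto simp: insert_commute)
  moreover have "w \<noteq> z1" using nbrs_z1 distinct_vertices w_edge
    by (auto simp: nbrs_def insert_commute set_eq_iff)
  moreover have "w \<noteq> x2" using simple_edgeD[OF simple w_edge] by simp
  ultimately show ?thesis using w_in_C2 in1 disj by auto
qed

lemma w_in_Q [simp]: "w \<in> verts Q" using w_in_C2 cover by simp

text \<open>The five vertices \<open>x1\<close>, \<open>w\<close>, \<open>x6\<close>,
  \<open>x4\<close>, \<open>x5\<close> attached to the removed path are distinct, so none of them
  loses more than one neighbour.\<close>

lemma card_nbrs_R:
  assumes "v \<in> R"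
  shows "2 \<le> card (nbrs Q v \<inter> R)"
proof -
  have v: "v \<in> verts Q" using assms by (simp add: R_def)
  have sub: "nbrs Q v - R \<subseteq> {x2, z2, z1}" using nbrs_subset[OF simple] by (auto simp: R_def)
  have mem: "x2 \<in> nbrs Q v \<longleftrightarrow> v \<in> {x1, z2, w}" "z2 \<in> nbrs Q v \<longleftrightarrow> v \<in> {x2, x6, z1}"
    "z1 \<in> nbrs Q v \<longleftrightarrow> v \<in> {x4, x5, z2}"
    by (simp_all add: nbrs_sym[of _ Q v] nbrs_x2 nbrs_z1 nbrs_z2)
  have "\<exists>t. nbrs Q v - R \<subseteq> {t}"
  proof -
    consider "v \<in> {x1, w}" | "v = x6" | "v \<in> {x4, x5}" | "v \<notin> {x1, w, x6, x4, x5}" by auto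
    then show ?thesis
    proof cases
      case 1
      then have "nbrs Q v - R \<subseteq> {x2}" using sub mem distinct_vertices w_distinct by auto
      then show ?thesis by blast
    next
      case 2
      then have "nbrs Q v - R \<subseteq> {z2}" using sub mem distinct_vertices w_distinct by auto
      then show ?thesis by blast
    next
      case 3
      then have "nbrs Q v - R \<subseteq> {z1}" using sub mem distinct_vertices w_distinct by auto
      then show ?thesis by blast
    next
      case 4
      then have "nbrs Q v - R \<subseteq> {z1}" using sub mem assms by (auto simp: R_def)
      then show ?thesis by blast
    qed
  qed
  then obtain t where "nbrs Q v - R \<subseteq> {t}" by blast
  then have "card (nbrs Q v - R) \<le> card {t}" by (intro card_mono) auto
  then show ?thesis
    using cubic_nbrs[OF cub v] card_Int_Diff[OF finite_nbrs[OF simple], of v R] by simp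
qed

text \<open>Three removed vertices on a path meet 9 - 2 = 7 edges, and each of these contributes at
  most one element to the cut.\<close>

lemma cut_le_inner:
  assumes "T \<subseteq> verts Q"
  shows "card (cut Q T) \<le> card (inner (T \<inter> R)) + of_bool ((x2 \<in> T) \<noteq> (x1 \<in> T)) + of_bool ((x2 \<in> T) \<noteq> (w \<in> T))
    + of_bool ((x2 \<in> T) \<noteq> (z2 \<in> T)) + of_bool ((z2 \<in> T) \<noteq> (x6 \<in> T)) + of_bool ((z2 \<in> T) \<noteq> (z1 \<in> T))
    + of_bool ((z1 \<in> T) \<noteq> (x4 \<in> T)) + of_bool ((z1 \<in> T) \<noteq> (x5 \<in> T))"
proof -
  define sep where "sep a b = {(u, v). u \<in> T \<and> v \<notin> T \<and> {u, v} = {a, b}}" for a b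
  have card_sep: "card (sep a b) \<le> of_bool ((a \<in> T) \<noteq> (b \<in> T))" for a b
  proof -
    have "sep a b = (if a \<in> T \<and> b \<notin> T then {(a, b)} else if b \<in> T \<and> a \<notin> T then {(b, a)} else {})"
      by (auto simp: sep_def doubleton_eq_iff)
    then show ?thesis by simp
  qed
  have sub: "cut Q T \<subseteq> inner (T \<inter> R) \<union> sep x2 x1 \<union> sep x2 w \<union> sep x2 z2 \<union> sep z2 x6 \<union> sep z2 z1 \<union> sep z1 x4 \<union> sep z1 x5"
  proof
    fix d assume "d \<in> cut Q T"
    then obtain u v where d: "d = (u, v)" and u: "u \<in> T" and v: "v \<notin> T" and uv: "{u, v} \<in> edges Q"
      by (auto simp: cut_def)
    have mem: "d \<in> sep a b \<longleftrightarrow> u = a \<and> v = b \<or> u = b \<and> v = a" for a b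
      using d u v by (auto simp: sep_def doubleton_eq_iff)
    have n: "v \<in> nbrs Q u" "u \<in> nbrs Q v" using uv by (auto simp: nbrs_def insert_commute)
    have V: "u \<in> verts Q" "v \<in> verts Q" using simple_edgeD[OF simple uv] by auto
    consider "u \<in> R" "v \<in> R" | "u = x2" | "u = z2" | "u = z1" | "v = x2" | "v = z2" | "v = z1"
      using V by (auto simp: R_def)
    then show "d \<in> inner (T \<inter> R) \<union> sep x2 x1 \<union> sep x2 w \<union> sep x2 z2 \<union> sep z2 x6 \<union> sep z2 z1 \<union> sep z1 x4 \<union> sep z1 x5"
    proof cases
      case 1
      then show ?thesis using d u v uv by (simp add: inner_def)
    next
      case 2
      then have "v \<in> {x1, z2, w}" using n nbrs_x2 by simp
      then show ?thesis using 2 by (auto simp: mem)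
    next
      case 3
      then have "v \<in> {x2, x6, z1}" using n nbrs_z2 by simp
      then show ?thesis using 3 by (auto simp: mem)
    next
      case 4
      then have "v \<in> {x4, x5, z2}" using n nbrs_z1 by simp
      then show ?thesis using 4 by (auto simp: mem)
    next
      case 5
      then have "u \<in> {x1, z2, w}" using n nbrs_x2 by simp
      then show ?thesis using 5 by (auto simp: mem)
    next
      case 6
      then have "u \<in> {x2, x6, z1}" using n nbrs_z2 by simp
      then show ?thesis using 6 by (auto simp: mem)
    next
      case 7
      then have "u \<in> {x4, x5, z2}" using n nbrs_z1 by simp
      then show ?thesis using 7 by (auto simp: mem)
    qed
  qed
  have fi: "finite (inner (T \<inter> R))"
    by (rule finite_subset[of _ "verts Q \<times> verts Q"]) (use assms fin in \<open>auto simp: inner_def R_def\<close>)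
  have fs: "finite (sep a b)" for a b
    by (rule finite_subset[of _ "{(a, b), (b, a)}"]) (auto simp: sep_def doubleton_eq_iff)
  have "card (cut Q T) \<le> card (inner (T \<inter> R) \<union> sep x2 x1 \<union> sep x2 w \<union> sep x2 z2 \<union> sep z2 x6 \<union> sep z2 z1 \<union> sep z1 x4 \<union> sep z1 x5)"
    using sub fi fs by (intro card_mono) auto
  also have "\<dots> \<le> card (inner (T \<inter> R)) + card (sep x2 x1) + card (sep x2 w) + card (sep x2 z2) + card (sep z2 x6)
     + card (sep z2 z1) + card (sep z1 x4) + card (sep z1 x5)"
    by (intro order_trans[OF card_Un_le] add_right_mono) simp
  also have "\<dots> \<le> card (inner (T \<inter> R)) + of_bool ((x2 \<in> T) \<noteq> (x1 \<in> T)) + of_bool ((x2 \<in> T) \<noteq> (w \<in> T))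
    + of_bool ((x2 \<in> T) \<noteq> (z2 \<in> T)) + of_bool ((z2 \<in> T) \<noteq> (x6 \<in> T)) + of_bool ((z2 \<in> T) \<noteq> (z1 \<in> T))
    + of_bool ((z1 \<in> T) \<noteq> (x4 \<in> T)) + of_bool ((z1 \<in> T) \<noteq> (x5 \<in> T))"
    by (intro add_mono card_sep order_refl)
  finally show ?thesis .
qed

lemma in_R: "x1 \<in> R" "x4 \<in> R" "x5 \<in> R" "x6 \<in> R" "w \<in> R" "x2 \<notin> R" "z1 \<notin> R" "z2 \<notin> R"
  using distinct_vertices w_distinct by (auto simp: R_def)

lemma finite_R: "finite R" using fin by (simp add: R_def)

text \<open>The set \<open>S\<close> is extended by all eight subsets of the removed path \<open>x2, z2, z1\<close>, and the
  connectivity of \<open>Q\<close> is applied to each extension.\<close>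

lemma inner_cut_bound:
  assumes S: "S \<subseteq> R" "2 \<le> card S" "2 \<le> card (R - S)"
  shows "2 \<le> card (inner S)"
    and "card (inner S) = 2 \<Longrightarrow> (x4 \<in> S) \<noteq> (x5 \<in> S) \<and> (x1 \<in> S) \<noteq> (w \<in> S)"
proof -
  have finS: "finite S" using S(1) finite_R finite_subset by blast
  \<comment> \<open>The Booleans \<open>a\<close>, \<open>b\<close>, \<open>c\<close> tell whether
    \<open>x2\<close>, \<open>z2\<close>, \<open>z1\<close> join \<open>S\<close>. If the path is
    split, both sides grow to at least three vertices and the bound is 5; if it stays whole, one
    side may have only two vertices and the bound is 4.\<close>
  have key: "(if a = b \<and> b = c then 4 else 5) \<le> card (inner S) + of_bool (a \<noteq> (x1 \<in> S)) + of_bool (a \<noteq> (w \<in> S))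
    + of_bool (a \<noteq> b) + of_bool (b \<noteq> (x6 \<in> S)) + of_bool (b \<noteq> c)
    + of_bool (c \<noteq> (x4 \<in> S)) + of_bool (c \<noteq> (x5 \<in> S))" for a b c
  proof -
    define Z where "Z = (if a then {x2} else {}) \<union> (if b then {z2} else {}) \<union> (if c then {z1} else {})"
    let ?T = "S \<union> Z"
    have Z: "Z \<subseteq> {x2, z2, z1}" by (auto simp: Z_def)
    have finZ: "finite Z" using Z finite_subset by blast
    have T: "?T \<subseteq> verts Q" "?T \<inter> R = S" using S(1) Z in_R by (auto simp: R_def)
    have co: "verts Q - ?T = (R - S) \<union> ({x2, z2, z1} - Z)"
      using S(1) Z in_R by (auto simp: R_def)
    have "card ?T = card S + card Z"
      using finS finZ S(1) Z in_R by (intro card_Un_disjoint) auto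
    moreover have "card (verts Q - ?T) = card (R - S) + card ({x2, z2, z1} - Z)"
      unfolding co using finite_R in_R by (intro card_Un_disjoint) auto
    moreover have "0 < card Z" "0 < card ({x2, z2, z1} - Z)" if "\<not> (a = b \<and> b = c)"
      using that distinct_vertices by (auto simp: Z_def card_gt_0_iff split: if_splits)
    ultimately have "(if a = b \<and> b = c then 4 else 5) \<le> card (cut Q ?T)"
      using ws T(1) S cut_ge_4[OF cub ws T(1)] unfolding well_separated_def by auto
    moreover have "(x2 \<in> ?T) = a" "(z2 \<in> ?T) = b" "(z1 \<in> ?T) = c" "(x1 \<in> ?T) = (x1 \<in> S)" "(w \<in> ?T) = (w \<in> S)"
      "(x4 \<in> ?T) = (x4 \<in> S)" "(x5 \<in> ?T) = (x5 \<in> S)" "(x6 \<in> ?T) = (x6 \<in> S)"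
      using S(1) in_R Z distinct_vertices by (auto simp: Z_def split: if_splits)
    ultimately show ?thesis using cut_le_inner[OF T(1)] unfolding T(2) by simp
  qed
  \<comment> \<open>The useful choice takes \<open>b\<close> as the side of \<open>x6\<close>,
    \<open>a\<close> as the common side of \<open>x1, w\<close> and \<open>c\<close> as the common
    side of \<open>x4, x5\<close>, each replaced by \<open>b\<close> where the pair is split. Either
    end then adds at most one edge. A pair that is not split adds an edge only by splitting the
    path, which raises the bound to 5; so \<open>inner S\<close> has size 2 only when both pairs are
    split.\<close>
  note k = key[of False False False] key[of False False True] key[of False True False] key[of False True True]
    key[of True False False] key[of True False True] key[of True True False] key[of True True True]
  show "2 \<le> card (inner S)"
    using k by (cases "x1 \<in> S"; cases "w \<in> S"; cases "x6 \<in> S"; cases "x4 \<in> S"; cases "x5 \<in> S") simp_all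
  show "(x4 \<in> S) \<noteq> (x5 \<in> S) \<and> (x1 \<in> S) \<noteq> (w \<in> S)" if "card (inner S) = 2"
    using k that by (cases "x1 \<in> S"; cases "w \<in> S"; cases "x6 \<in> S"; cases "x4 \<in> S"; cases "x5 \<in> S") simp_all
qed

end

section \<open>Boundary colourings of one summand\<close>

lemma card_fibre_eq_1:
  assumes "card A = 3" "inj_on f A" "f ` A \<subseteq> {..<3::nat}" "k < 3"
  shows "card {a \<in> A. f a = k} = 1"
proof -
  have "f ` A = {..<3}" using assms(1-3) by (intro card_subset_eq) (auto simp: card_image)
  then obtain a where a: "a \<in> A" "f a = k" using assms(4) by (metis imageE lessThan_iff)
  then have "{b \<in> A. f b = k} = {a}" using assms(2) by (auto dest: inj_onD)
  then show ?thesis by simp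
qed

text \<open>The colours \<open>a, b, d, f, g, h\<close> are those of \<open>e\<^sub>1\<close>, the two half-edges at \<open>x\<^sub>2\<close>, \<open>e\<^sub>6\<close>, \<open>e\<^sub>4\<close> and \<open>e\<^sub>5\<close>. The
  last two assumptions exclude the boundary colourings that extend to the whole of \<open>Q\<close>.\<close>

lemma six_colours:
  fixes a b d f g h :: nat
  assumes "a < 3" "b < 3" "d < 3" "f < 3" "g < 3" "h < 3" "b \<noteq> d"
    and "\<And>k. k < 3 \<Longrightarrow> even (of_bool (a = k) + of_bool (b = k) + of_bool (d = k) + of_bool (f = k) + of_bool (g = k) + of_bool (h = k) :: nat)"
    and "\<not> (a = b \<and> d \<noteq> f \<and> {g, h} = {d, f})" and "\<not> (a = d \<and> b \<noteq> f \<and> {g, h} = {b, f})"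
  shows "(a = b \<longrightarrow> g = h) \<and> (a = b \<and> g = h \<longrightarrow> d = f) \<and> (a \<noteq> b \<and> g \<noteq> h \<longrightarrow> d \<notin> {a, b} \<and> f \<notin> {g, h})"
proof -
  note even = assms(8)
  have four: "(p = q \<longrightarrow> d' = f) \<and> (p \<noteq> q \<longrightarrow> {p, q} = {d', f} \<and> d' \<noteq> f)"
    if "p < 3" "q < 3" "d' < 3"
      and ev: "\<And>k. k < 3 \<Longrightarrow> even (of_bool (d' = k) + of_bool (f = k) + of_bool (p = k) + of_bool (q = k) :: nat)"
    for p q d' :: nat
    using ev[OF that(1)] ev[OF that(2)] ev[OF that(3)]
    by (cases "p = q"; cases "d' = p"; cases "d' = q"; cases "f = p"; cases "f = q") auto
  show ?thesis
  proof (cases "a = b")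
    case True
    have "even (of_bool (d = k) + of_bool (f = k) + of_bool (g = k) + of_bool (h = k) :: nat)" if "k < 3" for k
      using even[OF that] True by (cases "b = k") simp_all
    from four[OF assms(5,6,3) this] show ?thesis using assms(9) True by auto
  next
    case ab: False
    show ?thesis
    proof (cases "g = h")
      case True
      then show ?thesis using ab by simp
    next
      case gh: False
      \<comment> \<open>If \<open>a = d\<close>, these two cancel and parity pairs up
        \<open>b, f, g, h\<close>; with \<open>g \<noteq> h\<close> this is the second excluded
        pattern.\<close>
      have "a \<noteq> d"
      proof
        assume ad: "a = d"
        have "even (of_bool (b = k) + of_bool (f = k) + of_bool (g = k) + of_bool (h = k) :: nat)" if "k < 3" for k
          using even[OF that] ad by (cases "d = k") simp_all
        from four[OF assms(5,6,2) this] show False using assms(10) ad gh by auto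
      qed
      \<comment> \<open>Now \<open>a\<close>, \<open>b\<close>, \<open>d\<close> are all three
        colours, so the colour \<open>f\<close> occurs exactly once among them. With
        \<open>f\<close> itself that makes two, and parity leaves both or none of \<open>g\<close>,
        \<open>h\<close> equal to \<open>f\<close>.\<close>
      then have "of_bool (a = f) + of_bool (b = f) + of_bool (d = f) = (1 :: nat)"
        using ab assms(1-4,7) by (cases "a = f"; cases "b = f"; cases "d = f") auto
      then have "even (1 + 1 + of_bool (g = f) + of_bool (h = f) :: nat)" using even[OF assms(4)] by simp
      then show ?thesis using gh ab \<open>a \<noteq> d\<close> assms(7) by (cases "g = f"; cases "h = f") auto
    qed
  qed
qed

context ingredient
begin

text \<open>The edge \<open>x1 x2\<close> is cut into two half-edges, so it has the colour \<open>a\<close> when seen from \<open>x1\<close>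
  and \<open>b\<close> when seen from \<open>x2\<close>.\<close>

definition "port_colour c a b d f g h v u =
  (if v = x1 \<and> u = x2 then a else if v = x2 \<and> u = x1 then b else if v = x2 \<and> u = z2 then d
   else if v = x6 \<and> u = z2 then f else if v = x4 \<and> u = z1 then g else if v = x5 \<and> u = z1 then h
   else c {v, u})" for c :: "'a set \<Rightarrow> nat"

lemma port_colour_ports:
  "port_colour c a b d f g h x1 x2 = a" "port_colour c a b d f g h x2 x1 = b"
  "port_colour c a b d f g h x2 z2 = d" "port_colour c a b d f g h x6 z2 = f"
  "port_colour c a b d f g h x4 z1 = g" "port_colour c a b d f g h x5 z1 = h"
  using distinct_vertices by (auto simp: port_colour_def)

text \<open>Only the deleted vertices \<open>z1\<close> and \<open>z2\<close> are exempt. The vertex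
  \<open>x2\<close> is kept, hence its two half-edges receive different colours.\<close>

definition "proper_port_colouring c a b d f g h \<longleftrightarrow>
  (\<forall>v\<in>verts Q - {z1, z2}. inj_on (port_colour c a b d f g h v) (nbrs Q v) \<and>
     port_colour c a b d f g h v ` nbrs Q v \<subseteq> {..<3})"

text \<open>The parity lemma: each remaining vertex sees the colour \<open>k\<close> exactly once,
  the number of these vertices is even, and an edge that stays whole is seen from both ends. What
  remains are the six half-edges.\<close>

lemma port_colour_parity:
  assumes "proper_port_colouring c a b d f g h" "k < 3"
  shows "even (of_bool (a = k) + of_bool (b = k) + of_bool (d = k) + of_bool (f = k) + of_bool (g = k) + of_bool (h = k) :: nat)"
proof -
  let ?p = "port_colour c a b d f g h"
  let ?V = "verts Q - {z1, z2}"
  define U where "U = Sigma ?V (\<lambda>v. {u \<in> nbrs Q v. ?p v u = k})"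
  have "card U = (\<Sum>v\<in>?V. card {u \<in> nbrs Q v. ?p v u = k})"
    unfolding U_def using fin finite_nbrs[OF simple] by (intro card_SigmaI) auto
  also have "\<dots> = (\<Sum>v\<in>?V. 1)"
    using assms cubic_nbrs[OF cub] unfolding proper_port_colouring_def
    by (intro sum.cong card_fibre_eq_1) auto
  also have "\<dots> = card (verts Q) - 2"
  proof -
    have "z1 \<noteq> z2" using distinct_vertices by auto
    then show ?thesis by (simp add: card_Diff_subset)
  qed
  finally have cardU: "even (card U)" using even_card_verts_cubic[OF cub] by simp
  define E where "E = {e \<in> edges Q. e \<inter> {z1, z2} = {} \<and> e \<noteq> {x1, x2} \<and> c e = k}"
  define P where "P = [(x1, x2), (x2, x1), (x2, z2), (x6, z2), (x4, z1), (x5, z1)]"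
  have dP: "distinct P" using distinct_vertices by (auto simp: P_def)
  have "U = {(v, u). {v, u} \<in> E} \<union> {(v, u) \<in> set P. ?p v u = k}"
  proof (intro equalityI subsetI)
    fix t assume "t \<in> U"
    then obtain v u where t: "t = (v, u)" "v \<in> verts Q" "v \<noteq> z1" "v \<noteq> z2" "u \<in> nbrs Q v" "?p v u = k"
      by (auto simp: U_def)
    show "t \<in> {(v, u). {v, u} \<in> E} \<union> {(v, u) \<in> set P. ?p v u = k}"
    proof (cases "(v, u) \<in> set P")
      case True
      then show ?thesis using t by simp
    next
      case False
      have "u \<noteq> z1"
      proof
        assume "u = z1"
        then have "v \<in> {x4, x5, z2}" using t(5) by (simp add: nbrs_sym[of z1] nbrs_z1)
        then show False using False \<open>u = z1\<close> t by (auto simp: P_def)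
      qed
      moreover have "u \<noteq> z2"
      proof
        assume "u = z2"
        then have "v \<in> {x2, x6, z1}" using t(5) by (simp add: nbrs_sym[of z2] nbrs_z2)
        then show False using False \<open>u = z2\<close> t by (auto simp: P_def)
      qed
      ultimately have "{v, u} \<in> E" using t False by (auto simp: E_def P_def port_colour_def nbrs_def doubleton_eq_iff)
      then show ?thesis using t by simp
    qed
  next
    fix t assume "t \<in> {(v, u). {v, u} \<in> E} \<union> {(v, u) \<in> set P. ?p v u = k}"
    then consider v u where "t = (v, u)" "{v, u} \<in> E" | v u where "t = (v, u)" "(v, u) \<in> set P" "?p v u = k"
      by auto
    then show "t \<in> U"
    proof cases
      case 1
      then have e: "{v, u} \<in> edges Q" "c {v, u} = k" and ne: "{v, u} \<noteq> {x1, x2}"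
        and z: "v \<noteq> z1" "v \<noteq> z2" "u \<noteq> z1" "u \<noteq> z2" by (auto simp: E_def)
      have "\<not> (v = x1 \<and> u = x2)" "\<not> (v = x2 \<and> u = x1)" using ne by auto
      then have "?p v u = k" using e(2) z by (auto simp: port_colour_def)
      then show ?thesis using 1(1) e(1) z simple_edgeD[OF simple e(1)] by (simp add: U_def nbrs_def)
    next
      case 2
      then have "v \<in> verts Q - {z1, z2}" "u \<in> nbrs Q v"
        using distinct_vertices path_edges by (auto simp: P_def nbrs_def insert_commute)
      then show ?thesis using 2 by (simp add: U_def)
    qed
  qed
  moreover have "card ({(v, u). {v, u} \<in> E} \<union> {(v, u) \<in> set P. ?p v u = k}) =
      card {(v, u). {v, u} \<in> E} + card {(v, u) \<in> set P. ?p v u = k}"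
  proof (rule card_Un_disjoint)
    show "finite {(v, u). {v, u} \<in> E}"
      by (rule finite_subset[of _ "verts Q \<times> verts Q"])
        (use fin simple_edgeD[OF simple] in \<open>auto simp: E_def\<close>)
    show "finite {(v, u) \<in> set P. ?p v u = k}" by (rule finite_subset[of _ "set P"]) auto
    show "{(v, u). {v, u} \<in> E} \<inter> {(v, u) \<in> set P. ?p v u = k} = {}"
      by (auto simp: E_def P_def insert_commute)
  qed
  moreover have "card {(v, u). {v, u} \<in> E} = 2 * card E"
  proof (rule card_darts)
    show "finite E" using finite_edges[OF simple] by (simp add: E_def)
    fix e assume "e \<in> E"
    then have "e \<in> edges Q" by (simp add: E_def)
    then show "\<exists>u v. u \<noteq> v \<and> e = {u, v}" using simple_edgeE[OF simple] by metis
  qed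
  ultimately have "even (card {(v, u) \<in> set P. ?p v u = k})" using cardU by simp
  moreover have "card {(v, u) \<in> set P. ?p v u = k} = (\<Sum>t\<in>set P. of_bool (?p (fst t) (snd t) = k))"
    by (simp add: sum_of_bool_eq Int_def case_prod_unfold)
  moreover have "\<dots> = sum_list (map (\<lambda>t. of_bool (?p (fst t) (snd t) = k)) P)"
    using dP by (simp add: sum_list_distinct_conv_sum_set)
  moreover have "\<dots> = of_bool (a = k) + of_bool (b = k) + of_bool (d = k) + of_bool (f = k) + of_bool (g = k) + of_bool (h = k)"
    by (simp add: P_def port_colour_ports)
  ultimately show ?thesis by simp
qed

text \<open>Such colours would close up to a colouring of \<open>Q\<close>: \<open>x1 x2\<close>
  gets \<open>r\<close>, \<open>x2 z2\<close> gets \<open>s\<close>, and \<open>z1 z2\<close> the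
  colour missing from \<open>s, f\<close>. The freedom in \<open>{r, s} = {b, d}\<close> is that the
  two half-edges at \<open>x2\<close> may exchange their colours without disturbing the edge
  \<open>x2 w\<close>.\<close>

lemma no_extending_colours:
  assumes p: "proper_port_colouring c a b d f g h"
    and rs: "r = a" "{r, s} = {b, d}" "s \<noteq> f" "{g, h} = {s, f}"
  shows False
proof -
  let ?p = "port_colour c a b d f g h"
  have inj: "inj_on (?p v) (nbrs Q v)" and lt: "\<And>u. u \<in> nbrs Q v \<Longrightarrow> ?p v u < 3"
    if "v \<in> verts Q" "v \<noteq> z1" "v \<noteq> z2" for v
    using p that by (auto simp: proper_port_colouring_def)
  \<comment> \<open>The colours 0, 1, 2 add up to 3, so \<open>m\<close> is the third one besides
    \<open>s\<close> and \<open>f\<close>.\<close>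
  define m where "m = 3 - s - f"
  define c' where "c' e = (if e = {x1, x2} then r else if e = {x2, z2} then s else if e = {z2, x6} then f
    else if e = {z2, z1} then m else if e = {z1, x4} then g else if e = {z1, x5} then h else c e)" for e
  have dv: "x1 \<noteq> x2" "x1 \<noteq> z2" "x1 \<noteq> x6" "x1 \<noteq> x4" "x1 \<noteq> z1" "x1 \<noteq> x5" "x2 \<noteq> z2" "x2 \<noteq> x6" "x2 \<noteq> x4"
    "x2 \<noteq> z1" "x2 \<noteq> x5" "z2 \<noteq> x6" "z2 \<noteq> x4" "z2 \<noteq> z1" "z2 \<noteq> x5" "x6 \<noteq> x4" "x6 \<noteq> z1" "x6 \<noteq> x5"
    "x4 \<noteq> z1" "x4 \<noteq> x5" "z1 \<noteq> x5" "w \<noteq> x1" "w \<noteq> x2" "w \<noteq> z2" "w \<noteq> x6" "w \<noteq> x4" "w \<noteq> z1" "w \<noteq> x5"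
    using distinct_vertices w_distinct by auto
  have f3: "f < 3" using lt[of x6 z2] dv nbrs_sym[of z2 Q x6] nbrs_z2 by (auto simp: port_colour_def)
  have px2: "?p x2 x1 = b" "?p x2 z2 = d" "?p x2 w = c {x2, w}" using dv by (auto simp: port_colour_def)
  have bd: "b < 3" "d < 3" "c {x2, w} < 3" "b \<noteq> d" "c {x2, w} \<noteq> b" "c {x2, w} \<noteq> d"
  proof -
    have n: "x1 \<in> nbrs Q x2" "z2 \<in> nbrs Q x2" "w \<in> nbrs Q x2" by (simp_all add: nbrs_x2)
    have x2: "x2 \<in> verts Q" "x2 \<noteq> z1" "x2 \<noteq> z2" using dv by auto
    show "b < 3" "d < 3" "c {x2, w} < 3" using lt[OF x2] n px2 by metis+
    show "b \<noteq> d" "c {x2, w} \<noteq> b" "c {x2, w} \<noteq> d"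
      using inj_onD[OF inj[OF x2], of x1 z2] inj_onD[OF inj[OF x2], of x1 w]
        inj_onD[OF inj[OF x2], of z2 w] n px2 dv by metis+
  qed
  have s3: "s < 3" "r < 3" using rs bd by (auto simp: doubleton_eq_iff)
  have m: "m < 3" "m \<noteq> s" "m \<noteq> f" using s3 f3 rs(3) unfolding m_def by presburger+
  have c'_generic: "c' {v, u} = ?p v u" if v: "v \<in> verts Q" "v \<notin> {x2, z1, z2}" and u: "u \<in> nbrs Q v" for v u
  proof -
    have "u = z1 \<Longrightarrow> v \<in> {x4, x5}" "u = z2 \<Longrightarrow> v = x6" "u = x2 \<Longrightarrow> v \<in> {x1, w}"
      using u v nbrs_sym[of u Q v] nbrs_z1 nbrs_z2 nbrs_x2 by auto
    then show ?thesis using v dv rs(1) by (auto simp: c'_def port_colour_def doubleton_eq_iff)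
  qed
  have c'_x2: "c' {x2, x1} = r" "c' {x2, z2} = s" "c' {x2, w} = c {x2, w}"
    and c'_z1: "c' {z1, x4} = g" "c' {z1, x5} = h" "c' {z1, z2} = m"
    and c'_z2: "c' {z2, x2} = s" "c' {z2, x6} = f" "c' {z2, z1} = m"
    using dv by (auto simp: c'_def doubleton_eq_iff)
  have inj_c': "inj_on (\<lambda>u. c' {v, u}) (nbrs Q v)" if v: "v \<in> verts Q" for v
  proof -
    consider "v = x2" | "v = z1" | "v = z2" | "v \<notin> {x2, z1, z2}" by auto
    then show ?thesis
    proof cases
      case 1
      have "r \<noteq> s" "c {x2, w} \<noteq> r" "c {x2, w} \<noteq> s" using bd rs(2) by (auto simp: doubleton_eq_iff)
      then show ?thesis using c'_x2 unfolding 1 nbrs_x2 by (intro inj_onI) (elim insertE emptyE; simp)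
    next
      case 2
      have "g \<noteq> h" "g \<noteq> m" "h \<noteq> m" using m rs(3,4) by (auto simp: doubleton_eq_iff)
      then show ?thesis using c'_z1 unfolding 2 nbrs_z1 by (intro inj_onI) (elim insertE emptyE; simp)
    next
      case 3
      show ?thesis using c'_z2 m rs(3) unfolding 3 nbrs_z2 by (intro inj_onI) (elim insertE emptyE; simp)
    next
      case 4
      then have "inj_on (?p v) (nbrs Q v)" using inj v by auto
      then show ?thesis by (rule inj_on_cong[THEN iffD1, rotated]) (simp add: c'_generic[OF v 4])
    qed
  qed
  have lt_c': "c' e < 3" if e: "e \<in> edges Q" for e
  proof -
    obtain u v where uv: "e = {u, v}" "u \<in> verts Q" using simple_edgeE[OF simple e] by metis
    then have vu: "v \<in> nbrs Q u" using e by (simp add: nbrs_def)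
    have gh: "g < 3" "h < 3" using rs(4) s3 f3 by (auto simp: doubleton_eq_iff)
    consider "u = x2" | "u = z1" | "u = z2" | "u \<notin> {x2, z1, z2}" by auto
    then show ?thesis
    proof cases
      case 4
      then show ?thesis using uv vu c'_generic lt by auto
    qed (use uv vu c'_x2 c'_z1 c'_z2 bd s3 m f3 gh in \<open>auto simp: nbrs_x2 nbrs_z1 nbrs_z2\<close>)
  qed
  show False using uncol three_edge_colorable_if_proper_darts[OF simple lt_c' inj_c'] by blast
qed

lemma port_colours:
  assumes p: "proper_port_colouring c a b d f g h"
  shows "(a = b \<longrightarrow> g = h) \<and> (a = b \<and> g = h \<longrightarrow> d = f) \<and> (a \<noteq> b \<and> g \<noteq> h \<longrightarrow> d \<notin> {a, b} \<and> f \<notin> {g, h})"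
proof (rule six_colours)
  let ?p = "port_colour c a b d f g h"
  have lt: "?p v u < 3" if "v \<in> verts Q" "v \<noteq> z1" "v \<noteq> z2" "{v, u} \<in> edges Q" for v u
    using p that by (auto simp: proper_port_colouring_def nbrs_def)
  note val = port_colour_ports[of c a b d f g h]
  show "a < 3" "b < 3" "d < 3" "f < 3" "g < 3" "h < 3"
    using lt[of x1 x2] lt[of x2 x1] lt[of x2 z2] lt[of x6 z2] lt[of x4 z1] lt[of x5 z1]
      distinct_vertices path_edges unfolding val by (auto simp: insert_commute)
  have "inj_on (?p x2) (nbrs Q x2)" using p distinct_vertices by (auto simp: proper_port_colouring_def)
  then have "?p x2 x1 = ?p x2 z2 \<Longrightarrow> x1 = z2" by (rule inj_onD) (auto simp: nbrs_x2)
  then show "b \<noteq> d" using val distinct_vertices by auto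
  show "even (of_bool (a = k) + of_bool (b = k) + of_bool (d = k) + of_bool (f = k) + of_bool (g = k) + of_bool (h = k) :: nat)"
    if "k < 3" for k by (rule port_colour_parity[OF p that])
  show "\<not> (a = b \<and> d \<noteq> f \<and> {g, h} = {d, f})"
    using no_extending_colours[OF p, of b d] by auto
  show "\<not> (a = d \<and> b \<noteq> f \<and> {g, h} = {b, f})"
    using no_extending_colours[OF p, of d b] by (auto simp: insert_commute)
qed

lemma reachable_C1: "u \<in> verts C1 - {z2} \<Longrightarrow> v \<in> verts C1 - {z2} \<Longrightarrow> reachable (delete_vertices C1 {z2}) u v"
  using circ1 in1 by (auto simp: circuit_def two_connected_def connected_def delete_vertices_def induced_subgraph_def)

lemma reachable_C2: "u \<in> verts C2 - {z1} \<Longrightarrow> v \<in> verts C2 - {z1} \<Longrightarrow> reachable (delete_vertices C2 {z1}) u v"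
  using circ2 in2 by (auto simp: circuit_def two_connected_def connected_def delete_vertices_def induced_subgraph_def)

end

section \<open>The ring of summands\<close>

definition idx :: "nat set" where
  "idx = {1..4}"

text \<open>The four summands form a ring in which \<open>nx i\<close> is the summand carrying the ends \<open>x\<^sub>4\<close> and \<open>x\<^sub>5\<close> of the
  half-edges of the \<open>i\<close>-th one at \<open>x\<^sub>1\<close> and \<open>x\<^sub>2\<close>. Thus \<open>e\<^sub>2\<close> and \<open>e\<^sub>3\<close> exchange their roles between odd and
  even \<open>i\<close>.\<close>

definition nx :: "nat \<Rightarrow> nat" where
  "nx i = (if i = 1 then 4 else i - 1)"

definition hub :: "nat \<Rightarrow> 'a hvert" where
  "hub i = (if odd i then Vertex_p else Vertex_q)"

lemma index_cases: "i \<in> idx \<Longrightarrow> i = 1 \<or> i = 2 \<or> i = 3 \<or> i = (4::nat)"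
  by (auto simp: idx_def)

lemma nx_values: "nx 1 = 4" "nx (Suc 0) = 4" "nx 2 = Suc 0" "nx 3 = 2" "nx 4 = 3"
  by (simp_all add: nx_def)

lemma idx_members: "Suc 0 \<in> idx" "2 \<in> idx" "3 \<in> idx" "4 \<in> idx" "idx = {Suc 0, 2, 3, 4}"
  by (auto simp: idx_def)

lemma nx_in [simp]: "i \<in> idx \<Longrightarrow> nx i \<in> idx"
  by (auto dest!: index_cases simp: nx_values idx_members(1-4))

lemma nx_4 [simp]: "i \<in> idx \<Longrightarrow> nx (nx (nx (nx i))) = i"
  by (auto dest!: index_cases simp: nx_values)

lemma nx_neq [simp]:
  assumes "i \<in> idx"
  shows "nx i \<noteq> i" "nx (nx i) \<noteq> i" "nx (nx (nx i)) \<noteq> i" "i \<noteq> nx i" "i \<noteq> nx (nx i)" "i \<noteq> nx (nx (nx i))"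
  using index_cases[OF assms] by (elim disjE; simp add: nx_values)+

lemma even_nx: "i \<in> idx \<Longrightarrow> even (nx i) \<longleftrightarrow> odd i"
  by (auto dest!: index_cases simp: nx_values)

lemma nx_orbit: "i \<in> idx \<Longrightarrow> idx = {i, nx i, nx (nx i), nx (nx (nx i))}"
  unfolding idx_members(5) by (elim insertE emptyE) (simp_all add: nx_values insert_commute)

lemma hub_nx [simp]: "i \<in> idx \<Longrightarrow> hub (nx (nx i)) = hub i" "i \<in> idx \<Longrightarrow> hub (nx i) \<noteq> hub i"
  by (auto simp: hub_def even_nx)

lemma hub_neq_Copy [simp]: "hub i \<noteq> Copy j v" "Copy j v \<noteq> hub i"
  by (auto simp: hub_def)

lemma hub_eq_iff: "hub i = hub j \<longleftrightarrow> (odd i \<longleftrightarrow> odd j)"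
  by (simp add: hub_def)

text \<open>The edges of \<open>H\<close> are described by one rule for all summands, so that
  statements need not be repeated for each index. A chord at \<open>x6\<close> is generated twice,
  from \<open>i\<close> and from \<open>nx (nx i)\<close>; as members of a set the two
  coincide.\<close>

locale ring_of_ingredients =
  fixes Q C1 C2 :: "nat \<Rightarrow> 'a graph" and x1 x2 x4 x5 x6 z1 z2 :: "nat \<Rightarrow> 'a" and H :: "'a hvert graph"
  assumes ingredient: "i \<in> idx \<Longrightarrow>
      ingredient (Q i) (C1 i) (C2 i) (x1 i) (x2 i) (x4 i) (x5 i) (x6 i) (z1 i) (z2 i)"
    and verts_H: "verts H = {Copy i v | i v. i \<in> idx \<and> v \<in> verts (Q i) - {z1 i, z2 i}} \<union> {Vertex_p, Vertex_q}"
    and edges_H: "edges H =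
      {{Copy i u, Copy i v} | i u v. i \<in> idx \<and> {u, v} \<in> edges (Q i) \<and> {u, v} \<noteq> {x1 i, x2 i} \<and>
         {u, v} \<inter> {z1 i, z2 i} = {}} \<union>
      (\<Union>i\<in>idx. {{Copy i (x1 i), Copy (nx i) (x4 (nx i))}, {Copy i (x2 i), Copy (nx i) (x5 (nx i))},
         {Copy i (x6 i), Copy (nx (nx i)) (x6 (nx (nx i)))}, {Copy i (x2 i), hub i}}) \<union>
      {{Vertex_p, Vertex_q}}"
begin

text \<open>Sends the edge \<open>vu\<close> of \<open>Q i\<close>, seen from \<open>v\<close>, to the other end of the corresponding edge of \<open>H\<close>.\<close>

definition "port i v u =
  (if v = x1 i \<and> u = x2 i then Copy (nx i) (x4 (nx i))
   else if v = x2 i \<and> u = x1 i then Copy (nx i) (x5 (nx i))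
   else if v = x2 i \<and> u = z2 i then hub i
   else if v = x6 i \<and> u = z2 i then Copy (nx (nx i)) (x6 (nx (nx i)))
   else if v = x4 i \<and> u = z1 i then Copy (nx (nx (nx i))) (x1 (nx (nx (nx i))))
   else if v = x5 i \<and> u = z1 i then Copy (nx (nx (nx i))) (x2 (nx (nx (nx i))))
   else Copy i u)"

lemma port_distinct:
  assumes "i \<in> idx"
  shows "x1 i \<noteq> x2 i" "x1 i \<noteq> z2 i" "x1 i \<noteq> x6 i" "x1 i \<noteq> x4 i" "x1 i \<noteq> z1 i" "x1 i \<noteq> x5 i"
    "x2 i \<noteq> z2 i" "x2 i \<noteq> x6 i" "x2 i \<noteq> x4 i" "x2 i \<noteq> z1 i" "x2 i \<noteq> x5 i" "z2 i \<noteq> x6 i" "z2 i \<noteq> x4 i"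
    "z2 i \<noteq> z1 i" "z2 i \<noteq> x5 i" "x6 i \<noteq> x4 i" "x6 i \<noteq> z1 i" "x6 i \<noteq> x5 i" "x4 i \<noteq> z1 i" "x4 i \<noteq> x5 i" "z1 i \<noteq> x5 i"
  using ingredient.distinct_vertices[OF ingredient[OF assms]] by simp_all

lemma port_ports:
  assumes "i \<in> idx"
  shows "port i (x1 i) (x2 i) = Copy (nx i) (x4 (nx i))" "port i (x2 i) (x1 i) = Copy (nx i) (x5 (nx i))"
    "port i (x2 i) (z2 i) = hub i" "port i (x6 i) (z2 i) = Copy (nx (nx i)) (x6 (nx (nx i)))"
    "port i (x4 i) (z1 i) = Copy (nx (nx (nx i))) (x1 (nx (nx (nx i))))"
    "port i (x5 i) (z1 i) = Copy (nx (nx (nx i))) (x2 (nx (nx (nx i))))"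
  using port_distinct[OF assms] by (simp_all add: port_def)

lemma port_inner:
  assumes "(v, u) \<notin> {(x1 i, x2 i), (x2 i, x1 i), (x2 i, z2 i), (x6 i, z2 i), (x4 i, z1 i), (x5 i, z1 i)}"
  shows "port i v u = Copy i u"
proof -
  have "\<not> (v = x1 i \<and> u = x2 i)" "\<not> (v = x2 i \<and> u = x1 i)" "\<not> (v = x2 i \<and> u = z2 i)"
    "\<not> (v = x6 i \<and> u = z2 i)" "\<not> (v = x4 i \<and> u = z1 i)" "\<not> (v = x5 i \<and> u = z1 i)"
    using assms by blast+
  then show ?thesis unfolding port_def by (simp only: if_False)
qed

text \<open>Apart from \<open>z1\<close> and \<open>z2\<close> themselves, their neighbours are
  \<open>x2\<close>, \<open>x6\<close>, \<open>x4\<close>, \<open>x5\<close>, and the darts from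
  these are among the six listed.\<close>

lemma inner_dart:
  assumes i: "i \<in> idx" and v: "v \<notin> {z1 i, z2 i}" and u: "{v, u} \<in> edges (Q i)"
    and n: "(v, u) \<notin> {(x1 i, x2 i), (x2 i, x1 i), (x2 i, z2 i), (x6 i, z2 i), (x4 i, z1 i), (x5 i, z1 i)}"
  shows "{v, u} \<noteq> {x1 i, x2 i}" "u \<noteq> z1 i" "u \<noteq> z2 i"
proof -
  interpret ingredient "Q i" "C1 i" "C2 i" "x1 i" "x2 i" "x4 i" "x5 i" "x6 i" "z1 i" "z2 i"
    by (rule ingredient[OF i])
  show "{v, u} \<noteq> {x1 i, x2 i}" using n by (auto simp: doubleton_eq_iff)
  have m: "v \<in> nbrs (Q i) u" using u by (simp add: nbrs_def insert_commute)
  show "u \<noteq> z1 i"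
  proof
    assume "u = z1 i"
    then show False using m nbrs_z1 v n by auto
  qed
  show "u \<noteq> z2 i"
  proof
    assume "u = z2 i"
    then show False using m nbrs_z2 v n by auto
  qed
qed

lemma in_edges_H:
  "i \<in> idx \<Longrightarrow> {Copy i (x1 i), Copy (nx i) (x4 (nx i))} \<in> edges H"
  "i \<in> idx \<Longrightarrow> {Copy i (x2 i), Copy (nx i) (x5 (nx i))} \<in> edges H"
  "i \<in> idx \<Longrightarrow> {Copy i (x6 i), Copy (nx (nx i)) (x6 (nx (nx i)))} \<in> edges H"
  "i \<in> idx \<Longrightarrow> {Copy i (x2 i), hub i} \<in> edges H"
  "i \<in> idx \<Longrightarrow> {hub i, hub (nx i)} \<in> edges H"
  "i \<in> idx \<Longrightarrow> {u, v} \<in> edges (Q i) \<Longrightarrow> {u, v} \<noteq> {x1 i, x2 i} \<Longrightarrow> {u, v} \<inter> {z1 i, z2 i} = {} \<Longrightarrow>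
     {Copy i u, Copy i v} \<in> edges H"
proof -
  show "i \<in> idx \<Longrightarrow> {hub i, hub (nx i)} \<in> edges H"
    by (simp add: edges_H hub_def even_nx insert_commute)
  show "i \<in> idx \<Longrightarrow> {u, v} \<in> edges (Q i) \<Longrightarrow> {u, v} \<noteq> {x1 i, x2 i} \<Longrightarrow> {u, v} \<inter> {z1 i, z2 i} = {} \<Longrightarrow>
     {Copy i u, Copy i v} \<in> edges H"
    unfolding edges_H by blast
qed (unfold edges_H, (rule UnI1, rule UnI2, rule UN_I, assumption, simp)+)

lemma edges_H_cases:
  assumes "e \<in> edges H"
  obtains i u v where "e = {Copy i u, Copy i v}" "i \<in> idx" "{u, v} \<in> edges (Q i)" "{u, v} \<noteq> {x1 i, x2 i}"
      "{u, v} \<inter> {z1 i, z2 i} = {}"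
    | i where "i \<in> idx" "e = {Copy i (x1 i), Copy (nx i) (x4 (nx i))}"
    | i where "i \<in> idx" "e = {Copy i (x2 i), Copy (nx i) (x5 (nx i))}"
    | i where "i \<in> idx" "e = {Copy i (x6 i), Copy (nx (nx i)) (x6 (nx (nx i)))}"
    | i where "i \<in> idx" "e = {Copy i (x2 i), hub i}"
    | "e = {Vertex_p, Vertex_q}"
  using assms unfolding edges_H
  by (elim UnE UN_E insertE emptyE CollectE exE conjE) (rule that; assumption)+

lemma port_edge:
  assumes i: "i \<in> idx" and v: "v \<in> verts (Q i) - {z1 i, z2 i}" and u: "u \<in> nbrs (Q i) v"
  shows "{Copy i v, port i v u} \<in> edges H"
proof (cases "(v, u) \<in> {(x1 i, x2 i), (x2 i, x1 i), (x2 i, z2 i), (x6 i, z2 i), (x4 i, z1 i), (x5 i, z1 i)}")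
  case True
  let ?p = "nx (nx (nx i))"
  have p: "?p \<in> idx" "nx ?p = i" using i by (simp_all)
  show ?thesis
    using True in_edges_H(1-4)[OF i] in_edges_H(1,2)[OF p(1)] port_ports[OF i] p(2)
    by (auto simp: insert_commute)
next
  case False
  have e: "{v, u} \<in> edges (Q i)" using u by (simp add: nbrs_def)
  have "v \<notin> {z1 i, z2 i}" using v by simp
  from inner_dart[OF i this e False] v show ?thesis
    unfolding port_inner[OF False] by (intro in_edges_H(6)[OF i e]) auto
qed

lemma port_nbrs_subset:
  assumes i: "i \<in> idx" and v: "v \<in> verts (Q i) - {z1 i, z2 i}"
  shows "nbrs H (Copy i v) \<subseteq> port i v ` nbrs (Q i) v"
proof
  interpret ingredient "Q i" "C1 i" "C2 i" "x1 i" "x2 i" "x4 i" "x5 i" "x6 i" "z1 i" "z2 i"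
    by (rule ingredient[OF i])
  have nb: "x2 i \<in> nbrs (Q i) (x1 i)" "x1 i \<in> nbrs (Q i) (x2 i)" "z2 i \<in> nbrs (Q i) (x2 i)"
    "z2 i \<in> nbrs (Q i) (x6 i)" "z1 i \<in> nbrs (Q i) (x4 i)" "z1 i \<in> nbrs (Q i) (x5 i)"
    using path_edges by (auto simp: nbrs_def insert_commute)
  fix t assume "t \<in> nbrs H (Copy i v)"
  then have "{Copy i v, t} \<in> edges H" by (simp add: nbrs_def)
  then show "t \<in> port i v ` nbrs (Q i) v"
  proof (cases rule: edges_H_cases)
    case (1 j a b)
    then obtain u where u: "t = Copy i u" "j = i" "{v, u} = {a, b}"
      by (auto simp: doubleton_eq_iff)
    have "port i v u = Copy i u"
      using 1 u(2) unfolding u(3)[symmetric] by (intro port_inner) (auto simp: doubleton_eq_iff)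
    then show ?thesis using 1 u by (intro image_eqI[of _ _ u]) (auto simp: nbrs_def)
  next
    case (2 j)
    then consider "i = j" "v = x1 i" "t = Copy (nx i) (x4 (nx i))" | "i = nx j" "v = x4 i" "t = Copy j (x1 j)"
      by (auto simp: doubleton_eq_iff)
    then show ?thesis
    proof cases
      case 1
      then show ?thesis using nb port_ports[OF i] by (intro image_eqI[of _ _ "x2 i"]) auto
    next
      case b: 2
      then have "j = nx (nx (nx i))" using 2(1) by (simp)
      then show ?thesis using b nb port_ports[OF i] by (intro image_eqI[of _ _ "z1 i"]) auto
    qed
  next
    case (3 j)
    then consider "i = j" "v = x2 i" "t = Copy (nx i) (x5 (nx i))" | "i = nx j" "v = x5 i" "t = Copy j (x2 j)"
      by (auto simp: doubleton_eq_iff)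
    then show ?thesis
    proof cases
      case 1
      then show ?thesis using nb port_ports[OF i] by (intro image_eqI[of _ _ "x1 i"]) auto
    next
      case b: 2
      then have "j = nx (nx (nx i))" using 3(1) by (simp)
      then show ?thesis using b nb port_ports[OF i] by (intro image_eqI[of _ _ "z1 i"]) auto
    qed
  next
    case (4 j)
    then consider "i = j" "v = x6 i" "t = Copy (nx (nx i)) (x6 (nx (nx i)))" | "i = nx (nx j)" "v = x6 i" "t = Copy j (x6 j)"
      by (auto simp: doubleton_eq_iff)
    then show ?thesis
    proof cases
      case 1
      then show ?thesis using nb port_ports[OF i] by (intro image_eqI[of _ _ "z2 i"]) auto
    next
      case b: 2
      then have "j = nx (nx i)" using 4(1) by (simp)
      then show ?thesis using b nb port_ports[OF i] by (intro image_eqI[of _ _ "z2 i"]) auto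
    qed
  next
    case (5 j)
    then have "i = j" "v = x2 i" "t = hub i" by (auto simp: doubleton_eq_iff)
    then show ?thesis using nb port_ports[OF i] by (intro image_eqI[of _ _ "z2 i"]) auto
  next
    case 6
    then show ?thesis by (auto simp: doubleton_eq_iff)
  qed
qed

lemma nbrs_Copy:
  assumes "i \<in> idx" "v \<in> verts (Q i) - {z1 i, z2 i}"
  shows "nbrs H (Copy i v) = port i v ` nbrs (Q i) v"
proof
  show "port i v ` nbrs (Q i) v \<subseteq> nbrs H (Copy i v)"
    using port_edge[OF assms] by (auto simp: nbrs_def)
qed (rule port_nbrs_subset[OF assms])

text \<open>The six boundary darts lead out of the copy \<open>i\<close>, all others stay in it.
  Only \<open>x2\<close> has two boundary darts, and one of them ends in the next summand, the other
  in a hub.\<close>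

lemma inj_port:
  assumes i: "i \<in> idx"
  shows "inj_on (port i v) (nbrs (Q i) v)"
proof (rule inj_onI)
  fix a b assume e: "port i v a = port i v b"
  define P where "P = {(x1 i, x2 i), (x2 i, x1 i), (x2 i, z2 i), (x6 i, z2 i), (x4 i, z1 i), (x5 i, z1 i)}"
  have outer: "port i v c \<noteq> Copy i d" if "(v, c) \<in> P" for c d
    using that nx_neq[OF i] by (auto simp: P_def port_ports[OF i])
  have inner: "port i v c = Copy i c" if "(v, c) \<notin> P" for c
    using that unfolding P_def by (rule port_inner)
  show "a = b"
  proof (cases "(v, a) \<in> P \<and> (v, b) \<in> P")
    case True
    then show ?thesis
    proof (cases "v = x2 i")
      case v: True
      then have "a \<in> {x1 i, z2 i}" "b \<in> {x1 i, z2 i}" using True port_distinct[OF i] by (auto simp: P_def)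
      then show ?thesis using e port_ports[OF i] v by auto
    next
      case v: False
      then show ?thesis using True port_distinct[OF i] by (auto simp: P_def)
    qed
  next
    case False
    then consider "(v, a) \<in> P" "(v, b) \<notin> P" | "(v, a) \<notin> P" "(v, b) \<in> P" | "(v, a) \<notin> P" "(v, b) \<notin> P"
      by blast
    then show ?thesis
    proof cases
      case 1
      show ?thesis using outer[OF 1(1), of b] e unfolding inner[OF 1(2)] by (rule notE)
    next
      case 2
      show ?thesis using outer[OF 2(2), of a] e[symmetric] unfolding inner[OF 2(1)] by (rule notE)
    next
      case 3
      show ?thesis using e unfolding inner[OF 3(1)] inner[OF 3(2)] by (rule hvert.inject(1)[THEN iffD1, THEN conjunct2])
    qed
  qed
qed

lemma nbrs_hub:
  assumes i: "i \<in> idx"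
  shows "nbrs H (hub i) = {Copy i (x2 i), Copy (nx (nx i)) (x2 (nx (nx i))), hub (nx i)}"
proof (intro equalityI subsetI)
  fix t assume "t \<in> nbrs H (hub i)"
  then have e: "{hub i, t} \<in> edges H" by (simp add: nbrs_def)
  have "t = hub (nx i) \<or> (\<exists>j\<in>idx. t = Copy j (x2 j) \<and> hub i = (hub j :: 'a hvert))"
    using e unfolding edges_H
    by (auto simp: doubleton_eq_iff hub_def even_nx[OF i] split: if_splits)
  moreover have "j = i \<or> j = nx (nx i)" if "j \<in> idx" "hub i = (hub j :: 'a hvert)" for j
  proof -
    have "j \<in> {i, nx i, nx (nx i), nx (nx (nx i))}" using that(1) nx_orbit[OF i] by blast
    then show ?thesis using that(2) i by (auto simp: hub_eq_iff even_nx)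
  qed
  ultimately show "t \<in> {Copy i (x2 i), Copy (nx (nx i)) (x2 (nx (nx i))), hub (nx i)}" by auto
next
  fix t assume "t \<in> {Copy i (x2 i), Copy (nx (nx i)) (x2 (nx (nx i))), hub (nx i)}"
  then show "t \<in> nbrs H (hub i)"
    using in_edges_H(4,5)[OF i] in_edges_H(4)[of "nx (nx i)"] i
    by (auto simp: nbrs_def insert_commute)
qed

lemma hub_cases: "Vertex_p = hub 1" "Vertex_q = hub 2"
  by (auto simp: hub_def)

lemma Copy_in_H: "Copy i v \<in> verts H \<longleftrightarrow> i \<in> idx \<and> v \<in> verts (Q i) - {z1 i, z2 i}"
  by (auto simp: verts_H)

lemma hub_in_H [simp]: "hub i \<in> verts H"
  by (auto simp: verts_H hub_def)

lemma verts_H_cases: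
  assumes "t \<in> verts H"
  obtains i v where "t = Copy i v" "i \<in> idx" "v \<in> verts (Q i) - {z1 i, z2 i}" | i where "t = hub i" "i \<in> idx"
  
proof -
  consider i v where "t = Copy i v" "i \<in> idx" "v \<in> verts (Q i) - {z1 i, z2 i}" | "t = hub 1" | "t = hub 2"
    using assms hub_cases unfolding verts_H by auto
  moreover have "(1 :: nat) \<in> idx" "(2 :: nat) \<in> idx" by (auto simp: idx_def)
  ultimately show ?thesis using that by cases blast+
qed

lemma port_vertices_in_H:
  assumes "i \<in> idx"
  shows "Copy i (x1 i) \<in> verts H" "Copy i (x2 i) \<in> verts H" "Copy i (x4 i) \<in> verts H"
    "Copy i (x5 i) \<in> verts H" "Copy i (x6 i) \<in> verts H"
  using ingredient.in_Q[OF ingredient[OF assms]] port_distinct[OF assms] assms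
  by (auto simp: Copy_in_H)

lemma simple_H: "simple_graph H"
  unfolding simple_graph_def
proof (intro conjI ballI)
  have "verts H \<subseteq> (\<Union>i\<in>idx. Copy i ` verts (Q i)) \<union> {Vertex_p, Vertex_q}"
    by (auto simp: verts_H)
  moreover have "finite (verts (Q i))" if "i \<in> idx" for i
    using ingredient.fin[OF ingredient[OF that]] .
  moreover have "finite idx" by (simp add: idx_def)
  ultimately show "finite (verts H)" by (intro finite_subset[of "verts H"]) auto
  fix e assume "e \<in> edges H"
  moreover have wit: "\<exists>u v. u \<in> verts H \<and> v \<in> verts H \<and> u \<noteq> v \<and> e = {u, v}"
    if "a \<in> verts H" "b \<in> verts H" "a \<noteq> b" "e = {a, b}" for a b using that by blast
  ultimately show "\<exists>u v. u \<in> verts H \<and> v \<in> verts H \<and> u \<noteq> v \<and> e = {u, v}"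
  proof (cases rule: edges_H_cases)
    case (1 i u v)
    then have "u \<noteq> v" "u \<in> verts (Q i)" "v \<in> verts (Q i)"
      using simple_edgeD[OF ingredient.simple[OF ingredient[OF 1(2)]] 1(3)] by auto
    then have "Copy i u \<in> verts H" "Copy i v \<in> verts H" "Copy i u \<noteq> Copy i v"
      using 1(2,5) by (auto simp: Copy_in_H)
    then show ?thesis using 1(1) by (rule wit)
  next
    case (2 i)
    then have "Copy i (x1 i) \<noteq> Copy (nx i) (x4 (nx i))" by simp
    then show ?thesis using 2(2)
      by (rule wit[OF port_vertices_in_H(1)[OF 2(1)] port_vertices_in_H(3)[OF nx_in[OF 2(1)]]])
  next
    case (3 i)
    then have "Copy i (x2 i) \<noteq> Copy (nx i) (x5 (nx i))" by simp
    then show ?thesis using 3(2)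
      by (rule wit[OF port_vertices_in_H(2)[OF 3(1)] port_vertices_in_H(4)[OF nx_in[OF 3(1)]]])
  next
    case (4 i)
    then have "Copy i (x6 i) \<noteq> Copy (nx (nx i)) (x6 (nx (nx i)))" by simp
    then show ?thesis using 4(2)
      by (rule wit[OF port_vertices_in_H(5)[OF 4(1)] port_vertices_in_H(5)[OF nx_in[OF nx_in[OF 4(1)]]]])
  next
    case (5 i)
    show ?thesis by (rule wit[OF port_vertices_in_H(2)[OF 5(1)] hub_in_H hub_neq_Copy(2) 5(2)])
  next
    case 6
    have "Vertex_p \<in> verts H" "Vertex_q \<in> verts H" by (simp_all add: verts_H)
    then show ?thesis using 6 by (intro wit) simp_all
  qed
qed

lemma cubic_H: "cubic H"
  unfolding cubic_def regular_def
proof (intro conjI ballI simple_H)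
  fix t assume "t \<in> verts H"
  then show "degree H t = 3"
  proof (cases rule: verts_H_cases)
    case (1 i v)
    then show ?thesis
      using cubic_nbrs[OF ingredient.cub[OF ingredient[OF 1(2)]]] inj_port[OF 1(2), of v]
      by (simp add: degree_eq_card_nbrs[OF simple_H] nbrs_Copy card_image)
  next
    case (2 i)
    then have "i \<noteq> nx (nx i)" by (simp)
    then show ?thesis using 2
      by (simp add: degree_eq_card_nbrs[OF simple_H] nbrs_hub)
  qed
qed

end

section \<open>Three-edge-colourings of the ring\<close>

context ring_of_ingredients
begin

text \<open>An edge from \<open>x1\<close> or \<open>x2\<close> of one summand to \<open>x4\<close>
  or \<open>x5\<close> of the next is a half-edge of both. So the colours \<open>g, h\<close> of the
  summand \<open>i\<close> are the colours \<open>a, b\<close> of its predecessor \<open>j\<close>,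
  which links the constraints around the ring.\<close>

lemma port_colours_H:
  assumes i: "i \<in> idx" and c: "\<And>e. e \<in> edges H \<Longrightarrow> c e < (3::nat)"
    "\<And>e e'. e \<in> edges H \<Longrightarrow> e' \<in> edges H \<Longrightarrow> e \<noteq> e' \<Longrightarrow> e \<inter> e' \<noteq> {} \<Longrightarrow> c e \<noteq> c e'"
    and a: "\<And>i. a i = c {Copy i (x1 i), Copy (nx i) (x4 (nx i))}"
    and b: "\<And>i. b i = c {Copy i (x2 i), Copy (nx i) (x5 (nx i))}"
    and d: "\<And>i. d i = c {Copy i (x2 i), hub i}"
    and f: "\<And>i. f i = c {Copy i (x6 i), Copy (nx (nx i)) (x6 (nx (nx i)))}"
    and j: "j = nx (nx (nx i))"
  shows "(a i = b i \<longrightarrow> a j = b j) \<and> (a i = b i \<and> a j = b j \<longrightarrow> d i = f i) \<and>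
    (a i \<noteq> b i \<and> a j \<noteq> b j \<longrightarrow> d i \<notin> {a i, b i} \<and> f i \<notin> {a j, b j})"
proof -
  interpret ingredient "Q i" "C1 i" "C2 i" "x1 i" "x2 i" "x4 i" "x5 i" "x6 i" "z1 i" "z2 i"
    by (rule ingredient[OF i])
  let ?p = "port_colour (\<lambda>e. c (Copy i ` e)) (a i) (b i) (d i) (f i) (a j) (b j)"
  have nj: "nx j = i" using i j by simp
  have p: "?p v u = c {Copy i v, port i v u}" for v u
    unfolding port_colour_def port_def if_distrib[of "\<lambda>t. c {Copy i v, t}"]
    by (intro if_cong refl) (simp_all add: a b d f j[symmetric] nj insert_commute)
  have "proper_port_colouring (\<lambda>e. c (Copy i ` e)) (a i) (b i) (d i) (f i) (a j) (b j)"
    unfolding proper_port_colouring_def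
  proof (intro ballI conjI)
    fix v assume v: "v \<in> verts (Q i) - {z1 i, z2 i}"
    have "inj_on (\<lambda>t. c {Copy i v, t}) (nbrs H (Copy i v))"
      using c(2) by (rule proper_darts_if_three_edge_coloring)
    then have "inj_on ((\<lambda>t. c {Copy i v, t}) \<circ> port i v) (nbrs (Q i) v)"
      using inj_port[OF i] by (intro comp_inj_on) (simp_all add: nbrs_Copy[OF i v])
    then show "inj_on (?p v) (nbrs (Q i) v)" by (simp add: p comp_def inj_on_def)
    show "?p v ` nbrs (Q i) v \<subseteq> {..<3}"
      using port_edge[OF i v] c(1) by (auto simp: p)
  qed
  then show ?thesis by (rule port_colours)
qed

lemma not_three_edge_colorable_H: "\<not> three_edge_colorable H"
proof
  assume "three_edge_colorable H"
  then obtain c where c: "\<And>e. e \<in> edges H \<Longrightarrow> c e < (3::nat)"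
    "\<And>e e'. e \<in> edges H \<Longrightarrow> e' \<in> edges H \<Longrightarrow> e \<noteq> e' \<Longrightarrow> e \<inter> e' \<noteq> {} \<Longrightarrow> c e \<noteq> c e'"
    unfolding three_edge_colorable_def by metis
  define a where "a i = c {Copy i (x1 i), Copy (nx i) (x4 (nx i))}" for i
  define b where "b i = c {Copy i (x2 i), Copy (nx i) (x5 (nx i))}" for i
  define d where "d i = c {Copy i (x2 i), hub i}" for i
  define f where "f i = c {Copy i (x6 i), Copy (nx (nx i)) (x6 (nx (nx i)))}" for i
  have rule: "(a i = b i \<longrightarrow> a j = b j) \<and> (a i = b i \<and> a j = b j \<longrightarrow> d i = f i) \<and>
    (a i \<noteq> b i \<and> a j \<noteq> b j \<longrightarrow> d i \<notin> {a i, b i} \<and> f i \<notin> {a j, b j})"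
    if "i \<in> idx" "j = nx (nx (nx i))" for i j
    using that(1) c a_def b_def d_def f_def that(2) by (rule port_colours_H)
  have lt: "a i < 3" "b i < 3" "d i < 3" "f i < 3" if "i \<in> idx" for i
    using c(1) in_edges_H(1-4)[OF that] by (auto simp: a_def b_def d_def f_def)
  have f_opp: "f 3 = f 1" "f 4 = f 2" by (simp_all add: f_def nx_values insert_commute)
  have "d 1 \<noteq> d 3"
  proof -
    have "{Copy 1 (x2 1), hub 1} \<in> edges H" "{Copy 3 (x2 3), hub 3} \<in> edges H"
      by (rule in_edges_H(4), simp add: idx_def)+
    then show ?thesis unfolding d_def by (intro c(2)) (auto simp: hub_def doubleton_eq_iff)
  qed
  moreover have "d 1 = d 3"
  proof -
    have r: "(a 1 = b 1 \<longrightarrow> a 2 = b 2) \<and> (a 1 = b 1 \<and> a 2 = b 2 \<longrightarrow> d 1 = f 1) \<and> (a 1 \<noteq> b 1 \<and> a 2 \<noteq> b 2 \<longrightarrow> d 1 \<notin> {a 1, b 1} \<and> f 1 \<notin> {a 2, b 2})"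
      "(a 2 = b 2 \<longrightarrow> a 3 = b 3) \<and> (a 2 = b 2 \<and> a 3 = b 3 \<longrightarrow> d 2 = f 2) \<and> (a 2 \<noteq> b 2 \<and> a 3 \<noteq> b 3 \<longrightarrow> d 2 \<notin> {a 2, b 2} \<and> f 2 \<notin> {a 3, b 3})"
      "(a 3 = b 3 \<longrightarrow> a 4 = b 4) \<and> (a 3 = b 3 \<and> a 4 = b 4 \<longrightarrow> d 3 = f 3) \<and> (a 3 \<noteq> b 3 \<and> a 4 \<noteq> b 4 \<longrightarrow> d 3 \<notin> {a 3, b 3} \<and> f 3 \<notin> {a 4, b 4})"
      "(a 4 = b 4 \<longrightarrow> a 1 = b 1) \<and> (a 4 = b 4 \<and> a 1 = b 1 \<longrightarrow> d 4 = f 4) \<and> (a 4 \<noteq> b 4 \<and> a 1 \<noteq> b 1 \<longrightarrow> d 4 \<notin> {a 4, b 4} \<and> f 4 \<notin> {a 1, b 1})"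
      by (rule rule; simp add: idx_def nx_def)+
    show ?thesis
    proof (cases "a 1 = b 1")
      case True
      \<comment> \<open>Equality \<open>a i = b i\<close> spreads to all \<open>i\<close>, so
        \<open>d 1 = f 1\<close> and \<open>d 3 = f 3\<close>, and the chord between summands 1 and
        3 gives \<open>f 1 = f 3\<close>.\<close>
      then show ?thesis using r f_opp by metis
    next
      case False
      then have ne: "a 2 \<noteq> b 2" "a 3 \<noteq> b 3" "a 4 \<noteq> b 4" using r by auto
      have third: "s = t" if "p < 3" "q < 3" "s < 3" "t < 3" "p \<noteq> q" "s \<notin> {p, q}" "t \<notin> {p, q}" for p q s t :: nat
        using that by auto
      have I: "1 \<in> idx" "2 \<in> idx" "3 \<in> idx" "4 \<in> idx" by (auto simp: idx_def)
      \<comment> \<open>Both are the colour missing from \<open>a 1, b 1\<close>: summand 1 has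
        these colours on its half-edges at \<open>x1\<close> and \<open>x2\<close>, summand 4 on
        those at \<open>x4\<close> and \<open>x5\<close>.\<close>
      have "d 1 = f 4"
        using r(1,4) False ne by (intro third[OF lt(1,2)[OF I(1)] lt(3)[OF I(1)] lt(4)[OF I(4)]]) auto
      moreover have "d 3 = f 2"
        using r(2,3) ne by (intro third[OF lt(1,2)[OF I(3)] lt(3)[OF I(3)] lt(4)[OF I(2)]]) auto
      ultimately show ?thesis using f_opp by simp
    qed
  qed
  ultimately show False by simp
qed

end

section \<open>The permutation 2-factor of the ring\<close>

context ring_of_ingredients
begin

text \<open>The two circuits of the permutation 2-factor of \<open>H\<close> are induced by \<open>side True\<close> and \<open>side False\<close>.
  Each follows \<open>C1\<close> in two opposite summands and \<open>C2\<close> in the other two.\<close>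

definition "layer b i = (if odd i = b then verts (C1 i) else verts (C2 i))"

definition "side b = {Copy i v | i v. i \<in> idx \<and> v \<in> layer b i - {z1 i, z2 i}} \<union> {if b then Vertex_p else Vertex_q}"

lemma Copy_in_side: "Copy i v \<in> side b \<longleftrightarrow> i \<in> idx \<and> v \<in> layer b i - {z1 i, z2 i}"
  by (auto simp: side_def)

lemma hub_in_side: "hub i \<in> side b \<longleftrightarrow> odd i = b"
  by (auto simp: side_def hub_def)

lemma layer_cover:
  assumes "i \<in> idx"
  shows "layer True i \<union> layer False i = verts (Q i)" "layer True i \<inter> layer False i = {}"
  using ingredient.cover[OF ingredient[OF assms]] ingredient.disj[OF ingredient[OF assms]]
  by (auto simp: layer_def)

lemma sides: "verts H = side True \<union> side False" "side True \<inter> side False = {}"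
proof -
  show "verts H = side True \<union> side False"
  proof (intro equalityI subsetI)
    fix t assume "t \<in> verts H"
    then show "t \<in> side True \<union> side False"
    proof (cases rule: verts_H_cases)
      case (1 i v)
      then show ?thesis using layer_cover(1)[OF 1(2)] by (auto simp: Copy_in_side)
    next
      case (2 i)
      then show ?thesis by (auto simp: hub_in_side)
    qed
  next
    fix t assume "t \<in> side True \<union> side False"
    then show "t \<in> verts H" using layer_cover(1) by (auto simp: side_def verts_H)
  qed
  show "side True \<inter> side False = {}"
    using layer_cover(2) by (fastforce simp: side_def)
qed

text \<open>The edges cut into half-edges all lie on circuits: \<open>x1 x2\<close>,
  \<open>x2 z2\<close>, \<open>z2 x6\<close> on \<open>C1\<close>, and the two edges to
  \<open>x4\<close> and \<open>x5\<close> on \<open>C2\<close>. Their new ends stay on the same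
  side: \<open>x1, x2\<close> lead from a summand following \<open>C1\<close> to the next one, which
  follows \<open>C2\<close>; \<open>x6\<close> leads to the opposite summand, which follows
  \<open>C1\<close>; and \<open>x2\<close> leads to the hub of that parity.\<close>

lemma port_in_side:
  assumes i: "i \<in> idx" and v: "v \<in> layer b i - {z1 i, z2 i}" and u: "u \<in> nbrs (Q i) v"
  shows "port i v u \<in> side b \<longleftrightarrow> u \<in> layer b i"
proof -
  interpret ingredient "Q i" "C1 i" "C2 i" "x1 i" "x2 i" "x4 i" "x5 i" "x6 i" "z1 i" "z2 i"
    by (rule ingredient[OF i])
  define P where "P = {(x1 i, x2 i), (x2 i, x1 i), (x2 i, z2 i), (x6 i, z2 i), (x4 i, z1 i), (x5 i, z1 i)}"
  show ?thesis
  proof (cases "(v, u) \<in> P")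
    case False
    have e: "{v, u} \<in> edges (Q i)" and "v \<notin> {z1 i, z2 i}" using u v by (auto simp: nbrs_def)
    from inner_dart[OF i this(2,1) False[unfolded P_def]] have "u \<notin> {z1 i, z2 i}" by simp
    then show ?thesis unfolding port_inner[OF False[unfolded P_def]] using i by (simp add: Copy_in_side)
  next
    case True
    show ?thesis
    proof (cases "odd i = b")
      case b: True
      then have "v \<in> {x1 i, x2 i, x6 i}" "u \<in> {x1 i, x2 i, z2 i}"
        using True v in1 in2 disj by (auto simp: P_def layer_def)
      then have "u \<in> layer b i" using b in1 by (auto simp: layer_def)
      moreover have "port i v u \<in> side b"
      proof -
        have "x4 (nx i) \<in> layer b (nx i) - {z1 (nx i), z2 (nx i)}" "x5 (nx i) \<in> layer b (nx i) - {z1 (nx i), z2 (nx i)}"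
          using b i ingredient.in2[OF ingredient[OF nx_in[OF i]]] port_distinct[OF nx_in[OF i]]
            even_nx[OF i] by (auto simp: layer_def)
        moreover have "x6 (nx (nx i)) \<in> layer b (nx (nx i)) - {z1 (nx (nx i)), z2 (nx (nx i))}"
          using b i ingredient.in1[OF ingredient[OF nx_in[OF nx_in[OF i]]]]
            port_distinct[OF nx_in[OF nx_in[OF i]]]
            even_nx[OF i] even_nx[OF nx_in[OF i]] by (auto simp: layer_def)
        moreover have "(v, u) \<in> {(x1 i, x2 i), (x2 i, x1 i), (x2 i, z2 i), (x6 i, z2 i)}"
          using True v b in2 disj by (auto simp: P_def layer_def)
        ultimately show ?thesis
          using i b port_ports[OF i] by (auto simp: Copy_in_side hub_in_side)
      qed
      ultimately show ?thesis by simp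
    next
      case b: False
      let ?j = "nx (nx (nx i))"
      have j: "?j \<in> idx" using i by simp
      have vu: "(v, u) \<in> {(x4 i, z1 i), (x5 i, z1 i)}"
        using True v b in1 disj by (auto simp: P_def layer_def)
      then have "u \<in> layer b i" using b in2 by (auto simp: layer_def)
      moreover have "x1 ?j \<in> layer b ?j - {z1 ?j, z2 ?j}" "x2 ?j \<in> layer b ?j - {z1 ?j, z2 ?j}"
        using b i ingredient.in1[OF ingredient[OF j]] port_distinct[OF j]
          even_nx[OF i] even_nx[OF nx_in[OF i]] even_nx[OF nx_in[OF nx_in[OF i]]] by (auto simp: layer_def)
      then have "port i v u \<in> side b" using vu port_ports[OF i] j by (auto simp: Copy_in_side)
      ultimately show ?thesis by simp
    qed
  qed
qed

lemma side_regular: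
  assumes "t \<in> side b"
  shows "card (nbrs H t \<inter> side b) = 2"
proof -
  have "t \<in> verts H" using assms sides(1) by (cases b) auto
  then show ?thesis
  proof (cases rule: verts_H_cases)
    case (1 i v)
    interpret ingredient "Q i" "C1 i" "C2 i" "x1 i" "x2 i" "x4 i" "x5 i" "x6 i" "z1 i" "z2 i"
      by (rule ingredient[OF 1(2)])
    have v: "v \<in> layer b i - {z1 i, z2 i}" using assms 1 by (simp add: Copy_in_side)
    have "nbrs H t \<inter> side b = port i v ` (nbrs (Q i) v \<inter> layer b i)"
      using port_in_side[OF 1(2) v] by (auto simp: 1(1) nbrs_Copy[OF 1(2,3)])
    also have "card \<dots> = card (nbrs (Q i) v \<inter> layer b i)"
      by (rule card_image[OF inj_on_subset[OF inj_port[OF 1(2)]]]) simp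
    also have "\<dots> = 2" using v card_nbrs_C1 card_nbrs_C2 by (auto simp: layer_def split: if_splits)
    finally show ?thesis .
  next
    case (2 i)
    then have b: "odd i = b" using assms by (simp add: hub_in_side)
    have x: "x2 j \<in> layer b j - {z1 j, z2 j}" if "j \<in> idx" "odd j = b" for j
      using that ingredient.in1[OF ingredient[OF that(1)]] port_distinct[OF that(1)] by (auto simp: layer_def)
    have "odd (nx (nx i)) = b" using b even_nx[OF 2(2)] even_nx[OF nx_in[OF 2(2)]] by simp
    then have "nbrs H t \<inter> side b = {Copy i (x2 i), Copy (nx (nx i)) (x2 (nx (nx i)))}"
      using x[of i] x[of "nx (nx i)"] b 2 even_nx[OF 2(2)] unfolding 2(1) nbrs_hub[OF 2(2)]
      by (auto simp: Copy_in_side hub_in_side)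
    then show ?thesis using 2(2) by simp
  qed
qed

lemma reachable_layer2:
  assumes i: "i \<in> idx" and b: "odd i \<noteq> b" and uv: "u \<in> verts (C2 i) - {z1 i}" "v \<in> verts (C2 i) - {z1 i}"
  shows "reachable (induced_subgraph H (side b)) (Copy i u) (Copy i v)"
proof -
  interpret ingredient "Q i" "C1 i" "C2 i" "x1 i" "x2 i" "x4 i" "x5 i" "x6 i" "z1 i" "z2 i"
    by (rule ingredient[OF i])
  show ?thesis
  proof (rule reachable_map[OF reachable_C2[OF uv]])
    fix s t assume st: "{s, t} \<in> edges (delete_vertices (C2 i) {z1 i})"
    then have "{s, t} \<in> edges (C2 i)" "s \<in> verts (C2 i) - {z1 i}" "t \<in> verts (C2 i) - {z1 i}"
      by (auto simp: delete_vertices_def induced_subgraph_def)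
    moreover have "{s, t} \<in> edges (Q i)" using calculation(1) edges_C_sub by blast
    moreover have "x1 i \<notin> {s, t}" "z2 i \<notin> {s, t}" using calculation(2,3) in1 disj by auto
    ultimately have "{Copy i s, Copy i t} \<in> edges H" "{Copy i s, Copy i t} \<subseteq> side b"
      using i b by (auto intro!: in_edges_H(6) simp: Copy_in_side layer_def)
    then show "reachable (induced_subgraph H (side b)) (Copy i s) (Copy i t)"
      by (intro reachable_edge) (simp add: induced_subgraph_def)
  qed
qed

text \<open>Without \<open>z2\<close> the circuit \<open>C1\<close> is a path, but it uses the edge
  \<open>x1 x2\<close>, which is absent from \<open>H\<close>. The gap is bridged by the whole
  \<open>C2\<close> path of the next summand, from \<open>x4\<close> to \<open>x5\<close>.\<close>

lemma reachable_layer1: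
  assumes i: "i \<in> idx" and b: "odd i = b" and uv: "u \<in> verts (C1 i) - {z2 i}" "v \<in> verts (C1 i) - {z2 i}"
  shows "reachable (induced_subgraph H (side b)) (Copy i u) (Copy i v)"
proof -
  let ?G = "induced_subgraph H (side b)"
  interpret ingredient "Q i" "C1 i" "C2 i" "x1 i" "x2 i" "x4 i" "x5 i" "x6 i" "z1 i" "z2 i"
    by (rule ingredient[OF i])
  have edge: "reachable ?G s t" if "{s, t} \<in> edges H" "s \<in> side b" "t \<in> side b" for s t
    using that by (intro reachable_edge) (simp add: induced_subgraph_def)
  have n: "nx i \<in> idx" "odd (nx i) \<noteq> b" using i b even_nx[OF i] by auto
  have p: "Copy i (x1 i) \<in> side b" "Copy i (x2 i) \<in> side b"
    using i b in1 port_distinct[OF i] by (auto simp: Copy_in_side layer_def)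
  have x45: "x4 (nx i) \<in> verts (C2 (nx i)) - {z1 (nx i)}" "x5 (nx i) \<in> verts (C2 (nx i)) - {z1 (nx i)}"
    using ingredient.in2[OF ingredient[OF n(1)]] port_distinct[OF n(1)] by auto
  then have q: "Copy (nx i) (x4 (nx i)) \<in> side b" "Copy (nx i) (x5 (nx i)) \<in> side b"
    using n port_distinct[OF n(1)] by (auto simp: Copy_in_side layer_def)
  have x12: "reachable ?G (Copy i (x1 i)) (Copy i (x2 i))"
  proof -
    have "reachable ?G (Copy i (x1 i)) (Copy (nx i) (x4 (nx i)))"
      by (rule edge[OF in_edges_H(1)[OF i] p(1) q(1)])
    moreover have "reachable ?G (Copy (nx i) (x4 (nx i))) (Copy (nx i) (x5 (nx i)))"
      by (rule reachable_layer2[OF n x45])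
    moreover have "reachable ?G (Copy (nx i) (x5 (nx i))) (Copy i (x2 i))"
      by (rule reachable_sym[OF edge[OF in_edges_H(2)[OF i] p(2) q(2)]])
    ultimately show ?thesis by (blast intro: reachable_trans)
  qed
  show ?thesis
  proof (rule reachable_map[OF reachable_C1[OF uv]])
    fix s t assume st: "{s, t} \<in> edges (delete_vertices (C1 i) {z2 i})"
    then have "{s, t} \<in> edges (C1 i)" and V: "s \<in> verts (C1 i) - {z2 i}" "t \<in> verts (C1 i) - {z2 i}"
      by (auto simp: delete_vertices_def induced_subgraph_def)
    then have e: "{s, t} \<in> edges (Q i)" using edges_C_sub by blast
    have z: "z1 i \<notin> {s, t}" using V in2 disj by auto
    have sd: "Copy i s \<in> side b" "Copy i t \<in> side b" using V z i b by (auto simp: Copy_in_side layer_def)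
    show "reachable ?G (Copy i s) (Copy i t)"
    proof (cases "{s, t} = {x1 i, x2 i}")
      case True
      then show ?thesis using x12 reachable_sym[OF x12] by (auto simp: doubleton_eq_iff)
    next
      case False
      have "{Copy i s, Copy i t} \<in> edges H"
        by (rule in_edges_H(6)[OF i e False]) (use V z in auto)
      then show ?thesis using edge sd by blast
    qed
  qed
qed

text \<open>Summands following \<open>C1\<close> are attached to the hub through \<open>x2\<close>;
  those following \<open>C2\<close> are attached through \<open>x4\<close> to the vertex
  \<open>x1\<close> of their predecessor.\<close>

lemma side_connected: "connected (induced_subgraph H (side b))"
proof -
  let ?G = "induced_subgraph H (side b)"
  let ?r = "if b then Vertex_p else Vertex_q :: 'a hvert"
  have edge: "reachable ?G s t" if "{s, t} \<in> edges H" "s \<in> side b" "t \<in> side b" for s t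
    using that by (intro reachable_edge) (simp add: induced_subgraph_def)
  have from1: "reachable ?G ?r (Copy i v)" if i: "i \<in> idx" "odd i = b" and v: "v \<in> verts (C1 i) - {z2 i}" for i v
  proof -
    have x2: "x2 i \<in> verts (C1 i) - {z2 i}"
      using ingredient.in1[OF ingredient[OF i(1)]] port_distinct[OF i(1)] by auto
    have r: "hub i = ?r" using i(2) by (simp add: hub_def)
    have "reachable ?G (Copy i (x2 i)) (hub i)"
      using i x2 port_distinct[OF i(1)]
      by (intro edge in_edges_H(4)) (auto simp: Copy_in_side hub_in_side layer_def)
    then show ?thesis
      unfolding r by (rule reachable_trans[OF reachable_sym reachable_layer1[OF i x2 v]])
  qed
  have reach: "reachable ?G ?r t" if "t \<in> side b" for t
  proof -
    consider "t = ?r" | i v where "t = Copy i v" "i \<in> idx" "v \<in> layer b i - {z1 i, z2 i}"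
      using \<open>t \<in> side b\<close> unfolding side_def by blast
    then show ?thesis
    proof cases
      case 1
      then show ?thesis by (simp add: reachable_refl)
    next
      case (2 i v)
      show ?thesis
      proof (cases "odd i = b")
        case True
        then show ?thesis using from1[OF 2(2) True] 2 by (simp add: layer_def)
      next
        case False
        let ?j = "nx (nx (nx i))"
        have j: "?j \<in> idx" "nx ?j = i" "odd ?j = b"
          using 2(2) False even_nx[OF 2(2)] even_nx[OF nx_in[OF 2(2)]] even_nx[OF nx_in[OF nx_in[OF 2(2)]]] by auto
        have x1: "x1 ?j \<in> verts (C1 ?j) - {z2 ?j}"
          using ingredient.in1[OF ingredient[OF j(1)]] port_distinct[OF j(1)] by auto
        have x4: "x4 i \<in> verts (C2 i) - {z1 i}"
          using ingredient.in2[OF ingredient[OF 2(2)]] port_distinct[OF 2(2)] by auto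
        have "{Copy ?j (x1 ?j), Copy i (x4 i)} \<in> edges H" using in_edges_H(1)[OF j(1)] j(2) by simp
        then have "reachable ?G (Copy ?j (x1 ?j)) (Copy i (x4 i))"
          using x1 x4 j 2(2) False port_distinct[OF j(1)] port_distinct[OF 2(2)]
          by (intro edge) (auto simp: Copy_in_side layer_def)
        then have "reachable ?G ?r (Copy i (x4 i))" by (rule reachable_trans[OF from1[OF j(1,3) x1]])
        moreover have "reachable ?G (Copy i (x4 i)) (Copy i v)"
          by (rule reachable_layer2[OF 2(2) False x4]) (use 2(3) False in \<open>simp add: layer_def\<close>)
        ultimately show ?thesis unfolding 2(1) by (rule reachable_trans)
      qed
    qed
  qed
  have "?r \<in> side b" by (simp add: side_def)
  moreover have "reachable ?G s t" if "s \<in> side b" "t \<in> side b" for s t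
    by (rule reachable_trans[OF reachable_sym[OF reach[OF that(1)]] reach[OF that(2)]])
  ultimately show ?thesis by (auto simp: connected_def induced_subgraph_def)
qed

lemma side_circuit: "circuit (induced_subgraph H (side b))"
proof (rule circuit_if_connected_two_regular)
  have sub: "side b \<subseteq> verts H" using sides(1) by (cases b) auto
  show s: "simple_graph (induced_subgraph H (side b))" by (rule simple_induced[OF simple_H sub])
  show "regular 2 (induced_subgraph H (side b))"
    unfolding regular_def
  proof
    fix t assume "t \<in> verts (induced_subgraph H (side b))"
    then have "t \<in> side b" by (simp add: induced_subgraph_def)
    then show "degree (induced_subgraph H (side b)) t = 2"
      using side_regular by (simp add: degree_eq_card_nbrs[OF s] nbrs_induced)
  qed
qed (rule side_connected)

lemma cycle_permutation_graph_H: "cycle_permutation_graph H"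
  unfolding cycle_permutation_graph_def
  using cubic_H permutation_two_factor_if_circuits[OF simple_H sides side_circuit side_circuit] by blast

text \<open>A single copy suffices: it lacks \<open>z1\<close> and \<open>z2\<close>, and the two
  hubs make up for them.\<close>

lemma card_H_ge: "7 \<le> card (verts H)"
proof -
  have i: "2 \<in> idx" by (simp add: idx_def)
  interpret ingredient "Q 2" "C1 2" "C2 2" "x1 2" "x2 2" "x4 2" "x5 2" "x6 2" "z1 2" "z2 2"
    by (rule ingredient[OF i])
  let ?S = "Copy 2 ` (verts (Q 2) - {z1 2, z2 2}) \<union> {Vertex_p, Vertex_q}"
  have "card ?S = card (Copy 2 ` (verts (Q 2) - {z1 2, z2 2})) + card {Vertex_p, Vertex_q :: 'a hvert}"
    using fin by (intro card_Un_disjoint) auto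
  also have "card (Copy 2 ` (verts (Q 2) - {z1 2, z2 2})) = card (verts (Q 2) - {z1 2, z2 2})"
    by (intro card_image) (simp add: inj_on_def)
  also have "\<dots> = card (verts (Q 2)) - 2"
  proof -
    have "card {z1 2, z2 2} = 2" using port_distinct(14)[OF i] by (metis card_2_iff)
    then show ?thesis by (simp add: card_Diff_subset)
  qed
  finally have "7 \<le> card ?S" using card_Q_ge by simp
  also have "\<dots> \<le> card (verts H)"
    using simple_H i by (intro card_mono) (auto simp: verts_H simple_graph_def)
  finally show ?thesis .
qed

end

section \<open>Edge cuts of the ring\<close>

lemma length_filter_conv_sum_list: "length (filter P xs) = (\<Sum>x\<leftarrow>xs. of_bool (P x))"
  by (induction xs) auto

context ring_of_ingredients
begin

definition "core i = verts (Q i) - {x2 i, z2 i, z1 i}"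

definition "w i = third_nbr (Q i) (x2 i) (x1 i) (z2 i)"

definition "core_cut i S = {(u, v). u \<in> S \<and> v \<in> core i - S \<and> {u, v} \<in> edges (Q i)}"

definition "trace U i = {v \<in> core i. Copy i v \<in> U}"

definition "crosses U a b = (of_bool ((a \<in> U) \<noteq> (b \<in> U)) :: nat)"

text \<open>Apart from the chords at \<open>x6\<close> and the edge pq, every edge of
  \<open>H\<close> outside the cores is counted here for exactly one \<open>i\<close>.\<close>

definition "ring_crossings U i = crosses U (Copy i (x1 i)) (Copy (nx i) (x4 (nx i))) + crosses U (Copy i (x2 i)) (Copy i (w i))
  + crosses U (Copy i (x2 i)) (Copy (nx i) (x5 (nx i))) + crosses U (Copy i (x2 i)) (hub i)"

definition "chord_crossings U i = crosses U (Copy i (x6 i)) (Copy (nx (nx i)) (x6 (nx (nx i))))"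

lemma w_facts:
  assumes i: "i \<in> idx"
  shows "w i \<noteq> x1 i" "w i \<noteq> x2 i" "w i \<noteq> z2 i" "w i \<noteq> x6 i" "w i \<noteq> x4 i" "w i \<noteq> z1 i" "w i \<noteq> x5 i"
    "{x2 i, w i} \<in> edges (Q i)" "w i \<in> core i"
proof -
  interpret ing: ingredient "Q i" "C1 i" "C2 i" "x1 i" "x2 i" "x4 i" "x5 i" "x6 i" "z1 i" "z2 i"
    by (rule ingredient[OF i])
  have w: "w i = ing.w" by (simp add: w_def ing.w_def)
  show "w i \<noteq> x1 i" "w i \<noteq> x2 i" "w i \<noteq> z2 i" "w i \<noteq> x6 i" "w i \<noteq> x4 i" "w i \<noteq> z1 i" "w i \<noteq> x5 i"
    "{x2 i, w i} \<in> edges (Q i)" "w i \<in> core i"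
    using ing.w_distinct ing.w_edge unfolding w core_def by auto
qed

lemma in_core:
  assumes i: "i \<in> idx"
  shows "x1 i \<in> core i" "x4 i \<in> core i" "x5 i \<in> core i" "x6 i \<in> core i" "x2 i \<notin> core i" "z1 i \<notin> core i" "z2 i \<notin> core i"
  using ingredient.in_Q[OF ingredient[OF i]] port_distinct[OF i] by (auto simp: core_def)

definition "ring_edges i = [(Copy i (x1 i), Copy (nx i) (x4 (nx i))), (Copy i (x2 i), Copy i (w i)),
  (Copy i (x2 i), Copy (nx i) (x5 (nx i))), (Copy i (x2 i), hub i)]"

text \<open>These are the nineteen edges of \<open>H\<close> that do not lie inside a core. As a
  list, they turn the number of crossing edges into a sum of truth values.\<close>

definition "outer_edges = ring_edges 1 @ ring_edges 2 @ ring_edges 3 @ ring_edges 4 @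
  [(Copy 1 (x6 1), Copy 3 (x6 3)), (Copy 2 (x6 2), Copy 4 (x6 4)), (Vertex_p, Vertex_q)]"

lemma distinct_outer_edges: "distinct (map (\<lambda>(a, b). {a, b}) outer_edges)"
proof -
  note d = port_distinct[OF idx_members(1)] port_distinct[OF idx_members(2)] port_distinct[OF idx_members(3)] port_distinct[OF idx_members(4)]
    w_facts(1-7)[OF idx_members(1)] w_facts(1-7)[OF idx_members(2)] w_facts(1-7)[OF idx_members(3)] w_facts(1-7)[OF idx_members(4)]
  show ?thesis
    by (simp add: outer_edges_def ring_edges_def nx_values hub_def doubleton_eq_iff d d[symmetric])
qed

lemma outer_edges_in_H:
  assumes "(a, b) \<in> set outer_edges"
  shows "{a, b} \<in> edges H"
proof -
  have ring: "{s, t} \<in> edges H" if "i \<in> idx" "(s, t) \<in> set (ring_edges i)" for s t i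
  proof -
    have "{Copy i (x2 i), Copy i (w i)} \<in> edges H"
      using w_facts[OF that(1)] port_distinct[OF that(1)] that(1)
      by (intro in_edges_H(6)) (auto simp: doubleton_eq_iff)
    then show ?thesis using that(2) in_edges_H(1-4)[OF that(1)] by (auto simp: ring_edges_def)
  qed
  have "{Copy 1 (x6 1), Copy 3 (x6 3)} \<in> edges H" "{Copy 2 (x6 2), Copy 4 (x6 4)} \<in> edges H"
    using in_edges_H(3)[of 1] in_edges_H(3)[of 2] by (simp_all add: nx_values idx_members(1-4) insert_commute)
  moreover have "{Vertex_p, Vertex_q} \<in> edges H" by (simp add: edges_H)
  ultimately show ?thesis using assms ring[of 1 a b] ring[of 2 a b] ring[of 3 a b] ring[of 4 a b]
    by (auto simp: outer_edges_def idx_members(1-4))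
qed

lemma outer_edges_not_in_core:
  assumes "(a, b) \<in> set outer_edges" "u \<in> core i" "v \<in> core i"
  shows "{a, b} \<noteq> {Copy i u, Copy i v}"
  using assms in_core(5)[of 1] in_core(5)[of 2] in_core(5)[of 3] in_core(5)[of 4]
  by (auto simp: outer_edges_def ring_edges_def doubleton_eq_iff nx_values idx_members(1-4) hub_def)

text \<open>Every crossing edge is oriented away from \<open>U\<close> and so becomes an element of
  the cut. Orientation does not change the underlying edges, so distinct edges give distinct
  elements, and none of them lies inside a core.\<close>

lemma cut_H_ge_sum:
  assumes U: "U \<subseteq> verts H"
  shows "(\<Sum>i\<in>idx. card (core_cut i (trace U i)) + ring_crossings U i) + chord_crossings U 1 + chord_crossings U 2
    + crosses U Vertex_p Vertex_q \<le> card (cut H U)"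
proof -
  let ?edge = "\<lambda>(a, b). {a, b}"
  let ?P = "\<lambda>(a, b). (a \<in> U) \<noteq> (b \<in> U)"
  let ?orient = "\<lambda>(a, b). if a \<in> U then (a, b) else (b, a)"
  define X where "X = filter ?P outer_edges"
  define Out where "Out = set (map ?orient X)"
  define Inn where "Inn i = (\<lambda>(u, v). (Copy i u, Copy i v)) ` core_cut i (trace U i)" for i
  have "distinct (map ?edge X)"
    unfolding X_def by (rule distinct_map_filter[OF distinct_outer_edges])
  moreover have "map ?edge X = map ?edge (map ?orient X)" by (auto simp: insert_commute split: if_splits)
  ultimately have "distinct (map ?edge (map ?orient X))" by (simp only:)
  then have "distinct (map ?orient X)" by (rule distinct_map[THEN iffD1, THEN conjunct1])
  from distinct_card[OF this] have "card Out = length X" unfolding Out_def length_map .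
  also have "\<dots> = (\<Sum>t\<leftarrow>outer_edges. of_bool (?P t))"
    unfolding X_def by (rule length_filter_conv_sum_list)
  also have "\<dots> = ring_crossings U 1 + ring_crossings U 2 + ring_crossings U 3 + ring_crossings U 4
      + chord_crossings U 1 + chord_crossings U 2 + crosses U Vertex_p Vertex_q"
    unfolding outer_edges_def ring_edges_def ring_crossings_def chord_crossings_def crosses_def
    by (simp add: nx_values)
  finally have card_Out: "card Out = (\<Sum>i\<in>idx. ring_crossings U i) + chord_crossings U 1 + chord_crossings U 2
    + crosses U Vertex_p Vertex_q" by (simp add: idx_members(5))
  have Out_cut: "Out \<subseteq> cut H U"
    using outer_edges_in_H by (force simp: Out_def X_def cut_def insert_commute)
  have core_edge: "{Copy i u, Copy i v} \<in> edges H" if "i \<in> idx" "u \<in> core i" "v \<in> core i" "{u, v} \<in> edges (Q i)" for i u v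
    using that by (intro in_edges_H(6)) (auto simp: core_def)
  have Inn_cut: "Inn i \<subseteq> cut H U" if i: "i \<in> idx" for i
    using core_edge[OF i] by (auto simp: Inn_def core_cut_def trace_def cut_def)
  have card_Inn: "card (Inn i) = card (core_cut i (trace U i))" for i
    unfolding Inn_def by (rule card_image) (auto simp: inj_on_def)
  have finc: "finite (cut H U)" by (rule finite_cut[OF simple_H U])
  have fin_Inn: "finite (Inn i)" if "i \<in> idx" for i using Inn_cut[OF that] finc by (rule finite_subset)
  have fin_idx: "finite idx" by (simp add: idx_def)
  have "card (\<Union>i\<in>idx. Inn i) = (\<Sum>i\<in>idx. card (Inn i))"
  proof (rule card_UN_disjoint[OF fin_idx])
    show "\<forall>i\<in>idx. \<forall>j\<in>idx. i \<noteq> j \<longrightarrow> Inn i \<inter> Inn j = {}" by (auto simp: Inn_def)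
  qed (use fin_Inn in blast)
  moreover have "card ((\<Union>i\<in>idx. Inn i) \<union> Out) = card (\<Union>i\<in>idx. Inn i) + card Out"
  proof (rule card_Un_disjoint)
    show "finite (\<Union>i\<in>idx. Inn i)" using fin_idx fin_Inn by blast
    show "finite Out" by (simp add: Out_def)
    show "(\<Union>i\<in>idx. Inn i) \<inter> Out = {}"
    proof (rule equals0I)
      fix t assume t: "t \<in> (\<Union>i\<in>idx. Inn i) \<inter> Out"
      then obtain i u v where uv: "t = (Copy i u, Copy i v)" "u \<in> core i" "v \<in> core i"
        by (auto simp: Inn_def core_cut_def trace_def)
      obtain a b where ab: "(a, b) \<in> set outer_edges" "t = ?orient (a, b)"
        using t unfolding Out_def X_def by fastforce
      then have "{a, b} = {Copy i u, Copy i v}" using uv(1) by (auto split: if_splits)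
      with ab(1) show False using outer_edges_not_in_core[OF _ uv(2,3), of a b] by simp
    qed
  qed
  moreover have "card ((\<Union>i\<in>idx. Inn i) \<union> Out) \<le> card (cut H U)"
    using Out_cut Inn_cut finc by (intro card_mono) auto
  ultimately show ?thesis by (simp add: card_Inn card_Out sum.distrib)
qed

text \<open>The ring may be read from any summand: a chord is shared by opposite summands, and
  \<open>i\<close> and its successor always have the two different hubs.\<close>

lemma cut_H_ge:
  assumes U: "U \<subseteq> verts H" and i: "i \<in> idx"
    and j: "j = nx i" "k = nx j" "l = nx k"
  shows "card (core_cut i (trace U i)) + card (core_cut j (trace U j)) + card (core_cut k (trace U k))
    + card (core_cut l (trace U l)) + ring_crossings U i + ring_crossings U j + ring_crossings U k + ring_crossings U l
    + chord_crossings U i + chord_crossings U j + crosses U (hub i) (hub j) \<le> card (cut H U)"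
proof -
  have sum: "(\<Sum>m\<in>idx. f m) = f i + f j + f k + f l" for f :: "nat \<Rightarrow> nat"
    using index_cases[OF i] by (elim disjE) (simp_all add: idx_members(5) j nx_values)
  have "chord_crossings U (nx (nx m)) = chord_crossings U m" if "m \<in> idx" for m
    using that by (simp add: chord_crossings_def crosses_def eq_commute)
  from this[of 1] this[of 2] have "chord_crossings U i + chord_crossings U j = chord_crossings U 1 + chord_crossings U 2"
    using index_cases[OF i] by (elim disjE) (simp_all add: idx_members(1-4) j nx_values)
  moreover have "crosses U (hub i) (hub j) = crosses U Vertex_p Vertex_q"
    using i j even_nx[OF i] by (auto simp: hub_def crosses_def)
  ultimately show ?thesis using cut_H_ge_sum[OF U] unfolding sum by simp
qed

end

text \<open>Here \<open>D\<close> is the cut inside the only core that may be split,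
  \<open>X1, W, X4, X5, X6\<close> are the sides of its boundary vertices (all \<open>v0\<close> if
  it is not split), \<open>v1, v2, v3\<close> the sides of the other cores, \<open>y0\<close> to
  \<open>y3\<close> those of the vertices \<open>x2\<close>, and \<open>P, P'\<close> those of the
  hubs. The assumptions \<open>y\<close> and \<open>P\<close> express that the vertices
  \<open>x2\<close> and the hubs agree with a majority of their neighbours.\<close>

lemma ring_constant:
  fixes D :: nat and X1 W X4 X5 X6 v0 v1 v2 v3 y0 y1 y2 y3 P P' :: bool
  assumes sum: "D + (of_bool (X1 \<noteq> v1) + of_bool (y0 \<noteq> W) + of_bool (y0 \<noteq> v1) + of_bool (y0 \<noteq> P))
      + (of_bool (v1 \<noteq> v2) + of_bool (y1 \<noteq> v1) + of_bool (y1 \<noteq> v2) + of_bool (y1 \<noteq> P'))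
      + (of_bool (v2 \<noteq> v3) + of_bool (y2 \<noteq> v2) + of_bool (y2 \<noteq> v3) + of_bool (y2 \<noteq> P))
      + (of_bool (v3 \<noteq> X4) + of_bool (y3 \<noteq> v3) + of_bool (y3 \<noteq> X5) + of_bool (y3 \<noteq> P'))
      + of_bool (X6 \<noteq> v2) + of_bool (v1 \<noteq> v3) + of_bool (P \<noteq> P') \<le> 4"
    and D: "2 \<le> D \<or> (X1 = v0 \<and> W = v0 \<and> X6 = v0 \<and> X4 = v0 \<and> X5 = v0)"
    and y: "y0 = W \<or> y0 = v1" "y0 = v1 \<or> y0 = P" "y1 = v1 \<or> y1 = v2" "y2 = v2 \<or> y2 = v3" "y3 = v3 \<or> y3 = P'"
    and P: "P = y0 \<or> P = y2" "P = y2 \<or> P = P'" "P' = y1 \<or> P' = y3" "P' = y1 \<or> P' = P"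
  shows "v2 = v1 \<and> v3 = v1 \<and> y0 = v1 \<and> y1 = v1 \<and> y2 = v1 \<and> y3 = v1 \<and> P = v1 \<and> P' = v1"
proof -
  have tri: "of_bool (a \<noteq> c) \<le> of_bool (b \<noteq> a) + (of_bool (b \<noteq> c) :: nat)" for a b c :: bool
    by (cases a; cases b; cases c) simp_all
  \<comment> \<open>Each path through a vertex \<open>x2\<close> is cut at least once when its ends
    differ; this eliminates \<open>y0\<close> to \<open>y3\<close> and charges 2 to every change
    between consecutive unsplit cores.\<close>
  have "D + of_bool (X1 \<noteq> v1) + of_bool (W \<noteq> v1) + 2 * of_bool (v1 \<noteq> v2) + 2 * of_bool (v2 \<noteq> v3)
     + of_bool (v3 \<noteq> X4) + of_bool (v3 \<noteq> X5) + of_bool (X6 \<noteq> v2) + of_bool (v1 \<noteq> v3) \<le> 4"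
    using sum tri[of W v1 y0] tri[of v1 v2 y1] tri[of v2 v3 y2] tri[of v3 X5 y3] by linarith
  \<comment> \<open>If \<open>D\<close> is at least 2, one change costs 2 more and brings either a
    second change or the chord between \<open>v1\<close> and \<open>v3\<close>. If no core is split,
    the sides close up cyclically: two changes cost 4, and at least one chord is cut as
    well.\<close>
  then have v: "v2 = v1 \<and> v3 = v1"
    using D by (cases v1; cases v2; cases v3; cases v0; auto)
  then have y12: "y1 = v1" "y2 = v1" using y by auto
  show ?thesis
  proof (cases "P = v1")
    case True
    then have "P' = v1" using P y12 by blast
    then show ?thesis using True v y12 y by blast
  next
    case False
    then have "P' \<noteq> v1" "y0 \<noteq> v1" using P y12 by blast+
    then have "y3 \<noteq> v1" using P y12 by blast
    have "W \<noteq> v1" using y(1) \<open>y0 \<noteq> v1\<close> by blast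
    \<comment> \<open>The four edges are those from \<open>y0\<close> to \<open>v1\<close>, from
      \<open>y1\<close> to \<open>P'\<close>, from \<open>y2\<close> to \<open>P\<close> and from
      \<open>y3\<close> to \<open>v3\<close>. Nothing else may be cut, so the split core is constant
      with \<open>X1 = v1\<close>, whereas \<open>W \<noteq> v1\<close>.\<close>
    have "4 + D + of_bool (X1 \<noteq> v1) + of_bool (X4 \<noteq> v1) \<le> 4"
      using sum v y12 False \<open>P' \<noteq> v1\<close> \<open>y0 \<noteq> v1\<close> \<open>y3 \<noteq> v1\<close> by (cases v1) (auto split: if_splits)
    then show ?thesis using D \<open>W \<noteq> v1\<close> by auto
  qed
qed

section \<open>Smallest violating cuts of the ring\<close>

context ring_of_ingredients
begin

definition "constant_on U i \<longleftrightarrow> trace U i = {} \<or> trace U i = core i"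

lemma constant_onD:
  assumes i: "i \<in> idx" and c: "constant_on U i"
  obtains b where "\<And>v. v \<in> core i \<Longrightarrow> Copy i v \<in> U \<longleftrightarrow> b"
  using c unfolding constant_on_def trace_def by blast

definition "stable_set U \<longleftrightarrow> U \<subseteq> verts H \<and> card (cut H U) \<le> 4 \<and>
  (\<forall>v\<in>U. card (nbrs H v - U) \<le> 1) \<and> (\<forall>v\<in>verts H - U. card (nbrs H v - (verts H - U)) \<le> 1)"

lemma stable_complement: "stable_set U \<Longrightarrow> stable_set (verts H - U)"
  using cut_complement[OF simple_H, of U] unfolding stable_set_def by (auto simp: double_diff)

lemma stable_majority:
  assumes st: "stable_set U" and v: "v \<in> verts H" and ab: "a \<in> nbrs H v" "b \<in> nbrs H v" "a \<noteq> b"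
  shows "(v \<in> U) = (a \<in> U) \<or> (v \<in> U) = (b \<in> U)"
proof (rule ccontr)
  assume n: "\<not> ((v \<in> U) = (a \<in> U) \<or> (v \<in> U) = (b \<in> U))"
  have fin: "finite (nbrs H v)" by (rule finite_nbrs[OF simple_H])
  have one: "card A \<noteq> 2 \<or> \<not> A \<subseteq> B" if "card B \<le> 1" "finite B" for A B :: "'a hvert set"
    using card_mono[OF that(2), of A] that(1) by auto
  have "card {a, b} = 2" using ab(3) by simp
  moreover have "{a, b} \<subseteq> verts H" using ab nbrs_subset[OF simple_H] by blast
  ultimately show False
    using st v n ab fin one[of "nbrs H v - U" "{a, b}"] one[of "nbrs H v - (verts H - U)" "{a, b}"]
    unfolding stable_set_def by (cases "v \<in> U") auto
qed

text \<open>A lone vertex of a core keeps two neighbours in the core, both on the other side,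
  against stability. This supplies the size assumptions of \<open>inner_cut_bound\<close>.\<close>

lemma card_trace_ge_2:
  assumes st: "stable_set U" and i: "i \<in> idx" and ne: "trace U i \<noteq> {}"
  shows "2 \<le> card (trace U i)"
proof (rule ccontr)
  assume n: "\<not> 2 \<le> card (trace U i)"
  interpret ing: ingredient "Q i" "C1 i" "C2 i" "x1 i" "x2 i" "x4 i" "x5 i" "x6 i" "z1 i" "z2 i"
    by (rule ingredient[OF i])
  have R: "ing.R = core i" by (simp add: core_def ing.R_def)
  have "finite (trace U i)" by (rule finite_subset[of _ "verts (Q i)"]) (use ing.fin in \<open>auto simp: trace_def core_def\<close>)
  then have "card (trace U i) = 1" using n ne by (metis One_nat_def card_gt_0_iff less_2_cases not_le not_less_zero)
  then obtain v where v: "trace U i = {v}" by (auto simp: card_1_singleton_iff)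
  then have vc: "v \<in> core i" "Copy i v \<in> U" by (auto simp: trace_def)
  have sub: "Copy i ` (nbrs (Q i) v \<inter> core i) \<subseteq> nbrs H (Copy i v) - U"
  proof
    fix t assume "t \<in> Copy i ` (nbrs (Q i) v \<inter> core i)"
    then obtain u where u: "t = Copy i u" "u \<in> nbrs (Q i) v" "u \<in> core i" by auto
    then have "{Copy i v, Copy i u} \<in> edges H"
      using vc in_edges_H(6)[OF i, of v u] by (auto simp: nbrs_def core_def doubleton_eq_iff)
    moreover have "Copy i u \<notin> U"
    proof
      assume "Copy i u \<in> U"
      then have "u = v" using u(3) v by (auto simp: trace_def)
      then show False using u(2) not_in_nbrs[OF ing.simple] by simp
    qed
    ultimately show "t \<in> nbrs H (Copy i v) - U" using u(1) by (simp add: nbrs_def)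
  qed
  have "2 \<le> card (nbrs (Q i) v \<inter> core i)" using ing.card_nbrs_R[of v] vc R by simp
  also have "\<dots> = card (Copy i ` (nbrs (Q i) v \<inter> core i))" by (simp add: card_image inj_on_def)
  also have "\<dots> \<le> card (nbrs H (Copy i v) - U)"
    by (rule card_mono[OF _ sub]) (simp add: finite_nbrs[OF simple_H])
  finally show False using st vc(2) unfolding stable_set_def by fastforce
qed

lemma core_cut_bound:
  assumes st: "stable_set U" and i: "i \<in> idx" and nc: "\<not> constant_on U i"
  shows "2 \<le> card (core_cut i (trace U i))"
    and "card (core_cut i (trace U i)) = 2 \<Longrightarrow>
      (Copy i (x4 i) \<in> U) \<noteq> (Copy i (x5 i) \<in> U) \<and> (Copy i (x1 i) \<in> U) \<noteq> (Copy i (w i) \<in> U)"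
proof -
  interpret ing: ingredient "Q i" "C1 i" "C2 i" "x1 i" "x2 i" "x4 i" "x5 i" "x6 i" "z1 i" "z2 i"
    by (rule ingredient[OF i])
  have R: "ing.R = core i" by (simp add: core_def ing.R_def)
  have inner: "ing.inner S = core_cut i S" for S by (simp add: core_cut_def ing.inner_def R)
  have w: "ing.w = w i" by (simp add: w_def ing.w_def)
  have sub: "trace U i \<subseteq> core i" by (auto simp: trace_def)
  have "core i - trace U i = trace (verts H - U) i"
    using i by (auto simp: trace_def Copy_in_H core_def)
  then have "2 \<le> card (trace U i)" "2 \<le> card (core i - trace U i)"
    using card_trace_ge_2[OF st i] card_trace_ge_2[OF stable_complement[OF st] i] nc sub
    by (auto simp: constant_on_def)
  note b = ing.inner_cut_bound[unfolded R inner w, OF sub this]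
  show "2 \<le> card (core_cut i (trace U i))" by (rule b(1))
  show "card (core_cut i (trace U i)) = 2 \<Longrightarrow>
      (Copy i (x4 i) \<in> U) \<noteq> (Copy i (x5 i) \<in> U) \<and> (Copy i (x1 i) \<in> U) \<noteq> (Copy i (w i) \<in> U)"
    using b(2) in_core[OF i] w_facts(9)[OF i] by (simp add: trace_def)
qed

lemma constant_agree:
  assumes "i \<in> idx" "constant_on U i"
  shows "(Copy i (x4 i) \<in> U) = (Copy i (x5 i) \<in> U)" "(Copy i (x1 i) \<in> U) = (Copy i (w i) \<in> U)"
  using assms in_core[OF assms(1)] w_facts(9)[OF assms(1)] by (auto simp: constant_on_def trace_def)

text \<open>Two nonconstant summands already account for a cut of size 4, so no edge outside them is cut;
  but then the different sides of \<open>x4, x5\<close> and of \<open>x1, w\<close> force both ring neighbours to be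
  nonconstant as well.\<close>

lemma at_most_one_nonconstant:
  assumes st: "stable_set U" and i: "i \<in> idx" and nc: "\<not> constant_on U i" and m: "m \<in> idx" "m \<noteq> i"
  shows "constant_on U m"
proof (rule ccontr)
  assume nm: "\<not> constant_on U m"
  define j where "j = nx i"
  define k where "k = nx j"
  define l where "l = nx k"
  have idx: "j \<in> idx" "k \<in> idx" "l \<in> idx" and nl: "nx l = i" using i by (simp_all add: j_def k_def l_def)
  let ?D = "\<lambda>i. card (core_cut i (trace U i))"
  have "card (cut H U) \<le> 4" and "U \<subseteq> verts H" using st by (auto simp: stable_set_def)
  then have le: "?D i + ?D j + ?D k + ?D l + ring_crossings U i + ring_crossings U l \<le> 4"
    using cut_H_ge[OF _ i j_def k_def l_def, of U] by linarith
  have "m \<in> {j, k, l}" using m nx_orbit[OF i] by (auto simp: j_def k_def l_def)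
  then have "2 \<le> ?D j + ?D k + ?D l" using core_cut_bound(1)[OF st m(1) nm] by auto
  then have D: "?D i = 2" "?D j + ?D k + ?D l = 2" "ring_crossings U i = 0" "ring_crossings U l = 0"
    using le core_cut_bound(1)[OF st i nc] by linarith+
  have s: "(Copy i (x4 i) \<in> U) \<noteq> (Copy i (x5 i) \<in> U)" "(Copy i (x1 i) \<in> U) \<noteq> (Copy i (w i) \<in> U)"
    using core_cut_bound(2)[OF st i nc D(1)] by auto
  have "\<not> constant_on U j"
    using D(3) s constant_agree(1)[OF idx(1), of U]
    by (auto simp: ring_crossings_def crosses_def j_def[symmetric])
  moreover have "\<not> constant_on U l"
    using D(4) s constant_agree(2)[OF idx(3), of U]
    by (auto simp: ring_crossings_def crosses_def nl)
  ultimately have "2 \<le> ?D j" "2 \<le> ?D l" using core_cut_bound(1)[OF st] idx by auto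
  then show False using D(2) by linarith
qed

lemma ex_index_others_constant:
  assumes st: "stable_set U"
  obtains i where "i \<in> idx" "\<And>m. m \<in> idx \<Longrightarrow> m \<noteq> i \<Longrightarrow> constant_on U m"
proof (cases "\<exists>i\<in>idx. \<not> constant_on U i")
  case True
  then show ?thesis using that at_most_one_nonconstant[OF st] by blast
next
  case False
  then show ?thesis using that[of 1] by (auto simp: idx_members(1-4))
qed

text \<open>At most one core is split, so three cores each have a single side, and
  \<open>ring_constant\<close> applies with stability providing the majorities. Everything outside
  the core of \<open>i\<close> then lies on the common side \<open>s\<close>.\<close>

lemma stable_cut_traces:
  assumes st: "stable_set U"
  obtains i s where "i \<in> idx" "\<And>m v. m \<in> idx \<Longrightarrow> m \<noteq> i \<Longrightarrow> v \<in> core m \<Longrightarrow> (Copy m v \<in> U) = s"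
    "\<And>m. m \<in> idx \<Longrightarrow> (Copy m (x2 m) \<in> U) = s" "\<And>m. m \<in> idx \<Longrightarrow> (hub m \<in> U) = s"
proof -
  obtain i where i: "i \<in> idx" and const: "\<And>m. m \<in> idx \<Longrightarrow> m \<noteq> i \<Longrightarrow> constant_on U m"
    using ex_index_others_constant[OF st] by blast
  define j where "j = nx i"
  define k where "k = nx j"
  define l where "l = nx k"
  have idx: "j \<in> idx" "k \<in> idx" "l \<in> idx" and ne: "j \<noteq> i" "k \<noteq> i" "l \<noteq> i" and nl: "nx l = i"
    using i by (simp_all add: j_def k_def l_def)
  obtain v1 where v1: "\<And>v. v \<in> core j \<Longrightarrow> (Copy j v \<in> U) = v1"
    using constant_onD[OF idx(1) const[OF idx(1) ne(1)]] by blast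
  obtain v2 where v2: "\<And>v. v \<in> core k \<Longrightarrow> (Copy k v \<in> U) = v2"
    using constant_onD[OF idx(2) const[OF idx(2) ne(2)]] by blast
  obtain v3 where v3: "\<And>v. v \<in> core l \<Longrightarrow> (Copy l v \<in> U) = v3"
    using constant_onD[OF idx(3) const[OF idx(3) ne(3)]] by blast
  \<comment> \<open>The side \<open>v0\<close> has a meaning only if the core of \<open>i\<close> is
    constant; otherwise the first alternative holds for any \<open>v0\<close>.\<close>
  have D: "\<exists>v0. 2 \<le> card (core_cut i (trace U i)) \<or> ((Copy i (x1 i) \<in> U) = v0 \<and> (Copy i (w i) \<in> U) = v0 \<and>
     (Copy i (x6 i) \<in> U) = v0 \<and> (Copy i (x4 i) \<in> U) = v0 \<and> (Copy i (x5 i) \<in> U) = v0)"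
  proof (cases "constant_on U i")
    case True
    then show ?thesis using constant_onD[OF i True] in_core[OF i] w_facts(9)[OF i] by metis
  next
    case False
    then show ?thesis using core_cut_bound(1)[OF st i] by blast
  qed
  then obtain v0 where D0: "2 \<le> card (core_cut i (trace U i)) \<or> ((Copy i (x1 i) \<in> U) = v0 \<and> (Copy i (w i) \<in> U) = v0 \<and>
     (Copy i (x6 i) \<in> U) = v0 \<and> (Copy i (x4 i) \<in> U) = v0 \<and> (Copy i (x5 i) \<in> U) = v0)" by blast
  have U: "U \<subseteq> verts H" "card (cut H U) \<le> 4" using st by (auto simp: stable_set_def)
  have hubs: "hub k = (hub i :: 'a hvert)" "hub l = (hub j :: 'a hvert)"
    using i idx by (simp_all add: k_def l_def j_def)
  note c1 = v1[OF in_core(1)[OF idx(1)]] v1[OF in_core(2)[OF idx(1)]] v1[OF in_core(3)[OF idx(1)]]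
    v1[OF in_core(4)[OF idx(1)]] v1[OF w_facts(9)[OF idx(1)]]
  note c2 = v2[OF in_core(1)[OF idx(2)]] v2[OF in_core(2)[OF idx(2)]] v2[OF in_core(3)[OF idx(2)]]
    v2[OF in_core(4)[OF idx(2)]] v2[OF w_facts(9)[OF idx(2)]]
  note c3 = v3[OF in_core(1)[OF idx(3)]] v3[OF in_core(2)[OF idx(3)]] v3[OF in_core(3)[OF idx(3)]]
    v3[OF in_core(4)[OF idx(3)]] v3[OF w_facts(9)[OF idx(3)]]
  have maj_y: "(Copy m (x2 m) \<in> U) = (Copy m (w m) \<in> U) \<or> (Copy m (x2 m) \<in> U) = (Copy (nx m) (x5 (nx m)) \<in> U)"
    "(Copy m (x2 m) \<in> U) = (Copy m (w m) \<in> U) \<or> (Copy m (x2 m) \<in> U) = (hub m \<in> U)"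
    "(Copy m (x2 m) \<in> U) = (Copy (nx m) (x5 (nx m)) \<in> U) \<or> (Copy m (x2 m) \<in> U) = (hub m \<in> U)"
    if m: "m \<in> idx" for m
  proof -
    have "{Copy m (x2 m), Copy m (w m)} \<in> edges H"
      using w_facts[OF m] port_distinct[OF m] m by (intro in_edges_H(6)) (auto simp: doubleton_eq_iff)
    then have n: "Copy m (w m) \<in> nbrs H (Copy m (x2 m))" "Copy (nx m) (x5 (nx m)) \<in> nbrs H (Copy m (x2 m))"
      "hub m \<in> nbrs H (Copy m (x2 m))"
      using in_edges_H(2,4)[OF m] by (auto simp: nbrs_def)
    have V: "Copy m (x2 m) \<in> verts H" by (rule port_vertices_in_H(2)[OF m])
    show "(Copy m (x2 m) \<in> U) = (Copy m (w m) \<in> U) \<or> (Copy m (x2 m) \<in> U) = (Copy (nx m) (x5 (nx m)) \<in> U)"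
      by (rule stable_majority[OF st V n(1,2)]) (use m in simp)
    show "(Copy m (x2 m) \<in> U) = (Copy m (w m) \<in> U) \<or> (Copy m (x2 m) \<in> U) = (hub m \<in> U)"
      by (rule stable_majority[OF st V n(1,3)]) simp
    show "(Copy m (x2 m) \<in> U) = (Copy (nx m) (x5 (nx m)) \<in> U) \<or> (Copy m (x2 m) \<in> U) = (hub m \<in> U)"
      by (rule stable_majority[OF st V n(2,3)]) simp
  qed
  have maj_hub: "(hub m \<in> U) = (Copy m (x2 m) \<in> U) \<or> (hub m \<in> U) = (Copy (nx (nx m)) (x2 (nx (nx m))) \<in> U)"
    "(hub m \<in> U) = (Copy m (x2 m) \<in> U) \<or> (hub m \<in> U) = (hub (nx m) \<in> U)"
    "(hub m \<in> U) = (Copy (nx (nx m)) (x2 (nx (nx m))) \<in> U) \<or> (hub m \<in> U) = (hub (nx m) \<in> U)"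
    if m: "m \<in> idx" for m
    by (rule stable_majority[OF st hub_in_H]; use m in \<open>simp add: nbrs_hub\<close>)+
  have eq: "v2 = v1 \<and> v3 = v1 \<and> (Copy i (x2 i) \<in> U) = v1 \<and> (Copy j (x2 j) \<in> U) = v1 \<and> (Copy k (x2 k) \<in> U) = v1 \<and>
      (Copy l (x2 l) \<in> U) = v1 \<and> (hub i \<in> U) = v1 \<and> (hub j \<in> U) = v1"
  proof (rule ring_constant[OF _ D0])
    show "card (core_cut i (trace U i)) + (of_bool ((Copy i (x1 i) \<in> U) \<noteq> v1) + of_bool ((Copy i (x2 i) \<in> U) \<noteq> (Copy i (w i) \<in> U))
          + of_bool ((Copy i (x2 i) \<in> U) \<noteq> v1) + of_bool ((Copy i (x2 i) \<in> U) \<noteq> (hub i \<in> U)))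
      + (of_bool (v1 \<noteq> v2) + of_bool ((Copy j (x2 j) \<in> U) \<noteq> v1) + of_bool ((Copy j (x2 j) \<in> U) \<noteq> v2)
          + of_bool ((Copy j (x2 j) \<in> U) \<noteq> (hub j \<in> U)))
      + (of_bool (v2 \<noteq> v3) + of_bool ((Copy k (x2 k) \<in> U) \<noteq> v2) + of_bool ((Copy k (x2 k) \<in> U) \<noteq> v3)
          + of_bool ((Copy k (x2 k) \<in> U) \<noteq> (hub i \<in> U)))
      + (of_bool (v3 \<noteq> (Copy i (x4 i) \<in> U)) + of_bool ((Copy l (x2 l) \<in> U) \<noteq> v3)
          + of_bool ((Copy l (x2 l) \<in> U) \<noteq> (Copy i (x5 i) \<in> U)) + of_bool ((Copy l (x2 l) \<in> U) \<noteq> (hub j \<in> U)))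
      + of_bool ((Copy i (x6 i) \<in> U) \<noteq> v2) + of_bool (v1 \<noteq> v3) + of_bool ((hub i \<in> U) \<noteq> (hub j \<in> U)) \<le> 4"
      using cut_H_ge[OF U(1) i j_def k_def l_def] U(2)
      unfolding ring_crossings_def chord_crossings_def crosses_def
        j_def[symmetric] k_def[symmetric] l_def[symmetric] nl hubs c1 c2 c3
      by linarith
  qed (use maj_y[OF i] maj_y[OF idx(1)] maj_y[OF idx(2)] maj_y[OF idx(3)] maj_hub[OF i] maj_hub[OF idx(1)] in
      \<open>simp_all only: j_def[symmetric] k_def[symmetric] l_def[symmetric] nl hubs c1 c2 c3\<close>)
  have orbit: "m = i \<or> m = j \<or> m = k \<or> m = l" if "m \<in> idx" for m
    using that nx_orbit[OF i] by (auto simp: j_def k_def l_def)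
  show ?thesis
  proof (rule that[OF i, of v1])
    show "(Copy m v \<in> U) = v1" if "m \<in> idx" "m \<noteq> i" "v \<in> core m" for m v
      using orbit[OF that(1)] that(2,3) v1[of v] v2[of v] v3[of v] eq by (elim disjE) simp_all
    show "(Copy m (x2 m) \<in> U) = v1" if "m \<in> idx" for m
      using orbit[OF that] eq by (elim disjE) simp_all
    show "(hub m \<in> U) = v1" if "m \<in> idx" for m
      using orbit[OF that] eq hubs by (elim disjE) simp_all
  qed
qed

lemma well_separated_H: "well_separated H"
proof (rule ccontr)
  assume "\<not> well_separated H"
  then obtain U0 where U0: "U0 \<subseteq> verts H" "3 \<le> card U0" "3 \<le> card (verts H - U0)" "card (cut H U0) \<le> 4"
    "\<And>v. v \<in> U0 \<Longrightarrow> card (nbrs H v - U0) \<le> 1"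
    "\<And>v. v \<in> verts H - U0 \<Longrightarrow> card (nbrs H v - (verts H - U0)) \<le> 1"
    using ex_stable_cut[OF cubic_H] by metis
  have st: "stable_set U0" using U0 by (auto simp: stable_set_def)
  obtain i s where i: "i \<in> idx" and s: "\<And>m v. m \<in> idx \<Longrightarrow> m \<noteq> i \<Longrightarrow> v \<in> core m \<Longrightarrow> (Copy m v \<in> U0) = s"
    "\<And>m. m \<in> idx \<Longrightarrow> (Copy m (x2 m) \<in> U0) = s" "\<And>m. m \<in> idx \<Longrightarrow> (hub m \<in> U0) = s"
    using stable_cut_traces[OF st] by blast
  interpret ing: ingredient "Q i" "C1 i" "C2 i" "x1 i" "x2 i" "x4 i" "x5 i" "x6 i" "z1 i" "z2 i"
    by (rule ingredient[OF i])
  \<comment> \<open>Of the two sides this is the one that avoids the hubs; by the choice of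
    \<open>s\<close> it is contained in the core of \<open>i\<close>.\<close>
  define U where "U = (if s then verts H - U0 else U0)"
  have U: "U \<subseteq> verts H" "3 \<le> card U" "card (cut H U) \<le> 4"
    using U0 cut_complement[OF simple_H U0(1)] by (auto simp: U_def)
  define S where "S = trace U i"
  have S: "S \<subseteq> core i" by (auto simp: S_def trace_def)
  have SQ: "S \<subseteq> verts (Q i)" using S by (auto simp: core_def)
  have US: "U = Copy i ` S"
  proof (intro equalityI subsetI)
    fix t assume t: "t \<in> U"
    then have "t \<in> verts H" using U(1) by auto
    then show "t \<in> Copy i ` S"
    proof (cases rule: verts_H_cases)
      case (1 m v)
      have "v \<noteq> x2 m" using s(2)[OF 1(2)] t 1 by (auto simp: U_def split: if_splits)
      then have v: "v \<in> core m" using 1(3) by (auto simp: core_def)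
      have "m = i"
      proof (rule ccontr)
        assume "m \<noteq> i"
        then show False using s(1)[OF 1(2) _ v] t 1(1) by (auto simp: U_def split: if_splits)
      qed
      then show ?thesis using t v 1(1) by (auto simp: S_def trace_def)
    next
      case (2 m)
      then show ?thesis using s(3)[OF 2(2)] t by (auto simp: U_def split: if_splits)
    qed
  qed (auto simp: S_def trace_def)
  have "card S = card U" unfolding US by (rule card_image[symmetric]) (simp add: inj_on_def)
  \<comment> \<open>The vertices \<open>x2\<close>, \<open>z2\<close>, \<open>z1\<close> always lie
    outside the core, so the far side in \<open>Q i\<close> is large enough.\<close>
  moreover have "3 \<le> card (verts (Q i) - S)"
  proof -
    have "card {x2 i, z2 i, z1 i} = 3" using port_distinct[OF i] by auto
    moreover have "{x2 i, z2 i, z1 i} \<subseteq> verts (Q i) - S" using S in_core[OF i] ing.in_Q by auto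
    ultimately show ?thesis using card_mono[of "verts (Q i) - S" "{x2 i, z2 i, z1 i}"] ing.fin by auto
  qed
  ultimately have "5 \<le> card (cut (Q i) S)"
    using ing.ws U(2) SQ unfolding well_separated_def by auto
  also have "\<dots> = card ((\<lambda>(v, u). (Copy i v, port i v u)) ` cut (Q i) S)"
  proof (rule card_image[symmetric], rule inj_onI)
    fix p q assume p: "p \<in> cut (Q i) S" and q: "q \<in> cut (Q i) S"
      and e: "(case p of (v, u) \<Rightarrow> (Copy i v, port i v u)) = (case q of (v, u) \<Rightarrow> (Copy i v, port i v u))"
    obtain v u u' where pq: "p = (v, u)" "q = (v, u')" "port i v u = port i v u'"
      using e by (auto split: prod.splits)
    have "u \<in> nbrs (Q i) v" "u' \<in> nbrs (Q i) v" using p q pq by (auto simp: cut_def nbrs_def)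
    then show "p = q" using inj_onD[OF inj_port[OF i] pq(3)] pq by simp
  qed
  also have "\<dots> \<le> card (cut H U)"
  proof (rule card_mono[OF finite_cut[OF simple_H U(1)]], rule subsetI)
    fix t assume "t \<in> (\<lambda>(v, u). (Copy i v, port i v u)) ` cut (Q i) S"
    then obtain v u where t: "t = (Copy i v, port i v u)" and v: "v \<in> S" and u: "u \<notin> S" "{v, u} \<in> edges (Q i)"
      by (auto simp: cut_def)
    have "v \<in> verts (Q i) - {z1 i, z2 i}" using v S by (auto simp: core_def)
    then have e: "{Copy i v, port i v u} \<in> edges H" using u(2) by (intro port_edge[OF i]) (simp_all add: nbrs_def)
    have "port i v u \<notin> Copy i ` S"
    proof
      assume "port i v u \<in> Copy i ` S"
      then have "port i v u = Copy i u"
        using i by (auto simp: port_def hub_def split: if_splits)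
      then show False using \<open>port i v u \<in> Copy i ` S\<close> u(1) by auto
    qed
    then show "t \<in> cut H U" using t v e by (auto simp: cut_def US)
  qed
  finally show False using U(3) by simp
qed

end

section \<open>The graph H\<close>

lemma component_eq_induced:
  assumes "A \<in> components K"
  shows "A = induced_subgraph K (verts A)"
  using assms by (auto simp: components_def induced_subgraph_def)

lemma two_factor_component_induced:
  assumes F: "subgraph F G" and C: "C \<in> components F" "chordless G C"
  shows "C = induced_subgraph G (verts C)"
proof -
  have "edges C = {e \<in> edges F. e \<subseteq> verts C}"
    by (subst component_eq_induced[OF C(1)]) (simp add: induced_subgraph_def)
  then have "edges C = {e \<in> edges G. e \<subseteq> verts C}"
    using F C(2) by (auto simp: subgraph_def chordless_def)
  then show ?thesis by (simp add: induced_subgraph_def)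
qed

lemma ingredient_if_permutation_snark:
  assumes ps: "permutation_snark Q" and c5: "cyclically_edge_connected 5 Q" and tf: "permutation_two_factor Q F"
    and comp: "components F = {C1, C2}"
    and path: "is_path C1 [x1, x2, z2, x6]" "is_path C2 [x4, z1, x5]" and e: "{z1, z2} \<in> edges Q"
  shows "ingredient Q C1 C2 x1 x2 x4 x5 x6 z1 z2"
proof
  show cub: "cubic Q" and "\<not> three_edge_colorable Q"
    using ps by (auto simp: permutation_snark_def snark_def)
  show "well_separated Q" by (rule well_separated_if_cyclically_5_connected[OF cub c5])
  have F: "subgraph F Q" "verts F = verts Q" and two: "card (components F) = 2"
    and C: "\<And>C. C \<in> components F \<Longrightarrow> circuit C \<and> chordless Q C"
    using tf by (auto simp: permutation_two_factor_def two_factor_def)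
  show "circuit C1" "circuit C2" using C comp by auto
  show "C1 = induced_subgraph Q (verts C1)" "C2 = induced_subgraph Q (verts C2)"
    using C comp by (auto intro!: two_factor_component_induced[OF F(1)])
  show "verts Q = verts C1 \<union> verts C2"
  proof (intro equalityI subsetI)
    fix v assume "v \<in> verts Q"
    then have "induced_subgraph F {w \<in> verts F. reachable F v w} \<in> {C1, C2}"
      using in_components[of v F] F(2) comp by simp
    moreover have "v \<in> verts (induced_subgraph F {w \<in> verts F. reachable F v w})"
      using \<open>v \<in> verts Q\<close> F(2) by (simp add: induced_subgraph_def reachable_refl)
    ultimately show "v \<in> verts C1 \<union> verts C2" by auto
  next
    fix v assume "v \<in> verts C1 \<union> verts C2"
    then obtain C where "C \<in> components F" "v \<in> verts C" using comp by auto
    then show "v \<in> verts Q" using F(2) by (auto simp: components_def induced_subgraph_def)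
  qed
  have "C1 \<noteq> C2" using two comp by auto
  then show "verts C1 \<inter> verts C2 = {}"
    using components_eq_or_disjoint[of C1 F C2] comp by auto
qed (rule path e)+

section \<open>From glued half-edges to the ring of summands\<close>

lemma Old_in_Q_tilde: "Old v \<in> verts (Q_tilde Q x z) \<longleftrightarrow> v \<in> verts Q - {z 1, z 2}"
  by (auto simp: Q_tilde_def Let_def delete_vertices_def delete_edges_def induced_subgraph_def)

lemma Old_edge_in_Q_tilde:
  assumes "simple_graph Q"
  shows "{Old u, Old v} \<in> edges (Q_tilde Q x z) \<longleftrightarrow>
    {u, v} \<in> edges Q \<and> {u, v} \<noteq> {x 1, x 2} \<and> {u, v} \<inter> {z 1, z 2} = {}"
proof -
  have inj: "{Old u, Old v} = Old ` e \<longleftrightarrow> {u, v} = e" for e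
    using inj_image_eq_iff[of Old "{u, v}" e] by (simp add: inj_def)
  have "{Old u, Old v} \<in> edges (Q_tilde Q x z) \<longleftrightarrow>
      {u, v} \<in> edges Q - {{x 1, x 2}} \<and> {u, v} \<subseteq> verts Q - {z 1, z 2}"
    by (auto simp: Q_tilde_def Let_def delete_vertices_def delete_edges_def induced_subgraph_def
        image_iff inj doubleton_eq_iff)
  then show ?thesis using simple_edgeD[OF assms, of u v] by auto
qed

lemma half_edge_in_Q_tilde:
  "{Old u, Y s} \<in> edges (Q_tilde Q x z) \<longleftrightarrow> s = 3 \<and> u = x 2 \<or> s \<in> {1, 2, 4, 5, 6} \<and> u = x s"
proof -
  have "{Old u, Y s} \<noteq> Old ` e" for e by (auto simp: set_eq_iff)
  then show ?thesis by (auto simp: Q_tilde_def Let_def image_iff doubleton_eq_iff)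
qed

text \<open>The half-edges numbered 2 and 3 both start at \<open>x2\<close>, so their alternation in
  the gluing disappears when edges are named by their ends. All that remains of it is the hub to
  which \<open>x2\<close> is joined.\<close>

lemma ring_of_ingredients_H_graph:
  assumes ingr: "\<And>i. i \<in> idx \<Longrightarrow>
    ingredient (Q i) (C1 i) (C2 i) (x i 1) (x i 2) (x i 4) (x i 5) (x i 6) (z i 1) (z i 2)"
  shows "ring_of_ingredients Q C1 C2 (\<lambda>i. x i 1) (\<lambda>i. x i 2) (\<lambda>i. x i 4) (\<lambda>i. x i 5) (\<lambda>i. x i 6)
    (\<lambda>i. z i 1) (\<lambda>i. z i 2) (H_graph Q x z)"
proof (rule ring_of_ingredients.intro)
  let ?T = "\<lambda>i. Q_tilde (Q i) (x i) (z i)"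
  show "verts (H_graph Q x z) = {Copy i v | i v. i \<in> idx \<and> v \<in> verts (Q i) - {z i 1, z i 2}} \<union> {Vertex_p, Vertex_q}"
    by (simp add: H_graph_def Let_def Old_in_Q_tilde idx_def)
  have inner: "{{Copy i u, Copy i v} | i u v. i \<in> {1..4} \<and> {Old u, Old v} \<in> edges (?T i)} =
    {{Copy i u, Copy i v} | i u v. i \<in> idx \<and> {u, v} \<in> edges (Q i) \<and> {u, v} \<noteq> {x i 1, x i 2} \<and> {u, v} \<inter> {z i 1, z i 2} = {}}"
    unfolding idx_def[symmetric] using Old_edge_in_Q_tilde[OF ingredient.simple[OF ingr]]
    by (intro Collect_cong iff_exI conj_cong refl)
  let ?G = "{{Copy i u, Copy j v} | i s j t u v. ((i, s), (j, t)) \<in> glued_half_edges \<and>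
            {Old u, Y s} \<in> edges (?T i) \<and> {Old v, Y t} \<in> edges (?T j)}"
  have glue: "?G = {{Copy 1 (x 1 1), Copy 4 (x 4 4)}, {Copy 1 (x 1 2), Copy 4 (x 4 5)},
      {Copy 4 (x 4 1), Copy 3 (x 3 4)}, {Copy 4 (x 4 2), Copy 3 (x 3 5)},
      {Copy 3 (x 3 1), Copy 2 (x 2 4)}, {Copy 3 (x 3 2), Copy 2 (x 2 5)},
      {Copy 2 (x 2 1), Copy 1 (x 1 4)}, {Copy 2 (x 2 2), Copy 1 (x 1 5)},
      {Copy 1 (x 1 6), Copy 3 (x 3 6)}, {Copy 2 (x 2 6), Copy 4 (x 4 6)}}" (is "_ = ?E")
  proof (intro equalityI subsetI)
    fix e assume "e \<in> ?G"
    then obtain i s j t u v where g: "((i, s), (j, t)) \<in> glued_half_edges" and e: "e = {Copy i u, Copy j v}"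
      and "{Old u, Y s} \<in> edges (?T i)" "{Old v, Y t} \<in> edges (?T j)" by blast
    then have uv: "u = (if s = 3 then x i 2 else x i s)" "v = (if t = 3 then x j 2 else x j t)"
      by (auto simp: half_edge_in_Q_tilde)
    show "e \<in> ?E"
      using g unfolding glued_half_edges_def e uv by (elim insertE emptyE) simp_all
  next
    have half: "{Old (x i s), Y s} \<in> edges (?T i)" if "s \<in> {1, 2, 4, 5, 6}" for i s
      using that by (simp add: half_edge_in_Q_tilde)
    have half3: "{Old (x i 2), Y 3} \<in> edges (?T i)" for i by (simp add: half_edge_in_Q_tilde)
    have memb: "{Copy i u, Copy j v} \<in> ?G"
      if "((i, s), (j, t)) \<in> glued_half_edges" "{Old u, Y s} \<in> edges (?T i)" "{Old v, Y t} \<in> edges (?T j)" for i s j t u v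
      using that by blast
    fix e assume "e \<in> ?E"
    moreover have "{Copy 1 (x 1 1), Copy 4 (x 4 4)} \<in> ?G"
      by (rule memb[OF _ half half]) (simp_all add: glued_half_edges_def)
    moreover have "{Copy 1 (x 1 2), Copy 4 (x 4 5)} \<in> ?G"
      by (rule memb[OF _ half3 half]) (simp_all add: glued_half_edges_def)
    moreover have "{Copy 4 (x 4 1), Copy 3 (x 3 4)} \<in> ?G"
      by (rule memb[OF _ half half]) (simp_all add: glued_half_edges_def)
    moreover have "{Copy 4 (x 4 2), Copy 3 (x 3 5)} \<in> ?G"
      by (rule memb[OF _ half half]) (simp_all add: glued_half_edges_def)
    moreover have "{Copy 3 (x 3 1), Copy 2 (x 2 4)} \<in> ?G"
      by (rule memb[OF _ half half]) (simp_all add: glued_half_edges_def)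
    moreover have "{Copy 3 (x 3 2), Copy 2 (x 2 5)} \<in> ?G"
      by (rule memb[OF _ half3 half]) (simp_all add: glued_half_edges_def)
    moreover have "{Copy 2 (x 2 1), Copy 1 (x 1 4)} \<in> ?G"
      by (rule memb[OF _ half half]) (simp_all add: glued_half_edges_def)
    moreover have "{Copy 2 (x 2 2), Copy 1 (x 1 5)} \<in> ?G"
      by (rule memb[OF _ half half]) (simp_all add: glued_half_edges_def)
    moreover have "{Copy 1 (x 1 6), Copy 3 (x 3 6)} \<in> ?G"
      by (rule memb[OF _ half half]) (simp_all add: glued_half_edges_def)
    moreover have "{Copy 2 (x 2 6), Copy 4 (x 4 6)} \<in> ?G"
      by (rule memb[OF _ half half]) (simp_all add: glued_half_edges_def)
    ultimately show "e \<in> ?G" by (elim insertE emptyE) (simp_all only:)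
  qed
  have p: "{{Copy i u, Vertex_p} | i s u. (i, s) \<in> {(1, 2), (3, 2)} \<and> {Old u, Y s} \<in> edges (?T i)} =
      {{Copy 1 (x 1 2), Vertex_p}, {Copy 3 (x 3 2), Vertex_p}}"
    and q: "{{Copy i u, Vertex_q} | i s u. (i, s) \<in> {(2, 3), (4, 3)} \<and> {Old u, Y s} \<in> edges (?T i)} =
      {{Copy 2 (x 2 2), Vertex_q}, {Copy 4 (x 4 2), Vertex_q}}"
    unfolding half_edge_in_Q_tilde by auto
  have outer: "(\<Union>i\<in>idx. {{Copy i (x i 1), Copy (nx i) (x (nx i) 4)}, {Copy i (x i 2), Copy (nx i) (x (nx i) 5)},
         {Copy i (x i 6), Copy (nx (nx i)) (x (nx (nx i)) 6)}, {Copy i (x i 2), hub i}}) =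
      ?E \<union> {{Copy 1 (x 1 2), Vertex_p}, {Copy 3 (x 3 2), Vertex_p}} \<union> {{Copy 2 (x 2 2), Vertex_q}, {Copy 4 (x 4 2), Vertex_q}}"
    unfolding idx_members(5) by (auto simp: nx_values hub_def insert_commute)
  show "edges (H_graph Q x z) =
      {{Copy i u, Copy i v} | i u v. i \<in> idx \<and> {u, v} \<in> edges (Q i) \<and> {u, v} \<noteq> {x i 1, x i 2} \<and>
         {u, v} \<inter> {z i 1, z i 2} = {}} \<union>
      (\<Union>i\<in>idx. {{Copy i (x i 1), Copy (nx i) (x (nx i) 4)}, {Copy i (x i 2), Copy (nx i) (x (nx i) 5)},
         {Copy i (x i 6), Copy (nx (nx i)) (x (nx (nx i)) 6)}, {Copy i (x i 2), hub i}}) \<union>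
      {{Vertex_p, Vertex_q}}"
    unfolding outer inner[symmetric] glue[symmetric] p[symmetric] q[symmetric]
    by (simp add: H_graph_def Let_def Un_assoc)
qed (erule ingr)

theorem theorem2p23:
  fixes Q F C1 C2 :: "nat \<Rightarrow> 'a graph" and x z :: "nat \<Rightarrow> nat \<Rightarrow> 'a"
  assumes "\<And>i. i \<in> {1..4} \<Longrightarrow> permutation_snark (Q i)"
    and "\<And>i. i \<in> {1..4} \<Longrightarrow> cyclically_edge_connected 5 (Q i)"
    and "\<And>i. i \<in> {1..4} \<Longrightarrow> permutation_two_factor (Q i) (F i)"
    and "\<And>i. i \<in> {1..4} \<Longrightarrow> components (F i) = {C1 i, C2 i}"
    and "\<And>i. i \<in> {1..4} \<Longrightarrow> \<not> contained_in_CDC (Q i) (F i)"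
    and "\<And>i. i \<in> {1..4} \<Longrightarrow> is_path (C1 i) [x i 1, x i 2, z i 2, x i 6]"
    and "\<And>i. i \<in> {1..4} \<Longrightarrow> is_path (C2 i) [x i 4, z i 1, x i 5]"
    and "\<And>i. i \<in> {1..4} \<Longrightarrow> {z i 1, z i 2} \<in> edges (Q i)"
  shows "cyclically_edge_connected 5 (H_graph Q x z) \<and> permutation_snark (H_graph Q x z)"
proof -
  let ?H = "H_graph Q x z"
  interpret ring_of_ingredients Q C1 C2 "\<lambda>i. x i 1" "\<lambda>i. x i 2" "\<lambda>i. x i 4" "\<lambda>i. x i 5" "\<lambda>i. x i 6"
    "\<lambda>i. z i 1" "\<lambda>i. z i 2" ?H
    by (intro ring_of_ingredients_H_graph ingredient_if_permutation_snark[OF assms(1-4,6-8)]) (simp_all add: idx_def)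
  have c5: "cyclically_edge_connected 5 ?H"
    by (rule cyclically_5_connected_if_well_separated[OF cubic_H well_separated_H])
  then have "cyclically_edge_connected 4 ?H"
    unfolding cyclically_edge_connected_def by (rule order_trans[rotated]) simp
  moreover have "5 \<le> girth ?H"
    by (rule girth_ge_5_if_well_separated[OF cubic_H well_separated_H card_H_ge])
  ultimately have "snark ?H"
    using cubic_H not_three_edge_colorable_H by (simp add: snark_def)
  then show ?thesis using c5 cycle_permutation_graph_H by (simp add: permutation_snark_def)
qed

end
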